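(* Let $G$ be a countable amenable group and $X \subset \mathcal{A}^G$ a $G$-subshift over a finite alphabet $\mathcal{A}$. Let $F \subset G$ be finite, $v, w \in L_F(X)$, $\phi \in SV(X)$, and $\mu_\phi$ an equilibrium state for $\phi$. If $E_X(v) \subset E_X(w)$, then $\mu_\phi \circ \xi_{v,w}$ (the measure $A \mapsto \mu_\phi(\xi_{v,w}(A))$) is absolutely continuous with respect to $\mu_\phi$ when restricted to $[w]$, and for $\mu_\phi$-almost every $x \in [w]$, $$\frac{d(\mu_\phi \circ \xi_{v,w})}{d\mu_\phi}(x) \leq \exp\left( \sum_{g \in G} \big( \phi(\sigma_g(\xi_{v,w}(x))) - \phi(\sigma_g(x)) \big) \right).$$
   Context: $\mathcal{A}$ is a finite set with the discrete topology and $\mathcal{A}^G$ has the product topology. For $g \in G$ and $x \in \mathcal{A}^G$, $\sigma_g(x)_h = x_{gh}$ for all $h\in G$. A $G$-subshift is a closed set $X \subset \mathcal{A}^G$ with $\sigma_g(X) \subset X$ for all $g \in G$. For $H \subset G$, $x_H$ is the restriction of $x$ to $H$, and $F^c = G \setminus F$. For finite $F \subset G$, $L_F(X) = \{x_F : x \in X\}$. For $w \in L_F(X)$, $[w] = \{x \in X : x_F = w\}$ and $E_X(w) = \{\eta \in \mathcal{A}^{F^c} : w\eta \in X\}$, where $w\eta$ is the concatenation (equal to $w$ on $F$ and $\eta$ on $F^c$). The map $\xi_{v,w} : X \to X$ for $v,w \in L_F(X)$: if $x \in [v]$, then $\xi_{v,w}(x) = w x_{F^c}$ if $w x_{F^c}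 \in X$, and $\xi_{v,w}(x) = x$ otherwise; if $x \in [w]$, then $\xi_{v,w}(x) = v x_{F^c}$ if $v x_{F^c} \in X$, and $\xi_{v,w}(x)=x$ otherwise; if $x \notin [v] \cup [w]$, $\xi_{v,w}(x) = x$. It is a Borel isomorphism of $X$. A potential is a continuous function $\phi : X \to \mathbb{R}$. For $E \subset G$, $Var_E(\phi) = \sup\{\phi(x) - \phi(y) : x,y \in X,\ x_E = y_E\}$. An exhaustive sequence is a sequence of finite sets $E_1 \subset E_2 \subset \cdots$ with $\bigcup_n E_n = G$. A potential $\phi$ has summable variation, written $\phi \in SV(X)$, if there is an exhaustive sequence $\{E_n\}$ with $\sum_{n \in \mathbb{N}} |E_{n+1}^{-1} \setminus E_n^{-1}| \cdot Var_{E_n}(\phi) < \infty$. (For such $\phi$ the sum over $G$ in the claim converges absolutely.) $\mathcal{M}_\sigma(X)$ is the set of Borel probability measures on $X$ invariant under all $\sigma_g$; $h(\mu)$ is the Kolmogorov–Sinai entropy with respect to the $G$-action. An equilibrium state for $\phi$ is a $\mu \in \mathcal{M}_\sigma(X)$ maximizing $h(\mu) + \int \phi \, d\mu$ over $\mathcal{M}_\sigma(X)$. *)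

theory Defs
  imports "HOL-Probability.Probability"
begin

text \<open>
  The group is the type \<open>'g\<close>, written additively: the class \<open>group_add\<close> does not assume
  commutativity, so \<open>g + h\<close> is the product \<open>gh\<close> and \<open>- g\<close> is the inverse of \<open>g\<close>.
  The finite alphabet is the type \<open>'a\<close> with its discrete topology, and \<open>'g \<Rightarrow> 'a\<close> carries the
  product topology of the library.  A pattern on a set \<open>H\<close> is a function
  that is \<open>undefined\<close> outside \<open>H\<close> (as produced by \<open>restrict\<close>).
\<close>

section \<open>Amenability\<close>

text \<open>
  The shift maps below satisfy \<open>\<sigma>\<^sub>g \<circ> \<sigma>\<^sub>k = \<sigma>\<^sub>k\<^sub>g\<close>, so \<open>F \<mapsto> H(\<Or>\<^bsub>g\<in>F\<^esub> \<sigma>\<^sub>g\<^sup>-\<^sup>1 P)\<close> is invariant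
  under left translation of \<open>F\<close>; the averaging sets must therefore be almost invariant under
  right translation.  (A group has such a sequence iff it has one
  for left translation: replace each set by the set of inverses.)
\<close>

definition folner_sequence :: "(nat \<Rightarrow> 'g::group_add set) \<Rightarrow> bool" where
  "folner_sequence \<F> \<longleftrightarrow>
     (\<forall>n. finite (\<F> n) \<and> \<F> n \<noteq> {}) \<and>
     (\<forall>g. (\<lambda>n. real (card (sym_diff (\<F> n) ((\<lambda>h. h + g) ` \<F> n))) / real (card (\<F> n)))
            \<longlonglongrightarrow> 0)"

definition amenable :: "'g::{group_add, countable} itself \<Rightarrow> bool" where
  "amenable _ \<longleftrightarrow> (\<exists>\<F> :: nat \<Rightarrow> 'g set. folner_sequence \<F>)"

section \<open>Subshifts\<close>

definition shift_map :: "'g::group_add \<Rightarrow> ('g \<Rightarrow> 'a) \<Rightarrow> ('g \<Rightarrow> 'a)" where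
  "shift_map g x = (\<lambda>h. x (g + h))"

definition subshift :: "('g::group_add \<Rightarrow> 'a::{finite, discrete_topology}) set \<Rightarrow> bool" where
  "subshift X \<longleftrightarrow> closed X \<and> (\<forall>g. shift_map g ` X \<subseteq> X)"

definition language :: "('g \<Rightarrow> 'a) set \<Rightarrow> 'g set \<Rightarrow> ('g \<Rightarrow> 'a) set" where
  "language X F = (\<lambda>x. restrict x F) ` X"

definition cylinder :: "('g \<Rightarrow> 'a) set \<Rightarrow> 'g set \<Rightarrow> ('g \<Rightarrow> 'a) \<Rightarrow> ('g \<Rightarrow> 'a) set" where
  "cylinder X F w = {x \<in> X. restrict x F = w}"

text \<open>\<open>override_on \<eta> w F\<close> is the concatenation \<open>w\<eta>\<close>.\<close>

definition extender_set :: "('g \<Rightarrow> 'a) set \<Rightarrow> 'g set \<Rightarrow> ('g \<Rightarrow> 'a) \<Rightarrow> ('g \<Rightarrow> 'a) set" where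
  "extender_set X F w = {\<eta> \<in> extensional (- F). override_on \<eta> w F \<in> X}"

definition swap_map ::
  "('g \<Rightarrow> 'a) set \<Rightarrow> 'g set \<Rightarrow> ('g \<Rightarrow> 'a) \<Rightarrow> ('g \<Rightarrow> 'a) \<Rightarrow> ('g \<Rightarrow> 'a) \<Rightarrow> ('g \<Rightarrow> 'a)"
where
  "swap_map X F v w x =
     (if x \<in> cylinder X F v then
        (if override_on (restrict x (- F)) w F \<in> X
         then override_on (restrict x (- F)) w F else x)
      else if x \<in> cylinder X F w then
        (if override_on (restrict x (- F)) v F \<in> X
         then override_on (restrict x (- F)) v F else x)
      else x)"

section \<open>Potentials\<close>

text \<open>A potential on \<open>X\<close> is a function on the full shift of which only the values on \<open>X\<close> matter.\<close>

definition potential :: "('g \<Rightarrow> 'a::discrete_topology) set \<Rightarrow> (('g \<Rightarrow> 'a) \<Rightarrow> real) \<Rightarrow> bool" where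
  "potential X \<phi> \<longleftrightarrow> continuous_on X \<phi>"

definition variation :: "('g \<Rightarrow> 'a) set \<Rightarrow> 'g set \<Rightarrow> (('g \<Rightarrow> 'a) \<Rightarrow> real) \<Rightarrow> real" where
  "variation X E \<phi> = Sup {\<phi> x - \<phi> y | x y. x \<in> X \<and> y \<in> X \<and> restrict x E = restrict y E}"

definition exhaustive_sequence :: "(nat \<Rightarrow> 'g set) \<Rightarrow> bool" where
  "exhaustive_sequence E \<longleftrightarrow>
     (\<forall>n. finite (E n)) \<and> (\<forall>n. E n \<subseteq> E (Suc n)) \<and> (\<Union>n. E n) = UNIV"

definition summable_variation ::
  "('g::group_add \<Rightarrow> 'a::discrete_topology) set \<Rightarrow> (('g \<Rightarrow> 'a) \<Rightarrow> real) \<Rightarrow> bool"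
where
  "summable_variation X \<phi> \<longleftrightarrow>
     potential X \<phi> \<and>
     (\<exists>E. exhaustive_sequence E \<and>
        summable (\<lambda>n. real (card (uminus ` E (Suc n) - uminus ` E n)) * variation X (E n) \<phi>))"

section \<open>Entropy\<close>

definition partition_entropy :: "'x measure \<Rightarrow> 'x set set \<Rightarrow> real" where
  "partition_entropy M P = - (\<Sum>A\<in>P. measure M A * ln (measure M A))"

definition measurable_partition :: "'x measure \<Rightarrow> 'x set set \<Rightarrow> bool" where
  "measurable_partition M P \<longleftrightarrow> finite P \<and> P \<subseteq> sets M \<and> partition_on (space M) P"

definition dynamical_join ::
  "'x measure \<Rightarrow> ('g \<Rightarrow> 'x \<Rightarrow> 'x) \<Rightarrow> 'x set set \<Rightarrow> 'g set \<Rightarrow> 'x set set"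
where
  "dynamical_join M T P F =
     common_refinement ((\<lambda>g. (\<lambda>A. T g -` A \<inter> space M) ` P) ` F)"

text \<open>
  The normalised entropies converge to the same limit along every Folner sequence
  (Ornstein and Weiss); \<open>entropy_rate\<close> is this common limit.
\<close>

definition entropy_rate ::
  "'x measure \<Rightarrow> ('g::group_add \<Rightarrow> 'x \<Rightarrow> 'x) \<Rightarrow> 'x set set \<Rightarrow> real"
where
  "entropy_rate M T P =
     (THE l. \<forall>\<F>. folner_sequence \<F> \<longrightarrow>
        (\<lambda>n. partition_entropy M (dynamical_join M T P (\<F> n)) / real (card (\<F> n)))
          \<longlonglongrightarrow> l)"

definition ks_entropy :: "'x measure \<Rightarrow> ('g::group_add \<Rightarrow> 'x \<Rightarrow> 'x) \<Rightarrow> ereal" where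
  "ks_entropy M T = (SUP P\<in>{P. measurable_partition M P}. ereal (entropy_rate M T P))"

section \<open>Equilibrium states\<close>

definition invariant_measures ::
  "('g::group_add \<Rightarrow> 'a::discrete_topology) set \<Rightarrow> ('g \<Rightarrow> 'a) measure set"
where
  "invariant_measures X =
     {\<mu>. space \<mu> = X \<and> sets \<mu> = sets (restrict_space borel X) \<and> prob_space \<mu> \<and>
         (\<forall>g. distr \<mu> \<mu> (shift_map g) = \<mu>)}"

definition pressure_of ::
  "('g::group_add \<Rightarrow> 'a::discrete_topology) measure \<Rightarrow> (('g \<Rightarrow> 'a) \<Rightarrow> real) \<Rightarrow> ereal"
where
  "pressure_of \<mu> \<phi> = ks_entropy \<mu> shift_map + ereal (\<integral>x. \<phi> x \<partial>\<mu>)"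

definition equilibrium_state ::
  "('g::group_add \<Rightarrow> 'a::discrete_topology) set \<Rightarrow> (('g \<Rightarrow> 'a) \<Rightarrow> real)
     \<Rightarrow> ('g \<Rightarrow> 'a) measure \<Rightarrow> bool"
where
  "equilibrium_state X \<phi> \<mu> \<longleftrightarrow>
     \<mu> \<in> invariant_measures X \<and>
     (\<forall>\<nu>\<in>invariant_measures X. pressure_of \<nu> \<phi> \<le> pressure_of \<mu> \<phi>)"

text \<open>
  \<open>A \<mapsto> M (f A)\<close>, a measure on the same sigma-algebra when \<open>f\<close> is a Borel isomorphism
  of \<open>space M\<close>.
\<close>

definition image_measure :: "'x measure \<Rightarrow> ('x \<Rightarrow> 'x) \<Rightarrow> 'x measure" where
  "image_measure M f = measure_of (space M) (sets M) (\<lambda>A. emeasure M (f ` A))"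

end

theory Submission
  imports Defs "HOL-Real_Asymp.Real_Asymp"
begin

text \<open>
  Suppose that the occurrences of \<open>v\<close> are too frequent: \<open>\<mu>[v] > e\<^sup>s \<mu>[w]\<close>, where \<open>s\<close> bounds
  the energy \<open>\<Sum>\<^sub>g \<phi>(\<sigma>\<^sub>g x) - \<phi>(\<sigma>\<^sub>g y)\<close> that is lost when one \<open>v\<close> of \<open>x\<close> is replaced by \<open>w\<close>.
  Put independent marks of density \<open>p\<close> on the group and replace \<open>v\<close> by \<open>w\<close> at each marked
  occurrence of \<open>v\<close> that does not overlap another marked site; since every context of \<open>v\<close> is a
  context of \<open>w\<close>, the result has a law on \<open>X\<close>, which is invariant.  Up to \<open>o(p)\<close>
  the entropy per site grows by \<open>p \<mu>[v] (ln \<mu>[v] - ln \<mu>[w])\<close>: the choice of the replaced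
  occurrences is fresh randomness, and what the new configuration forgets is only which of its
  \<open>w\<close> are new.  The energy drops by at most \<open>p \<mu>[v] s\<close>, so the pressure would increase.

  Hence \<open>\<mu>[v] \<le> e\<^sup>s \<mu>[w]\<close>.  The hypothesis is inherited by all patterns that extend \<open>v\<close> and \<open>w\<close>
  by the same symbols, so this inequality holds on small cylinders, where \<open>s\<close> is almost the
  exponent of the claim; approximating Borel sets by cylinders gives the density bound.

  Entropy rates are handled without the quasi-tiling machinery: Shearer's inequality turns strong
  subadditivity of \<open>F \<mapsto> H(F)\<close> into convergence of \<open>H(F\<^sub>n) / |F\<^sub>n|\<close> to \<open>inf\<^sub>K H(K) / |K|\<close>.
\<close>

text \<open>Both the randomness gained and the randomness forgotten are of order p ln (1/p), so
  everything depends on their difference. Let m and b be the frequencies of v and w. Choosing the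
  replaced v brings about m p (1 - ln p) per site; guessing which w are new costs about m p (1 - ln
  (m p / b)) = m p (1 - ln p - ln m + ln b). The singular terms cancel and m p (ln m - ln b) is
  left.

  The obstacle is that replacements at different sites are not independent: a mark is discarded when
  a conflicting site is marked too, and this exclusion is what makes simultaneous replacement well
  defined. Therefore independence is used only for the pair of configuration and marks, whose
  entropy is exact. All other entropies are conditional ones, bounded from above and summed site by
  site, so correlations do no harm.

  The integral of the potential looks at the origin only, while replacements happen everywhere.
  Invariance of the measure moves each replacement to the origin, and the sum over the sites becomes
  the sum over the group in the exponent.\<close>

section \<open>Shannon entropy of finitely valued functions\<close>

definition eta :: "real \<Rightarrow> real" where
  "eta t = - t * ln t"

text \<open>Partitions are carried by functions: joins become pairs or tuples, and refinement
  becomes functional dependence.\<close>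

definition fibres :: "'x measure \<Rightarrow> ('x \<Rightarrow> 'b) \<Rightarrow> 'x set set" where
  "fibres M f = (\<lambda>x. f -` {f x} \<inter> space M) ` space M"

definition ent :: "'x measure \<Rightarrow> ('x \<Rightarrow> 'b) \<Rightarrow> real" where
  "ent M f = (\<Sum>a\<in>f ` space M. eta (measure M (f -` {a} \<inter> space M)))"

text \<open>The chain rule serves as definition, so that no conditional probability has to be
  formed.\<close>

definition cond_ent :: "'x measure \<Rightarrow> ('x \<Rightarrow> 'b) \<Rightarrow> ('x \<Rightarrow> 'c) \<Rightarrow> real" where
  "cond_ent M f g = ent M (\<lambda>x. (f x, g x)) - ent M g"

lemma eta_0 [simp]: "eta 0 = 0" and eta_1 [simp]: "eta 1 = 0"
  by (simp_all add: eta_def)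

lemma eta_nonneg: "0 \<le> t \<Longrightarrow> t \<le> 1 \<Longrightarrow> 0 \<le> eta t"
  by (cases "t = 0") (auto simp: eta_def mult_le_0_iff)

lemma eta_mult: "0 < a \<Longrightarrow> 0 < b \<Longrightarrow> eta (a * b) = a * eta b + b * eta a"
  by (simp add: eta_def ln_mult algebra_simps)

lemma eta_mult_nonneg: "0 \<le> a \<Longrightarrow> 0 \<le> b \<Longrightarrow> eta (a * b) = a * eta b + b * eta a"
  by (cases "a = 0"; cases "b = 0") (auto simp: eta_mult)

text \<open>Merging cells loses entropy: ln is increasing, so replacing \<open>ln (t i)\<close> by
  the logarithm of the total can only lower each summand on the right.\<close>

lemma eta_sum_le:
  assumes "finite S" "\<And>i. i \<in> S \<Longrightarrow> 0 \<le> t i"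
  shows "eta (\<Sum>i\<in>S. t i) \<le> (\<Sum>i\<in>S. eta (t i))"
proof -
  have "- t i * ln (\<Sum>i\<in>S. t i) \<le> eta (t i)" if i: "i \<in> S" for i
  proof (cases "t i = 0")
    case False
    then have pos: "0 < t i" using assms(2)[OF i] by simp
    have "t i \<le> (\<Sum>i\<in>S. t i)"
      using assms i by (intro member_le_sum) auto
    with pos have "ln (t i) \<le> ln (\<Sum>i\<in>S. t i)" by simp
    with pos show ?thesis by (simp add: eta_def)
  qed simp
  then have "(\<Sum>i\<in>S. - t i * ln (\<Sum>i\<in>S. t i)) \<le> (\<Sum>i\<in>S. eta (t i))"
    by (rule sum_mono)
  then show ?thesis
    by (simp add: eta_def sum_distrib_right sum_negf)
qed

text \<open>Conditional mutual information is nonnegative, here for an unnormalised weight p. The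
  weight is compared with r s / t, under which a and b are independent given c; the inequality
  \<open>ln x \<le> x - 1\<close> is applied to the ratio of the two, and their total masses
  agree.\<close>

lemma eta_submodular:
  fixes p :: "'a \<Rightarrow> 'b \<Rightarrow> 'c \<Rightarrow> real"
  assumes fin: "finite A" "finite B" "finite C"
    and nn: "\<And>a b c. a \<in> A \<Longrightarrow> b \<in> B \<Longrightarrow> c \<in> C \<Longrightarrow> 0 \<le> p a b c"
  shows "(\<Sum>a\<in>A. \<Sum>b\<in>B. \<Sum>c\<in>C. eta (p a b c)) + (\<Sum>c\<in>C. eta (\<Sum>a\<in>A. \<Sum>b\<in>B. p a b c))
    \<le> (\<Sum>a\<in>A. \<Sum>c\<in>C. eta (\<Sum>b\<in>B. p a b c)) + (\<Sum>b\<in>B. \<Sum>c\<in>C. eta (\<Sum>a\<in>A. p a b c))"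
proof -
  define r where "r a c = (\<Sum>b\<in>B. p a b c)" for a c
  define s where "s b c = (\<Sum>a\<in>A. p a b c)" for b c
  define t where "t c = (\<Sum>a\<in>A. \<Sum>b\<in>B. p a b c)" for c
  have t_r: "t c = (\<Sum>a\<in>A. r a c)" for c by (simp add: t_def r_def)
  have t_s: "t c = (\<Sum>b\<in>B. s b c)" for c unfolding t_def s_def by (rule sum.swap)
  have r0: "0 \<le> r a c" if "a \<in> A" "c \<in> C" for a c
    unfolding r_def using nn that by (auto intro!: sum_nonneg)
  have s0: "0 \<le> s b c" if "b \<in> B" "c \<in> C" for b c
    unfolding s_def using nn that by (auto intro!: sum_nonneg)
  have pr: "p a b c \<le> r a c" if "a \<in> A" "b \<in> B" "c \<in> C" for a b c
    unfolding r_def using nn that fin by (intro member_le_sum[of b B "\<lambda>b. p a b c"]) auto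
  have ps: "p a b c \<le> s b c" if "a \<in> A" "b \<in> B" "c \<in> C" for a b c
    unfolding s_def using nn that fin by (intro member_le_sum[of a A "\<lambda>a. p a b c"]) auto
  have rt: "r a c \<le> t c" if "a \<in> A" "c \<in> C" for a c
    unfolding t_r using r0 that fin by (intro member_le_sum[of a A "\<lambda>a. r a c"]) auto
  have t0: "0 \<le> t c" if "c \<in> C" for c
    unfolding t_r using r0 that by (auto intro!: sum_nonneg)
  have pt: "p a b c * (ln (r a c) + ln (s b c) - ln (p a b c) - ln (t c))
      \<le> r a c * s b c / t c - p a b c" if abc: "a \<in> A" "b \<in> B" "c \<in> C" for a b c
  proof (cases "p a b c = 0")
    case True
    then show ?thesis using r0 s0 t0 abc by simp
  next
    case False
    then have p: "0 < p a b c" using nn abc by (simp add: order_less_le)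
    have r: "0 < r a c" and s: "0 < s b c" using p pr ps abc by (auto intro: less_le_trans)
    have t: "0 < t c" using r rt abc by (auto intro: less_le_trans)
    have "ln (r a c) + ln (s b c) - ln (p a b c) - ln (t c)
        = ln (r a c * s b c / (p a b c * t c))"
      using p r s t by (simp add: ln_mult ln_div)
    also have "\<dots> \<le> r a c * s b c / (p a b c * t c) - 1"
      using p r s t by (intro ln_le_minus_one) simp
    finally have "p a b c * (ln (r a c) + ln (s b c) - ln (p a b c) - ln (t c))
       \<le> p a b c * (r a c * s b c / (p a b c * t c) - 1)"
      using p by (intro mult_left_mono) auto
    also have "\<dots> = r a c * s b c / t c - p a b c"
      using p by (simp add: field_simps)
    finally show ?thesis .
  qed
  have "(\<Sum>a\<in>A. \<Sum>b\<in>B. \<Sum>c\<in>C. p a b c * (ln (r a c) + ln (s b c) - ln (p a b c) - ln (t c)))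
    \<le> (\<Sum>a\<in>A. \<Sum>b\<in>B. \<Sum>c\<in>C. r a c * s b c / t c - p a b c)"
    by (intro sum_mono pt) auto
  also have "\<dots> = (\<Sum>c\<in>C. \<Sum>a\<in>A. \<Sum>b\<in>B. r a c * s b c / t c - p a b c)"
  proof -
    have "(\<Sum>a\<in>A. \<Sum>b\<in>B. \<Sum>c\<in>C. u a b c) = (\<Sum>c\<in>C. \<Sum>a\<in>A. \<Sum>b\<in>B. u a b c)" for u :: "'a \<Rightarrow> 'b \<Rightarrow> 'c \<Rightarrow> real"
      by (subst sum.swap[of _ C B], subst sum.swap[of _ C A]) simp
    then show ?thesis .
  qed
  \<comment> \<open>For each c both weights have mass \<open>t c\<close>; if \<open>t c = 0\<close>,
    division by zero yields 0 and the summand vanishes as well.\<close>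
  also have "\<dots> = (\<Sum>c\<in>C. t c * t c / t c - t c)"
  proof (rule sum.cong[OF refl])
    fix c
    have "(\<Sum>a\<in>A. \<Sum>b\<in>B. r a c * s b c / t c) = (\<Sum>a\<in>A. r a c) * (\<Sum>b\<in>B. s b c) / t c"
      by (simp add: sum_product sum_divide_distrib)
    then show "(\<Sum>a\<in>A. \<Sum>b\<in>B. r a c * s b c / t c - p a b c) = t c * t c / t c - t c"
      by (simp add: sum_subtractf t_r[symmetric] t_s[symmetric] t_def[symmetric])
  qed
  also have "\<dots> \<le> 0" by (intro sum_nonpos) auto
  finally have main: "(\<Sum>a\<in>A. \<Sum>b\<in>B. \<Sum>c\<in>C. p a b c * (ln (r a c) + ln (s b c) - ln (p a b c) - ln (t c))) \<le> 0" .
  have 1: "(\<Sum>a\<in>A. \<Sum>b\<in>B. \<Sum>c\<in>C. p a b c * ln (r a c)) = - (\<Sum>a\<in>A. \<Sum>c\<in>C. eta (r a c))"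
  proof -
    have "(\<Sum>b\<in>B. \<Sum>c\<in>C. p a b c * ln (r a c)) = (\<Sum>c\<in>C. r a c * ln (r a c))" for a
      by (subst sum.swap) (simp add: r_def sum_distrib_right)
    then show ?thesis by (simp add: eta_def sum_negf)
  qed
  have 2: "(\<Sum>a\<in>A. \<Sum>b\<in>B. \<Sum>c\<in>C. p a b c * ln (s b c)) = - (\<Sum>b\<in>B. \<Sum>c\<in>C. eta (s b c))"
  proof -
    have "(\<Sum>a\<in>A. \<Sum>c\<in>C. p a b c * ln (s b c)) = (\<Sum>c\<in>C. s b c * ln (s b c))" for b
      by (subst sum.swap) (simp add: s_def sum_distrib_right)
    then show ?thesis by (subst sum.swap) (simp add: eta_def sum_negf)
  qed
  have 3: "(\<Sum>a\<in>A. \<Sum>b\<in>B. \<Sum>c\<in>C. p a b c * ln (t c)) = - (\<Sum>c\<in>C. eta (t c))"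
  proof -
    have "(\<Sum>a\<in>A. \<Sum>b\<in>B. \<Sum>c\<in>C. p a b c * ln (t c)) = (\<Sum>c\<in>C. \<Sum>a\<in>A. \<Sum>b\<in>B. p a b c * ln (t c))"
      by (subst sum.swap[of _ C B], subst sum.swap[of _ C A]) simp
    also have "\<dots> = (\<Sum>c\<in>C. t c * ln (t c))" by (simp add: t_def sum_distrib_right)
    finally show ?thesis by (simp add: eta_def sum_negf)
  qed
  have "(\<Sum>a\<in>A. \<Sum>b\<in>B. \<Sum>c\<in>C. p a b c * (ln (r a c) + ln (s b c) - ln (p a b c) - ln (t c)))
    = (\<Sum>a\<in>A. \<Sum>b\<in>B. \<Sum>c\<in>C. p a b c * ln (r a c)) + (\<Sum>a\<in>A. \<Sum>b\<in>B. \<Sum>c\<in>C. p a b c * ln (s b c))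
     + (\<Sum>a\<in>A. \<Sum>b\<in>B. \<Sum>c\<in>C. eta (p a b c)) - (\<Sum>a\<in>A. \<Sum>b\<in>B. \<Sum>c\<in>C. p a b c * ln (t c))"
    by (simp add: eta_def sum.distrib sum_subtractf sum_negf algebra_simps)
  with main 1 2 3 have "(\<Sum>a\<in>A. \<Sum>b\<in>B. \<Sum>c\<in>C. eta (p a b c)) + (\<Sum>c\<in>C. eta (t c))
    \<le> (\<Sum>a\<in>A. \<Sum>c\<in>C. eta (r a c)) + (\<Sum>b\<in>B. \<Sum>c\<in>C. eta (s b c))" by linarith
  then show ?thesis by (simp add: r_def s_def t_def)
qed

lemma ent_superset:
  assumes "finite S" "f ` space M \<subseteq> S"
  shows "ent M f = (\<Sum>a\<in>S. eta (measure M (f -` {a} \<inter> space M)))"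
proof -
  have "f -` {a} \<inter> space M = {}" if "a \<notin> f ` space M" for a using that by auto
  then show ?thesis unfolding ent_def
    by (intro sum.mono_neutral_left assms) auto
qed

lemma ent_eq_sum_fibres: "ent M f = (\<Sum>A\<in>fibres M f. eta (measure M A))"
proof -
  have eq: "fibres M f = (\<lambda>a. f -` {a} \<inter> space M) ` (f ` space M)"
    unfolding fibres_def by (simp add: image_image)
  have "inj_on (\<lambda>a. f -` {a} \<inter> space M) (f ` space M)"
    by (auto simp: inj_on_def)
  then show ?thesis unfolding eq ent_def by (subst sum.reindex) auto
qed

lemma fibres_cong:
  assumes "\<And>x y. x \<in> space M \<Longrightarrow> y \<in> space M \<Longrightarrow> f x = f y \<longleftrightarrow> g x = g y"
  shows "fibres M f = fibres M g"
  unfolding fibres_def using assms by (intro image_cong) auto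

text \<open>Entropy sees only which points a function identifies. By this rule tuples, restrictions
  and reordered pairs are exchanged for one another.\<close>

lemma ent_cong_fibres:
  assumes "\<And>x y. x \<in> space M \<Longrightarrow> y \<in> space M \<Longrightarrow> f x = f y \<longleftrightarrow> g x = g y"
  shows "ent M f = ent M g"
  unfolding ent_eq_sum_fibres by (rule arg_cong[OF fibres_cong[OF assms]])

definition tuple :: "('i \<Rightarrow> 'x \<Rightarrow> 'b) \<Rightarrow> 'i set \<Rightarrow> 'x \<Rightarrow> 'i \<Rightarrow> 'b" where
  "tuple f I x = restrict (\<lambda>i. f i x) I"

lemma tuple_eq_iff: "tuple f I x = tuple g I y \<longleftrightarrow> (\<forall>i\<in>I. f i x = g i y)"
  unfolding tuple_def by (auto simp: fun_eq_iff restrict_def)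

lemma simple_function_tuple:
  assumes "finite I" "\<And>i. i \<in> I \<Longrightarrow> simple_function M (f i)"
  shows "simple_function M (tuple f I)"
proof -
  let ?g = "tuple f I"
  have "?g ` space M \<subseteq> (\<Pi>\<^sub>E i\<in>I. f i ` space M)" by (auto simp: tuple_def)
  moreover have "finite (\<Pi>\<^sub>E i\<in>I. f i ` space M)"
    using assms by (intro finite_PiE) (auto dest: simple_functionD)
  ultimately have fin: "finite (?g ` space M)" by (rule finite_subset)
  have "?g -` {a} \<inter> space M \<in> sets M" if a: "a \<in> ?g ` space M" for a
  \<comment> \<open>An empty intersection would be \<open>UNIV\<close> instead of
    \<open>space M\<close>.\<close>
  proof (cases "I = {}")
    case True
    then have "?g -` {a} \<inter> space M = space M" using a by (auto simp: tuple_def restrict_def)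
    then show ?thesis by simp
  next
    case False
    have "?g -` {a} \<inter> space M = (\<Inter>i\<in>I. f i -` {a i} \<inter> space M)"
      using False a by (auto simp: tuple_def fun_eq_iff restrict_def) (metis)+
    also have "\<dots> \<in> sets M"
      using assms False by (intro sets.finite_INT) (auto dest: simple_functionD)
    finally show ?thesis .
  qed
  with fin show ?thesis unfolding simple_function_def by auto
qed

lemma vimage_Int_sets:
  assumes "simple_function M f" "A \<in> sets M"
  shows "f -` {a} \<inter> A \<in> sets M"
proof -
  have "f -` {a} \<inter> A = (f -` {a} \<inter> space M) \<inter> A"
    using sets.sets_into_space[OF assms(2)] by auto
  then show ?thesis using simple_functionD(2)[OF assms(1)] assms(2) by auto
qed

text \<open>A function of g factors through g by choosing representatives. Most measurability goals
  below reduce to this: it is enough to name a simple function that determines the one in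
  question.\<close>

lemma simple_function_determined:
  assumes "simple_function M g"
    and "\<And>x y. x \<in> space M \<Longrightarrow> y \<in> space M \<Longrightarrow> g x = g y \<Longrightarrow> f x = f y"
  shows "simple_function M f"
proof -
  define h where "h b = f (SOME x. x \<in> space M \<and> g x = b)" for b
  have "f x = (h \<circ> g) x" if x: "x \<in> space M" for x
  proof -
    have "(SOME y. y \<in> space M \<and> g y = g x) \<in> space M \<and> g (SOME y. y \<in> space M \<and> g y = g x) = g x"
      by (rule someI_ex) (use x in blast)
    then show ?thesis using assms(2)[OF x] unfolding h_def comp_def by metis
  qed
  then show ?thesis
    using simple_function_compose1[OF assms(1), of h] simple_function_cong[of M f "h \<circ> g"]
    by (auto simp: comp_def)
qed

context prob_space
begin

lemma measure_eq_sum_fibres: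
  assumes f: "simple_function M f" and A: "A \<in> sets M"
  shows "measure M A = (\<Sum>a\<in>f ` space M. measure M (f -` {a} \<inter> A))"
proof -
  have eq: "f -` {a} \<inter> A = (f -` {a} \<inter> space M) \<inter> A" for a
    using sets.sets_into_space[OF A] by auto
  have "A = (\<Union>a\<in>f ` space M. f -` {a} \<inter> A)"
    using sets.sets_into_space[OF A] by auto
  then have "measure M A = measure M (\<Union>a\<in>f ` space M. f -` {a} \<inter> A)" by simp
  also have "\<dots> = (\<Sum>a\<in>f ` space M. measure M (f -` {a} \<inter> A))"
  proof (rule finite_measure_finite_Union)
    show "finite (f ` space M)" using f by (auto dest: simple_functionD)
    show "(\<lambda>a. f -` {a} \<inter> A) ` f ` space M \<subseteq> sets M"
      unfolding eq using simple_functionD(2)[OF f] A by auto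
    show "disjoint_family_on (\<lambda>a. f -` {a} \<inter> A) (f ` space M)"
      by (auto simp: disjoint_family_on_def)
  qed
  finally show ?thesis .
qed

lemma ent_nonneg: "0 \<le> ent M f"
  unfolding ent_def by (intro sum_nonneg eta_nonneg) auto

lemma ent_Pair_eq:
  assumes f: "simple_function M f" and g: "simple_function M g"
  shows "ent M (\<lambda>x. (f x, g x)) =
    (\<Sum>a\<in>f ` space M. \<Sum>b\<in>g ` space M. eta (measure M (f -` {a} \<inter> (g -` {b} \<inter> space M))))"
proof -
  have "ent M (\<lambda>x. (f x, g x)) = (\<Sum>ab\<in>f ` space M \<times> g ` space M.
      eta (measure M ((\<lambda>x. (f x, g x)) -` {ab} \<inter> space M)))"
    by (rule ent_superset) (use f g in \<open>auto dest: simple_functionD\<close>)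
  also have "\<dots> = (\<Sum>(a, b)\<in>f ` space M \<times> g ` space M. eta (measure M (f -` {a} \<inter> (g -` {b} \<inter> space M))))"
    by (intro sum.cong refl) (auto intro!: arg_cong[where f="\<lambda>A. eta (measure M A)"])
  finally show ?thesis by (simp add: sum.cartesian_product)
qed

lemma ent_submodular:
  assumes f: "simple_function M f" and g: "simple_function M g" and h: "simple_function M h"
  shows "ent M (\<lambda>x. (f x, g x, h x)) + ent M h \<le> ent M (\<lambda>x. (f x, h x)) + ent M (\<lambda>x. (g x, h x))"
proof -
  define p where "p a b c = measure M (f -` {a} \<inter> (g -` {b} \<inter> (h -` {c} \<inter> space M)))" for a b c
  note sf = simple_functionD[OF f] simple_functionD[OF g] simple_functionD[OF h]
  let ?A = "f ` space M" and ?B = "g ` space M" and ?C = "h ` space M"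
  have int: "f -` {a} \<inter> A \<in> sets M" "g -` {b} \<inter> A \<in> sets M" "h -` {c} \<inter> A \<in> sets M" if "A \<in> sets M" for a b c A
  using that by (auto intro: vimage_Int_sets f g h)
  have fgh: "ent M (\<lambda>x. (f x, g x, h x)) = (\<Sum>a\<in>?A. \<Sum>b\<in>?B. \<Sum>c\<in>?C. eta (p a b c))"
  proof -
    have "ent M (\<lambda>x. (f x, g x, h x)) = (\<Sum>abc\<in>?A \<times> ?B \<times> ?C.
        eta (measure M ((\<lambda>x. (f x, g x, h x)) -` {abc} \<inter> space M)))"
      by (rule ent_superset) (use sf in auto)
    also have "\<dots> = (\<Sum>(a, b, c)\<in>?A \<times> ?B \<times> ?C. eta (p a b c))"
      unfolding p_def by (intro sum.cong refl) (auto intro!: arg_cong[where f="\<lambda>A. eta (measure M A)"])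
    finally show ?thesis by (simp add: sum.cartesian_product)
  qed
  have fh: "ent M (\<lambda>x. (f x, h x)) = (\<Sum>a\<in>?A. \<Sum>c\<in>?C. eta (\<Sum>b\<in>?B. p a b c))"
  proof -
    have "measure M (f -` {a} \<inter> (h -` {c} \<inter> space M)) = (\<Sum>b\<in>?B. p a b c)" for a c
      unfolding p_def by (subst measure_eq_sum_fibres[OF g]) (auto intro!: int sum.cong arg_cong[where f="measure M"])
    then show ?thesis by (simp add: ent_Pair_eq f h)
  qed
  have gh': "measure M (g -` {b} \<inter> (h -` {c} \<inter> space M)) = (\<Sum>a\<in>?A. p a b c)" for b c
    unfolding p_def by (subst measure_eq_sum_fibres[OF f]) (auto intro!: int)
  then have gh: "ent M (\<lambda>x. (g x, h x)) = (\<Sum>b\<in>?B. \<Sum>c\<in>?C. eta (\<Sum>a\<in>?A. p a b c))"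
    by (simp add: ent_Pair_eq g h)
  have "measure M (h -` {c} \<inter> space M) = (\<Sum>a\<in>?A. \<Sum>b\<in>?B. p a b c)" for c
    by (subst sum.swap, subst measure_eq_sum_fibres[OF g]) (auto intro!: int simp: gh')
  then have hh: "ent M h = (\<Sum>c\<in>?C. eta (\<Sum>a\<in>?A. \<Sum>b\<in>?B. p a b c))"
    by (simp add: ent_def)
  show ?thesis unfolding fgh fh gh hh
    by (rule eta_submodular) (use sf in \<open>auto simp: p_def\<close>)
qed

lemma ent_mono:
  assumes g: "simple_function M g"
    and "\<And>x y. x \<in> space M \<Longrightarrow> y \<in> space M \<Longrightarrow> g x = g y \<Longrightarrow> f x = f y"
  shows "ent M f \<le> ent M g"
proof -
  have f: "simple_function M f" using assms by (rule simple_function_determined)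
  have "measure M (f -` {a} \<inter> space M) = (\<Sum>b\<in>g ` space M. measure M (f -` {a} \<inter> (g -` {b} \<inter> space M)))" for a
    by (subst measure_eq_sum_fibres[OF g])
      (auto intro!: sum.cong arg_cong[where f="measure M"] simple_functionD[OF f])
  then have "ent M f \<le> ent M (\<lambda>x. (f x, g x))"
    unfolding ent_Pair_eq[OF f g] unfolding ent_def
    by (auto intro!: sum_mono eta_sum_le simp: simple_functionD[OF g])
  also have "\<dots> = ent M g"
    by (intro ent_cong_fibres) (simp only: prod.inject, blast intro: assms(2))
  finally show ?thesis .
qed

lemma ent_le_ln_card:
  assumes f: "simple_function M f" and "finite S" "f ` space M \<subseteq> S"
  shows "ent M f \<le> ln (real (card S))"
proof -
  let ?n = "real (card (f ` space M))"
  have fin: "finite (f ` space M)" using f by (auto dest: simple_functionD)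
  have n: "0 < ?n" using fin not_empty by (auto simp: card_gt_0_iff)
  \<comment> \<open>The right side is the tangent of the concave function \<open>eta\<close> at
    \<open>1 / ?n\<close>; summed over the \<open>?n\<close> values, the corrections in parentheses
    cancel.\<close>
  have "eta t \<le> t * ln ?n + (1 / ?n - t)" if "0 \<le> t" for t
  proof (cases "t = 0")
    case True then show ?thesis using n by simp
  next
    case False
    with that have t: "0 < t" by simp
    have "ln (1 / (?n * t)) \<le> 1 / (?n * t) - 1" using n t by (intro ln_le_minus_one) simp
    then have "t * ln (1 / (?n * t)) \<le> t * (1 / (?n * t) - 1)" using t by (intro mult_left_mono) auto
    moreover have "ln (1 / (?n * t)) = - ln ?n - ln t" using n t by (simp add: ln_div ln_mult)
    moreover have "t * (1 / (?n * t) - 1) = 1 / ?n - t" using n t by (simp add: field_simps)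
    ultimately have "t * (- ln ?n - ln t) \<le> 1 / ?n - t" by (simp only:)
    then show ?thesis by (simp add: eta_def right_diff_distrib)
  qed
  then have "ent M f \<le> (\<Sum>a\<in>f ` space M. measure M (f -` {a} \<inter> space M) * ln ?n + (1 / ?n - measure M (f -` {a} \<inter> space M)))"
    unfolding ent_def by (intro sum_mono) auto
  also have "\<dots> = ln ?n"
    using measure_eq_sum_fibres[OF f sets.top] n
    by (simp add: sum.distrib sum_subtractf sum_distrib_right[symmetric] prob_space)
  also have "\<dots> \<le> ln (real (card S))"
    using n card_mono[OF assms(2,3)] by (intro ln_mono) auto
  finally show ?thesis .
qed

text \<open>Submodularity in its working form: conditioning on more lowers the entropy. As g is a
  function of h, appending g to h changes no entropy.\<close>

lemma cond_ent_antimono: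
  assumes f: "simple_function M f" and h: "simple_function M h"
    and det: "\<And>x y. x \<in> space M \<Longrightarrow> y \<in> space M \<Longrightarrow> h x = h y \<Longrightarrow> g x = g y"
  shows "cond_ent M f h \<le> cond_ent M f g"
proof -
  have g: "simple_function M g" using h det by (rule simple_function_determined)
  have "ent M (\<lambda>x. (f x, h x, g x)) = ent M (\<lambda>x. (f x, h x))" "ent M (\<lambda>x. (h x, g x)) = ent M h"
    by (intro ent_cong_fibres; simp only: prod.inject; blast intro: det)+
  with ent_submodular[OF f h g] show ?thesis unfolding cond_ent_def by simp
qed

lemma cond_ent_mono:
  assumes f: "simple_function M f" and g: "simple_function M g"
    and "\<And>x y. x \<in> space M \<Longrightarrow> y \<in> space M \<Longrightarrow> f x = f y \<Longrightarrow> g x = g y \<Longrightarrow> f' x = f' y"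
  shows "cond_ent M f' g \<le> cond_ent M f g"
proof -
  have "ent M (\<lambda>x. (f' x, g x)) \<le> ent M (\<lambda>x. (f x, g x))"
    by (rule ent_mono[OF simple_function_Pair[OF f g]]) (simp only: prod.inject, blast intro: assms(3))
  then show ?thesis by (simp add: cond_ent_def)
qed

lemma cond_ent_le_ent:
  assumes f: "simple_function M f" and g: "simple_function M g"
  shows "cond_ent M f g \<le> ent M f"
proof -
  have "cond_ent M f g \<le> cond_ent M f (\<lambda>_. ())" by (rule cond_ent_antimono[OF f g]) auto
  also have "ent M (\<lambda>x. (f x, ())) = ent M f" by (intro ent_cong_fibres) auto
  then have "cond_ent M f (\<lambda>_. ()) \<le> ent M f" unfolding cond_ent_def using ent_nonneg[of "\<lambda>_. ()"] by simp
  finally show ?thesis .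
qed

lemma cond_ent_Pair_le:
  assumes f: "simple_function M f" and f': "simple_function M f'" and g: "simple_function M g"
  shows "cond_ent M (\<lambda>x. (f x, f' x)) g \<le> cond_ent M f g + cond_ent M f' g"
proof -
  have "ent M (\<lambda>x. ((f x, f' x), g x)) = ent M (\<lambda>x. (f x, f' x, g x))"
    by (intro ent_cong_fibres) auto
  then show ?thesis using ent_submodular[OF f f' g] unfolding cond_ent_def by simp
qed

text \<open>The source of all sitewise bounds: subadditivity holds under any common conditioning and
  for arbitrarily dependent variables.\<close>

lemma cond_ent_tuple_le:
  assumes "finite I" "\<And>i. i \<in> I \<Longrightarrow> simple_function M (f i)" and g: "simple_function M g"
  shows "cond_ent M (tuple f I) g \<le> (\<Sum>i\<in>I. cond_ent M (f i) g)"
  using assms(1,2)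
proof (induction I rule: finite_induct)
  case empty
  have "ent M (\<lambda>x. (tuple f {} x, g x)) = ent M g"
    by (intro ent_cong_fibres) (auto simp: tuple_eq_iff)
  then show ?case by (simp add: cond_ent_def)
next
  case (insert i I)
  have fi: "simple_function M (f i)" by (rule insert.prems) simp
  have fI: "simple_function M (tuple f I)"
    using insert.hyps(1) insert.prems by (intro simple_function_tuple) blast+
  have "cond_ent M (tuple f (insert i I)) g \<le> cond_ent M (\<lambda>x. (f i x, tuple f I x)) g"
    by (rule cond_ent_mono[OF simple_function_Pair[OF fi fI] g]) (auto simp: tuple_eq_iff)
  also have "\<dots> \<le> cond_ent M (f i) g + cond_ent M (tuple f I) g"
    by (rule cond_ent_Pair_le[OF fi fI g])
  also have "cond_ent M (tuple f I) g \<le> (\<Sum>i\<in>I. cond_ent M (f i) g)"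
    by (rule insert.IH) (rule insert.prems, erule insertI2)
  finally show ?case using insert.hyps by simp
qed

lemma ent_unit [simp]: "ent M (\<lambda>_. c) = 0"
proof -
  have "(\<lambda>_. c) ` space M = {c}" using not_empty by auto
  then show ?thesis by (simp add: ent_def prob_space)
qed

lemma cond_ent_unit [simp]: "cond_ent M f (\<lambda>_. c) = ent M f"
proof -
  have "ent M (\<lambda>x. (f x, c)) = ent M f" by (intro ent_cong_fibres) auto
  then show ?thesis by (simp add: cond_ent_def)
qed

lemma ent_tuple_le:
  assumes "finite I" "\<And>i. i \<in> I \<Longrightarrow> simple_function M (f i)"
  shows "ent M (tuple f I) \<le> (\<Sum>i\<in>I. ent M (f i))"
  using cond_ent_tuple_le[OF assms, where g = "\<lambda>_. ()"] by simp

end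

section \<open>Partitions and dynamical joins as level sets\<close>

lemma partition_entropy_fibres: "partition_entropy M (fibres M f) = ent M f"
  unfolding partition_entropy_def ent_eq_sum_fibres by (simp add: eta_def sum_negf)

lemma measurable_partition_fibres:
  assumes "simple_function M f"
  shows "measurable_partition M (fibres M f)"
  unfolding measurable_partition_def
proof (intro conjI)
  have "fibres M f = (\<lambda>a. f -` {a} \<inter> space M) ` (f ` space M)"
    unfolding fibres_def by (simp add: image_image)
  then show "finite (fibres M f)" using simple_functionD(1)[OF assms] by simp
  show "fibres M f \<subseteq> sets M" using simple_functionD(2)[OF assms] by (auto simp: fibres_def)
  show "partition_on (space M) (fibres M f)"
    by (rule partition_onI) (auto simp: fibres_def disjnt_def)
qed

lemma measurable_partition_eq_fibres:
  fixes M :: "'x measure"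
  assumes "measurable_partition M P"
  obtains f :: "'x \<Rightarrow> 'x set set" where "simple_function M f" "P = fibres M f"
proof -
  have P: "finite P" "P \<subseteq> sets M" "partition_on (space M) P"
    using assms by (auto simp: measurable_partition_def)
  have Un: "\<Union>P = space M" and ne: "{} \<notin> P"
    using P(3) by (auto simp: partition_on_def)
  have dj: "A = B" if "A \<in> P" "B \<in> P" "x \<in> A" "x \<in> B" for A B x
    using P(3) that by (auto simp: partition_on_def disjoint_def)
  \<comment> \<open>On the space this is the singleton of the cell of x; taking the set avoids the
    choice of an index.\<close>
  define f where "f x = {A \<in> P. x \<in> A}" for x
  have f: "f -` {f x} \<inter> space M = A" if "x \<in> A" "A \<in> P" for x A
  proof -
    have fx: "f y = {A}" if "y \<in> A" for y
      unfolding f_def using \<open>A \<in> P\<close> that dj by blast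
    have "y \<in> A" if "f y = {A}" for y using that unfolding f_def by blast
    then show ?thesis using fx[of x] fx that Un by auto
  qed
  have img: "fibres M f = P"
  proof
    show "fibres M f \<subseteq> P"
    proof
      fix B assume "B \<in> fibres M f"
      then obtain x where x: "x \<in> space M" "B = f -` {f x} \<inter> space M" by (auto simp: fibres_def)
      then obtain A where "A \<in> P" "x \<in> A" using Un by blast
      with f x show "B \<in> P" by simp
    qed
    show "P \<subseteq> fibres M f"
    proof
      fix A assume A: "A \<in> P"
      with ne obtain x where x: "x \<in> A" by fastforce
      then have "x \<in> space M" using Un A by blast
      then show "A \<in> fibres M f" unfolding fibres_def using f[OF x A] by (intro image_eqI[of _ _ x]) auto
    qed
  qed
  have "f ` space M \<subseteq> Pow P" by (auto simp: f_def)
  then have "finite (f ` space M)" using P(1) by (meson finite_Pow_iff finite_subset)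
  moreover have "f -` {f x} \<inter> space M \<in> sets M" if "x \<in> space M" for x
    using img P(2) that unfolding fibres_def by blast
  ultimately have "simple_function M f" unfolding simple_function_def by auto
  with img that show thesis by blast
qed

text \<open>A cell of the join consists of the points with the same name along F. For empty F the
  join would have the cell \<open>UNIV\<close> instead of \<open>space M\<close>.\<close>

lemma dynamical_join_fibres:
  assumes F: "F \<noteq> {}" and T: "\<And>g x. x \<in> space M \<Longrightarrow> T g x \<in> space M"
  shows "dynamical_join M T (fibres M f) F = fibres M (tuple (\<lambda>g x. f (T g x)) F)"
proof -
  define Q where "Q g = (\<lambda>A. T g -` A \<inter> space M) ` fibres M f" for g
  define B where "B g x = {y \<in> space M. f (T g y) = f (T g x)}" for g x
  have BQ: "B g x \<in> Q g" if "x \<in> space M" for g x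
  proof -
    have "B g x = T g -` (f -` {f (T g x)} \<inter> space M) \<inter> space M"
      unfolding B_def using T by auto
    moreover have "f -` {f (T g x)} \<inter> space M \<in> fibres M f"
      unfolding fibres_def using T that by blast
    ultimately show ?thesis unfolding Q_def by blast
  qed
  have QB: "A = B g x" if "A \<in> Q g" "x \<in> A" for A g x
    using that T unfolding Q_def B_def fibres_def by auto
  have fib: "tuple (\<lambda>g x. f (T g x)) F -` {tuple (\<lambda>g x. f (T g x)) F x} \<inter> space M = (\<Inter>g\<in>F. B g x)" for x
    using F unfolding B_def by (auto simp: tuple_eq_iff)
  have sub: "A \<subseteq> space M" if "A \<in> Q g" for A g using that unfolding Q_def by auto
  have "common_refinement (Q ` F) = (\<lambda>x. \<Inter>g\<in>F. B g x) ` space M"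
  proof (intro equalityI subsetI)
    fix Z assume "Z \<in> common_refinement (Q ` F)"
    then obtain c where c: "c \<in> (\<Pi> P\<in>Q ` F. P)" "Z = \<Inter> (c ` (Q ` F))" "Z \<noteq> {}"
      unfolding common_refinement by auto
    then obtain x where x: "x \<in> Z" by auto
    have cB: "c (Q g) = B g x" if "g \<in> F" for g
      by (rule QB) (use c x that in auto)
    obtain g where g: "g \<in> F" using F by auto
    have "x \<in> c (Q g)" "c (Q g) \<in> Q g" using c x g by auto
    then have "x \<in> space M" using sub by blast
    moreover have "Z = (\<Inter>g\<in>F. B g x)" using c(2) cB by auto
    ultimately show "Z \<in> (\<lambda>x. \<Inter>g\<in>F. B g x) ` space M" by blast
  next
    fix Z assume "Z \<in> (\<lambda>x. \<Inter>g\<in>F. B g x) ` space M"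
    then obtain x where x: "x \<in> space M" "Z = (\<Inter>g\<in>F. B g x)" by blast
    define c where "c P = \<Union>{A\<in>P. x \<in> A}" for P
    have xB: "x \<in> B g x" for g using x by (auto simp: B_def)
    have "{A \<in> Q g. x \<in> A} = {B g x}" for g
    proof
      show "{A \<in> Q g. x \<in> A} \<subseteq> {B g x}" using QB by blast
      show "{B g x} \<subseteq> {A \<in> Q g. x \<in> A}" using BQ x xB by blast
    qed
    then have cB: "c (Q g) = B g x" for g unfolding c_def by simp
    have "c \<in> (\<Pi> P\<in>Q ` F. P)" using cB BQ x by auto
    moreover have "Z = \<Inter> (c ` (Q ` F))" using cB x by auto
    moreover have "Z \<noteq> {}" using xB x by auto
    ultimately show "Z \<in> common_refinement (Q ` F)" unfolding common_refinement by blast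
  qed
  then show ?thesis unfolding dynamical_join_def Q_def[symmetric] fibres_def[of M "tuple _ _"] fib .
qed

subsection \<open>Strongly subadditive set functions\<close>

text \<open>The model is the entropy of a window. The averaging argument only needs monotonicity and
  diminishing returns when one point is added.\<close>

locale strongly_subadditive =
  fixes H :: "'g set \<Rightarrow> real"
  assumes H_empty: "H {} = 0"
    and mono: "finite B \<Longrightarrow> A \<subseteq> B \<Longrightarrow> H A \<le> H B"
    and submod: "finite B \<Longrightarrow> A \<subseteq> B \<Longrightarrow> x \<notin> B \<Longrightarrow> H (insert x B) - H B \<le> H (insert x A) - H A"
begin

text \<open>F is built up point by point. A new point x raises \<open>H F\<close> by some d; each of
  the at least k sets \<open>S i\<close> containing x gains no less, since
  \<open>S i \<inter> F\<close> is a subset of F and returns diminish.\<close>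

lemma shearer:
  assumes "finite I" "finite F" "\<And>x. x \<in> F \<Longrightarrow> k \<le> card {i \<in> I. x \<in> S i}"
  shows "real k * H F \<le> (\<Sum>i\<in>I. H (S i \<inter> F))"
  using assms(2,3)
proof (induction F rule: finite_induct)
  case empty
  then show ?case by (simp add: H_empty)
next
  case (insert x F)
  let ?J = "{i \<in> I. x \<in> S i}"
  let ?d = "H (insert x F) - H F"
  have d: "0 \<le> ?d" using mono[of "insert x F" F] insert.hyps by auto
  have "real k * H F \<le> (\<Sum>i\<in>I. H (S i \<inter> F))"
    by (rule insert.IH) (rule insert.prems, simp)
  moreover have "k * ?d \<le> (\<Sum>i\<in>I. H (S i \<inter> insert x F) - H (S i \<inter> F))"
  proof -
    have "real k * ?d \<le> card ?J * ?d"
      using d insert.prems[of x] by (intro mult_right_mono) auto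
    also have "\<dots> = (\<Sum>i\<in>I. if x \<in> S i then ?d else 0)"
      using assms(1) by (simp add: sum.If_cases Int_def)
    also have "\<dots> \<le> (\<Sum>i\<in>I. H (S i \<inter> insert x F) - H (S i \<inter> F))"
    proof (rule sum_mono)
      fix i
      show "(if x \<in> S i then ?d else 0) \<le> H (S i \<inter> insert x F) - H (S i \<inter> F)"
        using submod[of F "S i \<inter> F" x] insert.hyps by auto
    qed
    finally show ?thesis .
  qed
  ultimately show ?case by (simp add: sum_subtractf algebra_simps)
qed

end

text \<open>The inner and the outer boundary for finitely many right translations. Both are covered
  by one symmetric difference for each translation, up to a translation of the points.\<close>

lemma folner_boundary:
  assumes "folner_sequence \<F>" "finite S"
  shows "(\<lambda>n. real (card {d \<in> \<F> n. \<exists>s\<in>S. d + s \<notin> \<F> n}) / real (card (\<F> n))) \<longlonglongrightarrow> 0"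
    and "(\<lambda>n. real (card ((\<Union>s\<in>S. (\<lambda>h. h + s) ` \<F> n) - \<F> n)) / real (card (\<F> n))) \<longlonglongrightarrow> 0"
proof -
  have fin: "finite (\<F> n)" for n using assms by (auto simp: folner_sequence_def)
  define u where "u n = (\<Sum>s\<in>S. real (card (sym_diff (\<F> n) ((\<lambda>h. h + s) ` \<F> n))) / real (card (\<F> n)))" for n
  have "(\<lambda>n. real (card (sym_diff (\<F> n) ((\<lambda>h. h + s) ` \<F> n))) / real (card (\<F> n))) \<longlonglongrightarrow> 0" for s
    using assms(1) by (auto simp: folner_sequence_def)
  then have u: "u \<longlonglongrightarrow> 0" unfolding u_def by (intro tendsto_null_sum)
  have le: "real (card {d \<in> \<F> n. \<exists>s\<in>S. d + s \<notin> \<F> n}) / real (card (\<F> n)) \<le> u n" for n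
  proof -
    have "card {d \<in> \<F> n. \<exists>s\<in>S. d + s \<notin> \<F> n} \<le> card (\<Union>s\<in>S. {d \<in> \<F> n. d + s \<notin> \<F> n})"
      using assms(2) fin by (intro card_mono) auto
    also have "\<dots> \<le> (\<Sum>s\<in>S. card {d \<in> \<F> n. d + s \<notin> \<F> n})"
      by (rule card_UN_le[OF assms(2)])
    also have "\<dots> \<le> (\<Sum>s\<in>S. card (sym_diff (\<F> n) ((\<lambda>h. h + s) ` \<F> n)))"
    proof (rule sum_mono)
      fix s
      show "card {d \<in> \<F> n. d + s \<notin> \<F> n} \<le> card (sym_diff (\<F> n) ((\<lambda>h. h + s) ` \<F> n))"
        by (rule card_inj_on_le[of "\<lambda>h. h + s"]) (auto simp: inj_on_def fin)
    qed
    finally show ?thesis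
      unfolding u_def by (simp add: divide_right_mono flip: sum_divide_distrib of_nat_sum)
  qed
  have le2: "real (card ((\<Union>s\<in>S. (\<lambda>h. h + s) ` \<F> n) - \<F> n)) / real (card (\<F> n)) \<le> u n" for n
  proof -
    have "card ((\<Union>s\<in>S. (\<lambda>h. h + s) ` \<F> n) - \<F> n) \<le> card (\<Union>s\<in>S. sym_diff (\<F> n) ((\<lambda>h. h + s) ` \<F> n))"
      using assms(2) fin by (intro card_mono) auto
    also have "\<dots> \<le> (\<Sum>s\<in>S. card (sym_diff (\<F> n) ((\<lambda>h. h + s) ` \<F> n)))"
      by (rule card_UN_le[OF assms(2)])
    finally show ?thesis
      unfolding u_def by (simp add: divide_right_mono flip: sum_divide_distrib of_nat_sum)
  qed
  show "(\<lambda>n. real (card {d \<in> \<F> n. \<exists>s\<in>S. d + s \<notin> \<F> n}) / real (card (\<F> n))) \<longlonglongrightarrow> 0"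
    by (rule tendsto_sandwich[OF _ _ tendsto_const u]) (auto intro!: always_eventually le)
  show "(\<lambda>n. real (card ((\<Union>s\<in>S. (\<lambda>h. h + s) ` \<F> n) - \<F> n)) / real (card (\<F> n))) \<longlonglongrightarrow> 0"
    by (rule tendsto_sandwich[OF _ _ tendsto_const u]) (auto intro!: always_eventually le2)
qed

locale invariant_strongly_subadditive = strongly_subadditive H
  for H :: "'g::group_add set \<Rightarrow> real" +
  assumes inv: "finite A \<Longrightarrow> H ((+) g ` A) = H A"
begin

lemma nonneg: "finite A \<Longrightarrow> 0 \<le> H A"
  using mono[of A "{}"] H_empty by simp

text \<open>Shearer's inequality for the translates g + K: a point x of F lies in exactly
  \<open>card K\<close> of them, those with g = x - k. At most \<open>card F\<close> translates lie
  inside F. Any other one that meets F has g = f - k with f in the inner boundary, which accounts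
  for the error term.\<close>

lemma average_le:
  assumes F: "finite F" "F \<noteq> {}" and K: "finite K" "K \<noteq> {}"
  shows "H F / card F \<le> H K / card K
    + card {d \<in> F. \<exists>s\<in>(\<lambda>(a, b). - a + b) ` (K \<times> K). d + s \<notin> F} / card F * H K"
proof -
  let ?S = "(\<lambda>(a, b). - a + b) ` (K \<times> K)"
  let ?bd = "{d \<in> F. \<exists>s\<in>?S. d + s \<notin> F}"
  define I where "I = (\<Union>k\<in>K. (\<lambda>f. f - k) ` F)"
  have finI: "finite I" unfolding I_def using F K by auto
  have "real (card K) * H F \<le> (\<Sum>g\<in>I. H ((+) g ` K \<inter> F))"
  proof (rule shearer[OF finI F(1)])
    fix x assume x: "x \<in> F"
    have "{g \<in> I. x \<in> (+) g ` K} = (\<lambda>k. x - k) ` K"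
    proof (intro equalityI subsetI)
      fix g assume "g \<in> {g \<in> I. x \<in> (+) g ` K}"
      then obtain k where "k \<in> K" "x = g + k" by auto
      then show "g \<in> (\<lambda>k. x - k) ` K" by (intro image_eqI[of _ _ k]) (auto simp: algebra_simps)
    next
      fix g assume "g \<in> (\<lambda>k. x - k) ` K"
      then obtain k where k: "k \<in> K" "g = x - k" by auto
      then have "x = g + k" by (simp add: algebra_simps)
      with k x show "g \<in> {g \<in> I. x \<in> (+) g ` K}" unfolding I_def by blast
    qed
    moreover have "card ((\<lambda>k. x - k) ` K) = card K"
      by (rule card_image)
        (auto simp: inj_on_def diff_conv_add_uminus simp del: add_uminus_conv_diff)
    ultimately show "card K \<le> card {i \<in> I. x \<in> (+) i ` K}" by simp
  qed
  also have "\<dots> \<le> (\<Sum>g\<in>I. H K)"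
  proof (rule sum_mono)
    fix g show "H ((+) g ` K \<inter> F) \<le> H K"
      using mono[of "(+) g ` K" "(+) g ` K \<inter> F"] inv[of K g] K by auto
  qed
  also have "\<dots> = real (card I) * H K" by simp
  also have "\<dots> \<le> (real (card F) + real (card K) * real (card ?bd)) * H K"
  proof (rule mult_right_mono[OF _ nonneg[OF K(1)]])
    have "I \<subseteq> {g. (+) g ` K \<subseteq> F} \<union> (\<Union>k\<in>K. (\<lambda>f. f - k) ` ?bd)"
    proof
      fix g assume "g \<in> I"
      then obtain k f where k: "k \<in> K" "f \<in> F" "g = f - k" unfolding I_def by auto
      show "g \<in> {g. (+) g ` K \<subseteq> F} \<union> (\<Union>k\<in>K. (\<lambda>f. f - k) ` ?bd)"
      proof (cases "(+) g ` K \<subseteq> F")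
        case False
        then obtain k' where k': "k' \<in> K" "g + k' \<notin> F" by auto
        have "g + k' = f + (- k + k')" using k by (simp add: add.assoc[symmetric])
        then have "f \<in> ?bd" using k k' by force
        then show ?thesis using k by blast
      qed simp
    qed
    moreover have fin1: "finite {g. (+) g ` K \<subseteq> F}" and card1: "card {g. (+) g ` K \<subseteq> F} \<le> card F"
    proof -
      obtain k where k: "k \<in> K" using K by auto
      have inj: "inj_on (\<lambda>g. g + k) {g. (+) g ` K \<subseteq> F}" by (auto simp: inj_on_def)
      have img: "(\<lambda>g. g + k) ` {g. (+) g ` K \<subseteq> F} \<subseteq> F" using k by auto
      show "finite {g. (+) g ` K \<subseteq> F}" using inj_on_finite[OF inj img F(1)] .
      show "card {g. (+) g ` K \<subseteq> F} \<le> card F" using card_inj_on_le[OF inj img F(1)] .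
    qed
    moreover have "card (\<Union>k\<in>K. (\<lambda>f. f - k) ` ?bd) \<le> card K * card ?bd"
    proof -
      have "card (\<Union>k\<in>K. (\<lambda>f. f - k) ` ?bd) \<le> (\<Sum>k\<in>K. card ((\<lambda>f. f - k) ` ?bd))"
        by (rule card_UN_le[OF K(1)])
      also have "\<dots> \<le> (\<Sum>k\<in>K. card ?bd)" using F by (intro sum_mono card_image_le) auto
      finally show ?thesis by simp
    qed
    ultimately have "card I \<le> card F + card K * card ?bd"
      using card_mono[of "{g. (+) g ` K \<subseteq> F} \<union> (\<Union>k\<in>K. (\<lambda>f. f - k) ` ?bd)" I]
        card_Un_le[of "{g. (+) g ` K \<subseteq> F}" "\<Union>k\<in>K. (\<lambda>f. f - k) ` ?bd"] F K by auto
    then show "real (card I) \<le> real (card F) + real (card K) * real (card ?bd)"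
      by (simp only: flip: of_nat_mult of_nat_add of_nat_le_iff[where 'a=real])
  qed
  finally have main: "real (card K) * H F \<le> (real (card F) + real (card K) * real (card ?bd)) * H K" .
  have pos: "0 < real (card F)" "0 < real (card K)" using F K by (auto simp: card_gt_0_iff)
  have "H F / card F = real (card K) * H F / (card K * card F)" using pos by simp
  also have "\<dots> \<le> (real (card F) + real (card K) * real (card ?bd)) * H K / (card K * card F)"
    using main pos by (intro divide_right_mono) auto
  also have "\<dots> = H K / card K + card ?bd / card F * H K"
    using pos by (simp add: field_simps)
  finally show ?thesis .
qed

text \<open>Each term is at least the infimum, and \<open>average_le\<close> with a nearly optimal K
  bounds it from above because the boundary term vanishes. The limit is the same for every
  sequence.\<close>

lemma tendsto_Inf:
  assumes fol: "folner_sequence \<F>"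
  shows "(\<lambda>n. H (\<F> n) / card (\<F> n)) \<longlonglongrightarrow> Inf ((\<lambda>K. H K / card K) ` {K. finite K \<and> K \<noteq> {}})"
    (is "_ \<longlonglongrightarrow> Inf ?A")
proof (rule LIMSEQ_I)
  fix e :: real assume e: "0 < e"
  have bdd: "bdd_below ?A"
    by (rule bdd_belowI[of _ 0]) (auto intro!: divide_nonneg_nonneg nonneg)
  have "H {0} / card {0::'g} \<in> ?A" by (rule imageI) auto
  then have ne: "?A \<noteq> {}" by blast
  have "Inf ?A < Inf ?A + e / 2" using e by simp
  then obtain a where a: "a \<in> ?A" "a < Inf ?A + e / 2"
    using cInf_lessD[OF ne] by blast
  then obtain K where K: "finite K" "K \<noteq> {}" "H K / card K < Inf ?A + e / 2" by blast
  let ?S = "(\<lambda>(a, b). - a + b) ` (K \<times> K)"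
  have "(\<lambda>n. card {d \<in> \<F> n. \<exists>s\<in>?S. d + s \<notin> \<F> n} / card (\<F> n) * H K) \<longlonglongrightarrow> 0 * H K"
    by (intro tendsto_mult tendsto_const folner_boundary[OF fol]) (use K in auto)
  then have "\<forall>\<^sub>F n in sequentially. card {d \<in> \<F> n. \<exists>s\<in>?S. d + s \<notin> \<F> n} / card (\<F> n) * H K < e / 2"
    using e by (intro order_tendstoD(2)[where y = "0 * H K"]) auto
  then obtain N where N: "\<And>n. n \<ge> N \<Longrightarrow> card {d \<in> \<F> n. \<exists>s\<in>?S. d + s \<notin> \<F> n} / card (\<F> n) * H K < e / 2"
    unfolding eventually_sequentially by blast
  show "\<exists>N. \<forall>n\<ge>N. norm (H (\<F> n) / card (\<F> n) - Inf ?A) < e"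
  proof (intro exI[of _ N] allI impI)
    fix n assume n: "n \<ge> N"
    have F: "finite (\<F> n)" "\<F> n \<noteq> {}" using fol by (auto simp: folner_sequence_def)
    have "Inf ?A \<le> H (\<F> n) / card (\<F> n)"
      using F by (intro cInf_lower bdd imageI) auto
    moreover have "H (\<F> n) / card (\<F> n) < Inf ?A + e"
      using average_le[OF F K(1,2)] N[OF n] K(3) by linarith
    ultimately show "norm (H (\<F> n) / card (\<F> n) - Inf ?A) < e" by simp
  qed
qed

end


subsection \<open>Entropy rates of measure preserving actions\<close>

lemma ent_distr:
  assumes "S \<in> measurable M N" "simple_function N f" "distr M N S = N"
  shows "ent N f = ent M (\<lambda>x. f (S x))"
proof -
  have "ent M (\<lambda>x. f (S x)) = (\<Sum>a\<in>f ` space N. eta (measure M ((\<lambda>x. f (S x)) -` {a} \<inter> space M)))"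
    by (rule ent_superset)
      (use assms measurable_space[OF assms(1)] in \<open>auto dest: simple_functionD\<close>)
  also have "\<dots> = (\<Sum>a\<in>f ` space N. eta (measure (distr M N S) (f -` {a} \<inter> space N)))"
  proof (intro sum.cong refl arg_cong[where f=eta])
    fix a
    have "S -` (f -` {a} \<inter> space N) \<inter> space M = (\<lambda>x. f (S x)) -` {a} \<inter> space M"
      using measurable_space[OF assms(1)] by auto
    then show "measure M ((\<lambda>x. f (S x)) -` {a} \<inter> space M) = measure (distr M N S) (f -` {a} \<inter> space N)"
      using assms by (subst measure_distr) (auto dest: simple_functionD)
  qed
  finally show ?thesis by (simp add: ent_def assms(3))
qed

locale mp_action = prob_space M for M :: "'x measure" +
  fixes T :: "'g::group_add \<Rightarrow> 'x \<Rightarrow> 'x"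
  assumes T_measurable: "T g \<in> measurable M M"
    and T_distr: "distr M M (T g) = M"
    and T_comp: "x \<in> space M \<Longrightarrow> T g (T k x) = T (k + g) x"
begin

lemma T_space: "x \<in> space M \<Longrightarrow> T g x \<in> space M"
  using measurable_space[OF T_measurable] .

abbreviation orbit :: "('x \<Rightarrow> 'b) \<Rightarrow> 'g set \<Rightarrow> 'x \<Rightarrow> 'g \<Rightarrow> 'b" where
  "orbit f \<equiv> tuple (\<lambda>g x. f (T g x))"

lemma simple_function_T:
  assumes "simple_function M f"
  shows "simple_function M (\<lambda>x. f (T g x))"
proof -
  have "(\<lambda>x. f (T g x)) ` space M \<subseteq> f ` space M" using T_space by auto
  then show ?thesis
    using assms measurable_compose[OF T_measurable] finite_subset
    unfolding simple_function_eq_measurable by blast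
qed

lemma simple_function_orbit: "finite F \<Longrightarrow> simple_function M f \<Longrightarrow> simple_function M (orbit f F)"
  by (intro simple_function_tuple simple_function_T)

lemma ent_T: "simple_function M f \<Longrightarrow> ent M (\<lambda>x. f (T g x)) = ent M f"
  by (rule ent_distr[OF T_measurable _ T_distr, symmetric])

lemma ball_plus_image: "(\<forall>a\<in>(+) g ` A. P a) \<longleftrightarrow> (\<forall>a\<in>A. P (g + a))"
  by blast

text \<open>The reversed order in \<open>T_comp\<close> is what makes a left translation of the
  window correspond to one application of T.\<close>

lemma orbit_translate:
  assumes "x \<in> space M" "y \<in> space M"
  shows "orbit f ((+) g ` A) x = orbit f ((+) g ` A) y \<longleftrightarrow> orbit f A (T g x) = orbit f A (T g y)"
  unfolding tuple_eq_iff ball_plus_image using assms by (simp add: T_comp)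

lemma invariant_strongly_subadditive_ent:
  assumes f: "simple_function M f"
  shows "invariant_strongly_subadditive (\<lambda>F. ent M (orbit f F))"
proof unfold_locales
  note sf = simple_function_orbit[OF _ f]
  have "ent M (orbit f {}) = ent M (\<lambda>_. ())"
    by (rule ent_cong_fibres) (simp add: tuple_eq_iff)
  then show "ent M (orbit f {}) = 0" by simp
  show "ent M (orbit f A) \<le> ent M (orbit f B)" if "finite B" "A \<subseteq> B" for A B
    using sf that by (intro ent_mono) (auto simp: tuple_eq_iff)
  show "ent M (orbit f (insert x B)) - ent M (orbit f B) \<le> ent M (orbit f (insert x A)) - ent M (orbit f A)"
    if "finite B" "A \<subseteq> B" "x \<notin> B" for A B x
  proof -
    have eq: "ent M (orbit f (insert x C)) = ent M (\<lambda>y. (f (T x y), orbit f C y))" for C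
      by (rule ent_cong_fibres) (simp add: tuple_eq_iff)
    have "cond_ent M (\<lambda>y. f (T x y)) (orbit f B) \<le> cond_ent M (\<lambda>y. f (T x y)) (orbit f A)"
      using f that sf
      by (intro cond_ent_antimono simple_function_T) (auto simp: tuple_eq_iff)
    then show ?thesis by (simp add: cond_ent_def eq)
  qed
  show "ent M (orbit f ((+) g ` A)) = ent M (orbit f A)" if "finite A" for g A
  proof -
    have "ent M (orbit f ((+) g ` A)) = ent M (\<lambda>x. orbit f A (T g x))"
      by (rule ent_cong_fibres[OF orbit_translate])
    also have "\<dots> = ent M (orbit f A)" by (rule ent_T[OF sf[OF that]])
    finally show ?thesis .
  qed
qed

text \<open>Existence of the limit named by \<open>THE\<close> comes from
  \<open>tendsto_Inf\<close>. Uniqueness comes from the given sequence: without any such sequence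
  every number would satisfy the description.\<close>

lemma entropy_rate_tendsto:
  assumes f: "simple_function M f" and fol: "folner_sequence \<F>"
  shows "(\<lambda>n. ent M (orbit f (\<F> n)) / card (\<F> n)) \<longlonglongrightarrow> entropy_rate M T (fibres M f)"
proof -
  let ?l = "Inf ((\<lambda>K. ent M (orbit f K) / card K) ` {K. finite K \<and> K \<noteq> {}})"
  have eq: "partition_entropy M (dynamical_join M T (fibres M f) (\<G> n)) = ent M (orbit f (\<G> n))"
    if "folner_sequence \<G>" for \<G> n
    using that by (subst dynamical_join_fibres) (auto simp: partition_entropy_fibres folner_sequence_def T_space)
  have lim: "(\<lambda>n. ent M (orbit f (\<G> n)) / card (\<G> n)) \<longlonglongrightarrow> ?l" if "folner_sequence \<G>" for \<G>
    using invariant_strongly_subadditive.tendsto_Inf[OF invariant_strongly_subadditive_ent[OF f] that] .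
  have "entropy_rate M T (fibres M f) = ?l"
    unfolding entropy_rate_def
  proof (rule the_equality)
    show "\<forall>\<F>. folner_sequence \<F> \<longrightarrow> (\<lambda>n. partition_entropy M (dynamical_join M T (fibres M f) (\<F> n)) / card (\<F> n)) \<longlonglongrightarrow> ?l"
      using lim eq by simp
    fix l assume "\<forall>\<F>. folner_sequence \<F> \<longrightarrow> (\<lambda>n. partition_entropy M (dynamical_join M T (fibres M f) (\<F> n)) / card (\<F> n)) \<longlonglongrightarrow> l"
    then have "(\<lambda>n. ent M (orbit f (\<F> n)) / card (\<F> n)) \<longlonglongrightarrow> l"
      using fol eq by simp
    then show "l = ?l" using lim[OF fol] by (rule LIMSEQ_unique)
  qed
  then show ?thesis using lim[OF fol] by simp
qed

text \<open>If a K-window of \<open>\<alpha>\<close> nearly determines f, then f has hardly more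
  entropy. F is widened by B so that each site g of F sees its whole window g + K and costs at most
  e; the entropy of \<open>\<alpha>\<close> on B is negligible because B is an outer
  boundary.\<close>

lemma entropy_rate_le_of_cond_ent:
  fixes \<F> :: "nat \<Rightarrow> 'g set"
  assumes f: "simple_function M f" and \<alpha>: "simple_function M \<alpha>" and fol: "folner_sequence \<F>"
    and K: "finite K" and le: "cond_ent M f (orbit \<alpha> K) \<le> e"
  shows "entropy_rate M T (fibres M f) \<le> entropy_rate M T (fibres M \<alpha>) + e"
proof (rule LIMSEQ_le[OF entropy_rate_tendsto[OF f fol]])
  let ?b = "\<lambda>n. real (card ((\<Union>s\<in>K. (\<lambda>h. h + s) ` \<F> n) - \<F> n)) / real (card (\<F> n))"
  show "(\<lambda>n. ent M (orbit \<alpha> (\<F> n)) / card (\<F> n) + ?b n * ent M \<alpha> + e)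
     \<longlonglongrightarrow> entropy_rate M T (fibres M \<alpha>) + e"
    using tendsto_add[OF tendsto_add[OF entropy_rate_tendsto[OF \<alpha> fol]
      tendsto_mult[OF folner_boundary(2)[OF fol K] tendsto_const[of "ent M \<alpha>"]]] tendsto_const[of e]]
    by (simp only: mult_zero_left add_0_right)
  show "\<exists>N. \<forall>n\<ge>N. ent M (orbit f (\<F> n)) / card (\<F> n) \<le> ent M (orbit \<alpha> (\<F> n)) / card (\<F> n) + ?b n * ent M \<alpha> + e"
  proof (intro exI[of _ 0] allI impI)
    fix n
    define F where "F = \<F> n"
    define B where "B = (\<Union>s\<in>K. (\<lambda>h. h + s) ` F) - F"
    have F: "finite F" "F \<noteq> {}" using fol by (auto simp: F_def folner_sequence_def)
    then have pos: "0 < real (card F)" by (simp add: card_gt_0_iff)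
    have B: "finite B" using F K by (auto simp: B_def)
    note sf = simple_function_orbit[OF F(1) f] simple_function_orbit[OF F(1) \<alpha>]
      simple_function_orbit[OF B \<alpha>]
    have sfU: "simple_function M (orbit \<alpha> (F \<union> B))"
      using F B \<alpha> by (intro simple_function_orbit) auto
    have "ent M (orbit f F) \<le> ent M (\<lambda>x. (orbit f F x, orbit \<alpha> (F \<union> B) x))"
      by (rule ent_mono[OF simple_function_Pair[OF sf(1) sfU]]) simp
    also have "\<dots> = ent M (orbit \<alpha> (F \<union> B)) + cond_ent M (orbit f F) (orbit \<alpha> (F \<union> B))"
      by (simp add: cond_ent_def)
    also have "ent M (orbit \<alpha> (F \<union> B)) \<le> ent M (orbit \<alpha> F) + card B * ent M \<alpha>"
    proof -
      have "ent M (orbit \<alpha> (F \<union> B)) = ent M (\<lambda>x. (orbit \<alpha> B x, orbit \<alpha> F x))"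
        by (rule ent_cong_fibres) (auto simp: tuple_eq_iff)
      also have "\<dots> \<le> ent M (orbit \<alpha> B) + ent M (orbit \<alpha> F)"
        using cond_ent_le_ent[OF sf(3,2)] by (simp add: cond_ent_def)
      also have "ent M (orbit \<alpha> B) \<le> (\<Sum>g\<in>B. ent M (\<lambda>x. \<alpha> (T g x)))"
        by (rule ent_tuple_le[OF B simple_function_T[OF \<alpha>]])
      also have "\<dots> = card B * ent M \<alpha>" using ent_T[OF \<alpha>] by simp
      finally show ?thesis by simp
    qed
    also have "cond_ent M (orbit f F) (orbit \<alpha> (F \<union> B)) \<le> (\<Sum>g\<in>F. cond_ent M (\<lambda>x. f (T g x)) (orbit \<alpha> (F \<union> B)))"
      by (rule cond_ent_tuple_le[OF F(1) simple_function_T[OF f] sfU])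
    also have "\<dots> \<le> (\<Sum>g\<in>F. e)"
    proof (rule sum_mono)
      fix g assume g: "g \<in> F"
      have gK: "(+) g ` K \<subseteq> F \<union> B" using g unfolding B_def by auto
      have "cond_ent M (\<lambda>x. f (T g x)) (orbit \<alpha> (F \<union> B)) \<le> cond_ent M (\<lambda>x. f (T g x)) (orbit \<alpha> ((+) g ` K))"
        using gK by (intro cond_ent_antimono simple_function_T[OF f] sfU) (auto simp: tuple_eq_iff)
      also have "\<dots> = cond_ent M f (orbit \<alpha> K)"
      proof -
        have sK: "simple_function M (orbit \<alpha> K)" using K \<alpha> by (rule simple_function_orbit)
        have "ent M (\<lambda>x. (f (T g x), orbit \<alpha> ((+) g ` K) x)) = ent M (\<lambda>x. (f (T g x), orbit \<alpha> K (T g x)))"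
          by (rule ent_cong_fibres) (simp add: orbit_translate)
        also have "\<dots> = ent M (\<lambda>x. (f x, orbit \<alpha> K x))"
          by (rule ent_T[OF simple_function_Pair[OF f sK]])
        finally show ?thesis
          unfolding cond_ent_def using invariant_strongly_subadditive.inv[OF invariant_strongly_subadditive_ent[OF \<alpha>] K] by simp
      qed
      finally show "cond_ent M (\<lambda>x. f (T g x)) (orbit \<alpha> (F \<union> B)) \<le> e" using le by simp
    qed
    finally have "ent M (orbit f F) \<le> ent M (orbit \<alpha> F) + card B * ent M \<alpha> + card F * e" by simp
    then have "ent M (orbit f F) / card F \<le> (ent M (orbit \<alpha> F) + card B * ent M \<alpha> + card F * e) / card F"
      using pos by (intro divide_right_mono) auto
    also have "\<dots> = ent M (orbit \<alpha> F) / card F + card B / card F * ent M \<alpha> + e"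
      using pos by (simp add: add_divide_distrib)
    finally show "ent M (orbit f (\<F> n)) / card (\<F> n) \<le> ent M (orbit \<alpha> (\<F> n)) / card (\<F> n) + ?b n * ent M \<alpha> + e"
      unfolding B_def F_def .
  qed
qed

end

subsection \<open>The topology of the full shift\<close>

lemma restrict_eq_iff: "restrict x K = restrict y K \<longleftrightarrow> (\<forall>h\<in>K. x h = y h)"
  by (auto simp: fun_eq_iff restrict_def)

lemma open_cylinder:
  fixes p :: "'g \<Rightarrow> 'a::discrete_topology"
  assumes "finite K"
  shows "open {y. \<forall>h\<in>K. y h = p h}"
proof -
  have "open ((\<lambda>y::'g \<Rightarrow> 'a. y h) -` {p h})" for h
    by (intro open_vimage discrete_topology_class.open_discrete continuous_on_product_coordinates)
  then have "open (\<Inter>h\<in>K. (\<lambda>y::'g \<Rightarrow> 'a. y h) -` {p h})"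
    using assms by (intro open_INT) auto
  also have "(\<Inter>h\<in>K. (\<lambda>y::'g \<Rightarrow> 'a. y h) -` {p h}) = {y. \<forall>h\<in>K. y h = p h}" by auto
  finally show ?thesis .
qed

lemma open_contains_cylinder:
  fixes x :: "'g \<Rightarrow> 'a::topological_space"
  assumes "open U" "x \<in> U"
  obtains K where "finite K" "{y. \<forall>h\<in>K. y h = x h} \<subseteq> U"
proof -
  obtain X where X: "x \<in> (\<Pi>\<^sub>E i\<in>UNIV. X i)" "finite {i. X i \<noteq> topspace euclidean}" "(\<Pi>\<^sub>E i\<in>UNIV. X i) \<subseteq> U"
    using product_topology_open_contains_basis[of "\<lambda>_. euclidean" UNIV U x] assms
    unfolding open_fun_def by blast
  have "{y. \<forall>h\<in>{i. X i \<noteq> topspace euclidean}. y h = x h} \<subseteq> (\<Pi>\<^sub>E i\<in>UNIV. X i)"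
  proof
    fix y assume y: "y \<in> {y. \<forall>h\<in>{i. X i \<noteq> topspace euclidean}. y h = x h}"
    have "y i \<in> X i" for i
    proof (cases "X i = topspace euclidean")
      case False
      then have "y i = x i" using y by auto
      then show ?thesis using X(1) by (auto simp: PiE_def Pi_def)
    qed simp
    then show "y \<in> (\<Pi>\<^sub>E i\<in>UNIV. X i)" by auto
  qed
  then have "{y. \<forall>h\<in>{i. X i \<noteq> topspace euclidean}. y h = x h} \<subseteq> U" using X(3) by (rule subset_trans)
  then show thesis using that X(2) by blast
qed

text \<open>Allows passing from finitely many replacements in a point to infinitely many.\<close>

lemma closed_cylinder_limit:
  fixes X :: "('g \<Rightarrow> 'a::topological_space) set"
  assumes "closed X" "\<And>K. finite K \<Longrightarrow> \<exists>x\<in>X. \<forall>h\<in>K. x h = y h"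
  shows "y \<in> X"
proof (rule ccontr)
  assume "y \<notin> X"
  then obtain K where "finite K" "{z. \<forall>h\<in>K. z h = y h} \<subseteq> - X"
    using open_contains_cylinder[of "- X" y] assms(1) by (auto simp: open_Compl)
  then show False using assms(2)[of K] by blast
qed

lemma compact_full_shift: "compact (UNIV :: ('g \<Rightarrow> 'a::{finite, topological_space}) set)"
proof -
  have "compact_space (euclidean :: 'a topology)"
    by (simp add: compact_space_def finite_imp_compact)
  then have "compact_space (product_topology (\<lambda>i::'g. euclidean :: 'a topology) UNIV)"
    by (simp add: compact_space_product_topology)
  then show ?thesis by (simp add: compact_space_def euclidean_product_topology)
qed

lemma compact_closed_shift:
  fixes X :: "('g \<Rightarrow> 'a::{finite, topological_space}) set"
  shows "closed X \<Longrightarrow> compact X"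
  using compact_Int_closed[OF compact_full_shift, of X] by simp

text \<open>Heine-Cantor with windows in place of a metric: the union of the windows of a finite
  subcover works everywhere, as both points are compared with the same centre.\<close>

lemma uniformly_continuous_cylinder:
  fixes X :: "('g \<Rightarrow> 'a::{finite, discrete_topology}) set" and \<phi> :: "('g \<Rightarrow> 'a) \<Rightarrow> real"
  assumes X: "closed X" and \<phi>: "continuous_on X \<phi>" and e: "0 < e"
  obtains K where "finite K" "\<And>x y. x \<in> X \<Longrightarrow> y \<in> X \<Longrightarrow> (\<forall>h\<in>K. x h = y h) \<Longrightarrow> \<bar>\<phi> x - \<phi> y\<bar> < e"
proof -
  have "\<exists>K. finite K \<and> (\<forall>y\<in>X. (\<forall>h\<in>K. y h = x h) \<longrightarrow> \<bar>\<phi> y - \<phi> x\<bar> < e / 2)" if "x \<in> X" for x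
  proof -
    have "open {t. \<bar>t - \<phi> x\<bar> < e / 2}"
      by (intro open_Collect_less continuous_intros)
    then obtain U where U: "open U" "U \<inter> X = \<phi> -` {t. \<bar>t - \<phi> x\<bar> < e / 2} \<inter> X"
      using \<phi> unfolding continuous_on_open_invariant by blast
    have "x \<in> \<phi> -` {t. \<bar>t - \<phi> x\<bar> < e / 2} \<inter> X" using that e by simp
    then have "x \<in> U" using U(2) by blast
    then obtain K where "finite K" "{y. \<forall>h\<in>K. y h = x h} \<subseteq> U"
      using open_contains_cylinder U(1) by blast
    then show ?thesis using U(2) by blast
  qed
  then obtain k where k: "\<And>x. x \<in> X \<Longrightarrow> finite (k x)"
     "\<And>x y. x \<in> X \<Longrightarrow> y \<in> X \<Longrightarrow> (\<forall>h\<in>k x. y h = x h) \<Longrightarrow> \<bar>\<phi> y - \<phi> x\<bar> < e / 2"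
    by metis
  obtain C where C: "C \<subseteq> X" "finite C" "X \<subseteq> (\<Union>x\<in>C. {y. \<forall>h\<in>k x. y h = x h})"
  proof (rule compactE_image[OF compact_closed_shift[OF X], of X "\<lambda>x. {y. \<forall>h\<in>k x. y h = x h}"])
    show "open {y. \<forall>h\<in>k x. y h = x h}" if "x \<in> X" for x using open_cylinder k(1)[OF that] .
    show "X \<subseteq> (\<Union>x\<in>X. {y. \<forall>h\<in>k x. y h = x h})" by auto
  qed
  show thesis
  proof (rule that[of "\<Union>x\<in>C. k x"])
    show "finite (\<Union>x\<in>C. k x)" using C k by auto
    fix x y assume xy: "x \<in> X" "y \<in> X" "\<forall>h\<in>\<Union>x\<in>C. k x. x h = y h"
    then obtain z where z: "z \<in> C" "\<forall>h\<in>k z. x h = z h" using C(3) by blast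
    then have "\<forall>h\<in>k z. y h = z h" using xy(3) by force
    then have "\<bar>\<phi> x - \<phi> z\<bar> < e / 2" "\<bar>\<phi> y - \<phi> z\<bar> < e / 2"
      using k(2)[of z x] k(2)[of z y] z C(1) xy by blast+
    then show "\<bar>\<phi> x - \<phi> y\<bar> < e" by linarith
  qed
qed

lemma bounded_on_closed_shift:
  fixes X :: "('g \<Rightarrow> 'a::{finite, topological_space}) set" and \<phi> :: "('g \<Rightarrow> 'a) \<Rightarrow> real"
  assumes "closed X" "continuous_on X \<phi>"
  obtains B where "0 \<le> B" "\<And>x. x \<in> X \<Longrightarrow> \<bar>\<phi> x\<bar> \<le> B"
proof -
  have "bounded (\<phi> ` X)"
    using compact_closed_shift assms compact_continuous_image compact_imp_bounded by blast
  then obtain B where "\<forall>t\<in>\<phi> ` X. norm t \<le> B" unfolding bounded_iff by blast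
  then show thesis using that[of "max B 0"] by force
qed

subsection \<open>The Borel sets of the full shift\<close>

definition cylinders :: "('g \<Rightarrow> 'a) set set" where
  "cylinders = {{y. \<forall>h\<in>K. y h = p h} | K p. finite K}"

lemma countable_cylinders: "countable (cylinders :: ('g::countable \<Rightarrow> 'a::finite) set set)"
proof -
  have eq: "cylinders = (\<Union>K\<in>Collect finite. (\<lambda>p. {y. \<forall>h\<in>K. y h = p h}) ` (\<Pi>\<^sub>E h\<in>K. (UNIV :: 'a set)) :: ('g \<Rightarrow> 'a) set set)"
  proof (intro equalityI subsetI)
    fix C :: "('g \<Rightarrow> 'a) set" assume "C \<in> cylinders"
    then obtain K p where K: "finite K" "C = {y. \<forall>h\<in>K. y h = p h}" by (auto simp: cylinders_def)
    then have "C = {y. \<forall>h\<in>K. y h = restrict p K h}" by simp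
    then show "C \<in> (\<Union>K\<in>Collect finite. (\<lambda>p. {y. \<forall>h\<in>K. y h = p h}) ` (\<Pi>\<^sub>E h\<in>K. UNIV))"
      using K(1) by (intro UN_I[of K] image_eqI[of _ _ "restrict p K"]) auto
  qed (auto simp: cylinders_def)
  have "countable (\<Pi>\<^sub>E h\<in>K. (UNIV :: 'a set))" if "finite K" for K :: "'g set"
    using that by (intro countable_finite finite_PiE) auto
  then show ?thesis
    unfolding eq by (intro countable_UN countable_image countable_Collect_finite) simp
qed

text \<open>As the group is countable and the alphabet finite, there are countably many cylinders,
  so an open set is a countable union of them.\<close>

lemma sets_borel_shift:
  "sets (borel :: ('g::countable \<Rightarrow> 'a::{finite, discrete_topology}) measure) = sigma_sets UNIV cylinders"
proof
  show "sigma_sets UNIV cylinders \<subseteq> sets (borel :: ('g \<Rightarrow> 'a) measure)"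
  proof -
    have "cylinders \<subseteq> sets (borel :: ('g \<Rightarrow> 'a) measure)"
      unfolding cylinders_def by (auto intro!: borel_open open_cylinder)
    then show ?thesis using sets.sigma_sets_subset[of cylinders "borel :: ('g \<Rightarrow> 'a) measure"] by simp
  qed
  have "U \<in> sigma_sets UNIV cylinders" if "open U" for U :: "('g \<Rightarrow> 'a) set"
  proof -
    interpret sigma_algebra UNIV "sigma_sets UNIV (cylinders :: ('g \<Rightarrow> 'a) set set)"
      by (rule sigma_algebra_sigma_sets) simp
    let ?\<C> = "{C \<in> cylinders. C \<subseteq> U}"
    have "\<Union>?\<C> = U"
    proof
      show "U \<subseteq> \<Union>?\<C>"
      proof
        fix x assume "x \<in> U"
        then obtain K where K: "finite K" "{y. \<forall>h\<in>K. y h = x h} \<subseteq> U"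
          using open_contains_cylinder \<open>open U\<close> by blast
        then have "{y. \<forall>h\<in>K. y h = x h} \<in> ?\<C>" by (auto simp: cylinders_def)
        then show "x \<in> \<Union>?\<C>" by blast
      qed
    qed auto
    moreover have "countable ?\<C>"
      by (rule countable_subset[OF _ countable_cylinders]) auto
    then have "\<Union>?\<C> \<in> sigma_sets UNIV cylinders"
      by (rule countable_Union) auto
    ultimately show ?thesis by simp
  qed
  then have "{S :: ('g \<Rightarrow> 'a) set. open S} \<subseteq> sigma_sets UNIV cylinders" by auto
  then have "sigma_sets UNIV {S :: ('g \<Rightarrow> 'a) set. open S} \<subseteq> sigma_sets UNIV cylinders"
    by (rule sigma_sets_mono)
  then show "sets (borel :: ('g \<Rightarrow> 'a) measure) \<subseteq> sigma_sets UNIV cylinders"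
    by (simp add: borel_def)
qed

lemma measurable_shiftI:
  fixes f :: "'x \<Rightarrow> 'g::countable \<Rightarrow> 'a::{finite, discrete_topology}"
  assumes "\<And>h a. {x \<in> space M. f x h = a} \<in> sets M"
  shows "f \<in> borel_measurable M"
proof (rule measurable_sigma_sets[OF sets_borel_shift])
  fix C :: "('g \<Rightarrow> 'a) set" assume "C \<in> cylinders"
  then obtain K p where K: "finite K" "C = {y. \<forall>h\<in>K. y h = p h}" by (auto simp: cylinders_def)
  have "{x \<in> space M. \<forall>h\<in>K. f x h = p h} \<in> sets M"
    using K(1) assms by (intro sets.sets_Collect_finite_All) auto
  also have "{x \<in> space M. \<forall>h\<in>K. f x h = p h} = f -` C \<inter> space M" using K(2) by auto
  finally show "f -` C \<inter> space M \<in> sets M" .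
qed auto

lemma sets_coordinate:
  fixes f :: "'x \<Rightarrow> 'g \<Rightarrow> 'a::{finite, discrete_topology}"
  assumes "f \<in> borel_measurable M" "finite K"
  shows "{x \<in> space M. restrict (f x) K \<in> S} \<in> sets M"
proof -
  have 1: "{x \<in> space M. f x h = a} \<in> sets M" for h a
  proof -
    have "open {y :: 'g \<Rightarrow> 'a. \<forall>k\<in>{h}. y k = a}" by (rule open_cylinder) simp
    then have "{y :: 'g \<Rightarrow> 'a. \<forall>k\<in>{h}. y k = a} \<in> sets borel" by (rule borel_open)
    from measurable_sets[OF assms(1) this] show ?thesis by (simp add: vimage_def Int_def conj_commute)
  qed
  have "{x \<in> space M. restrict (f x) K = p} \<in> sets M" if "p \<in> (\<Pi>\<^sub>E h\<in>K. UNIV)" for p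
  proof -
    have "{x \<in> space M. \<forall>h\<in>K. f x h = p h} \<in> sets M"
      using assms(2) 1 by (intro sets.sets_Collect_finite_All) auto
    also have "{x \<in> space M. \<forall>h\<in>K. f x h = p h} = {x \<in> space M. restrict (f x) K = p}"
      using that by (auto simp: fun_eq_iff restrict_def PiE_def extensional_def)
    finally show ?thesis .
  qed
  moreover have "finite (\<Pi>\<^sub>E h\<in>K. (UNIV :: 'a set))" using assms(2) by (intro finite_PiE) auto
  ultimately have "(\<Union>p\<in>S \<inter> (\<Pi>\<^sub>E h\<in>K. UNIV). {x \<in> space M. restrict (f x) K = p}) \<in> sets M"
    by (intro sets.finite_UN) auto
  also have "(\<Union>p\<in>S \<inter> (\<Pi>\<^sub>E h\<in>K. UNIV). {x \<in> space M. restrict (f x) K = p}) = {x \<in> space M. restrict (f x) K \<in> S}"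
    by auto
  finally show ?thesis .
qed

lemma sets_borel_restrict:
  "finite K \<Longrightarrow> {x :: 'g \<Rightarrow> 'a::{finite, discrete_topology}. restrict x K \<in> S} \<in> sets borel"
  using sets_coordinate[of "\<lambda>x. x" borel K S] by simp

lemma simple_function_window:
  fixes f :: "'x \<Rightarrow> 'g \<Rightarrow> 'a::{finite, discrete_topology}"
  assumes "f \<in> borel_measurable M" "finite K"
  shows "simple_function M (\<lambda>x. restrict (f x) K)"
  unfolding simple_function_def
proof
  have "(\<lambda>x. restrict (f x) K) ` space M \<subseteq> (\<Pi>\<^sub>E h\<in>K. UNIV)" by auto
  then show "finite ((\<lambda>x. restrict (f x) K) ` space M)"
    by (rule finite_subset) (use assms(2) in \<open>auto intro: finite_PiE\<close>)
  show "\<forall>p\<in>(\<lambda>x. restrict (f x) K) ` space M. (\<lambda>x. restrict (f x) K) -` {p} \<inter> space M \<in> sets M"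
  proof
    fix p
    have "(\<lambda>x. restrict (f x) K) -` {p} \<inter> space M = {x \<in> space M. restrict (f x) K \<in> {p}}" by auto
    then show "(\<lambda>x. restrict (f x) K) -` {p} \<inter> space M \<in> sets M"
      using sets_coordinate[OF assms, of "{p}"] by simp
  qed
qed

text \<open>A single window event approximates A in both measures, because later an inequality
  between two measures is carried over from windows to A. The property is verified along the
  generation of the Borel sets from the cylinders.\<close>

lemma approximate_by_window:
  fixes N1 N2 :: "('g::countable \<Rightarrow> 'a::{finite, discrete_topology}) measure"
  assumes "finite_measure N1" "finite_measure N2" and N: "sets N1 = sets borel" "sets N2 = sets borel"
    and A: "A \<in> sets borel" and e: "0 < e"
  obtains K S where "finite K" "measure N1 (sym_diff A {x. restrict x K \<in> S}) < e"
    "measure N2 (sym_diff A {x. restrict x K \<in> S}) < e"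
proof -
  interpret N1: finite_measure N1 by fact
  interpret N2: finite_measure N2 by fact
  let ?C = "\<lambda>K S. {x :: 'g \<Rightarrow> 'a. restrict x K \<in> S}"
  have C: "?C K S \<in> sets borel" if "finite K" for K S using that by (rule sets_borel_restrict)
  have "\<forall>e>0. \<exists>K S. finite K \<and> measure N1 (sym_diff A (?C K S)) < e \<and> measure N2 (sym_diff A (?C K S)) < e"
    using A unfolding sets_borel_shift
  proof (induction A rule: sigma_sets.induct)
    case (Basic A)
    then obtain K p where K: "finite K" "A = {y. \<forall>h\<in>K. y h = p h}" by (auto simp: cylinders_def)
    have "A = ?C K {restrict p K}" using K by (auto simp: restrict_eq_iff)
    then show ?case using K(1) by (metis Diff_cancel Un_empty measure_empty)
  next
    case Empty
    have "{} = ?C {} {}" by simp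
    then show ?case by (metis Diff_cancel Un_empty measure_empty finite.emptyI)
  next
    case (Compl A)
    have "sym_diff (UNIV - A) (?C K (- S)) = sym_diff A (?C K S)" for K S by auto
    then show ?case using Compl.IH by metis
  next
    case (Union A)
    have As: "A i \<in> sets borel" for i using Union.hyps unfolding sets_borel_shift by blast
    show ?case
    proof (intro allI impI)
      fix e :: real assume e: "0 < e"
      let ?B = "\<lambda>n. \<Union>i<n. A i"
      let ?U = "\<Union>i. A i"
      have lim: "(\<lambda>n. measure N (?U - ?B n)) \<longlonglongrightarrow> 0" if "finite_measure N" "sets N = sets borel" for N
      proof -
        interpret finite_measure N by fact
        have "(\<lambda>n. measure N (?U - ?B n)) \<longlonglongrightarrow> measure N (\<Inter>n. ?U - ?B n)"
          by (rule finite_Lim_measure_decseq) (use As that in \<open>auto simp: decseq_def intro: less_le_trans\<close>)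
        also have "(\<Inter>n. ?U - ?B n) = {}" by blast
        finally show ?thesis by simp
      qed
      have "\<forall>\<^sub>F n in sequentially. measure N1 (?U - ?B n) < e / 2 \<and> measure N2 (?U - ?B n) < e / 2"
        by (intro eventually_conj order_tendstoD(2)[OF lim]) (use assms e in auto)
      then obtain n where n: "measure N1 (?U - ?B n) < e / 2" "measure N2 (?U - ?B n) < e / 2"
        unfolding eventually_sequentially by blast
      \<comment> \<open>The n approximation errors may add up to e / 2; the other half is spent on
        cutting off the union at n.\<close>
      define d where "d = e / (2 * (real n + 1))"
      have d: "0 < d" using e by (simp add: d_def)
      have nd: "real n * d \<le> e / 2" using e by (simp add: d_def field_simps)
      have "\<exists>K S. finite K \<and> measure N1 (sym_diff (A i) (?C K S)) < d \<and> measure N2 (sym_diff (A i) (?C K S)) < d" for i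
        using Union.IH d by blast
      then obtain K S where KS: "\<And>i. finite (K i)"
        "\<And>i. measure N1 (sym_diff (A i) (?C (K i) (S i))) < d"
        "\<And>i. measure N2 (sym_diff (A i) (?C (K i) (S i))) < d" by metis
      define L where "L = (\<Union>i<n. K i)"
      define R where "R = {p. \<exists>i<n. restrict p (K i) \<in> S i}"
      have L: "finite L" using KS(1) by (auto simp: L_def)
      have eqR: "?C L R = (\<Union>i<n. ?C (K i) (S i))"
      proof -
        have "restrict (restrict x L) (K i) = restrict x (K i)" if "i < n" for x :: "'g \<Rightarrow> 'a" and i
          using that by (auto simp: L_def fun_eq_iff restrict_def)
        then show ?thesis by (auto simp: R_def)
      qed
      have sub: "sym_diff ?U (?C L R) \<subseteq> (?U - ?B n) \<union> (\<Union>i<n. sym_diff (A i) (?C (K i) (S i)))"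
        unfolding eqR by blast
      have bnd: "measure N (sym_diff ?U (?C L R)) < e"
        if N: "finite_measure N" "sets N = sets borel" "measure N (?U - ?B n) < e / 2"
          "\<And>i. measure N (sym_diff (A i) (?C (K i) (S i))) < d" for N
      proof -
        interpret finite_measure N by fact
        have sd: "sym_diff (A i) (?C (K i) (S i)) \<in> sets N" for i
          using As C[OF KS(1)] N(2) by auto
        have "measure N (sym_diff ?U (?C L R)) \<le> measure N ((?U - ?B n) \<union> (\<Union>i<n. sym_diff (A i) (?C (K i) (S i))))"
          using sub by (rule finite_measure_mono) (use As sd N(2) in auto)
        also have "\<dots> \<le> measure N (?U - ?B n) + measure N (\<Union>i<n. sym_diff (A i) (?C (K i) (S i)))"
          by (rule measure_Un_le) (use As sd N(2) in auto)
        also have "measure N (\<Union>i<n. sym_diff (A i) (?C (K i) (S i))) \<le> (\<Sum>i<n. measure N (sym_diff (A i) (?C (K i) (S i))))"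
          by (rule measure_UNION_le) (use sd in auto)
        also have "\<dots> \<le> (\<Sum>i<n. d)" using N(4) by (intro sum_mono less_imp_le)
        also have "\<dots> \<le> e / 2" using nd by simp
        finally show ?thesis using N(3) by simp
      qed
      show "\<exists>K S. finite K \<and> measure N1 (sym_diff ?U (?C K S)) < e \<and> measure N2 (sym_diff ?U (?C K S)) < e"
        using L bnd[of N1] bnd[of N2] assms n KS by blast
    qed
  qed
  then show thesis using that e by blast
qed

subsection \<open>Invariant measures on a subshift\<close>

lemma shift_map_shift_map: "shift_map g (shift_map k x) = shift_map (k + g) x"
  by (simp add: shift_map_def add.assoc)

lemma shift_map_0 [simp]: "shift_map 0 x = x"
  by (simp add: shift_map_def)

lemma subshift_closed: "subshift X \<Longrightarrow> closed X"
  by (simp add: subshift_def)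

lemma subshift_shift_map: "subshift X \<Longrightarrow> x \<in> X \<Longrightarrow> shift_map g x \<in> X"
  by (auto simp: subshift_def)

lemma orbit_shift: "tuple (\<lambda>g x. shift_map g x 0) F x = restrict x F"
  by (simp add: tuple_def shift_map_def)

locale invariant_measure =
  fixes X :: "('g::{group_add, countable} \<Rightarrow> 'a::{finite, discrete_topology}) set"
    and \<mu> :: "('g \<Rightarrow> 'a) measure"
  assumes X: "subshift X" and \<mu>: "\<mu> \<in> invariant_measures X"
begin

lemma space_eq: "space \<mu> = X" and sets_eq: "sets \<mu> = sets (restrict_space borel X)"
  using \<mu> by (auto simp: invariant_measures_def)

lemma X_borel [measurable]: "X \<in> sets borel"
  using subshift_closed[OF X] by (rule borel_closed)

lemma in_sets_iff: "A \<in> sets \<mu> \<longleftrightarrow> A \<subseteq> X \<and> A \<in> sets borel"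
  unfolding sets_eq using X_borel by (subst sets_restrict_space_iff) auto

lemma id_measurable: "(\<lambda>x. x) \<in> borel_measurable \<mu>"
  using measurable_restrict_space1[of "\<lambda>x. x" borel borel X]
  by (simp add: measurable_cong_sets[OF sets_eq refl])

lemma measurable_intoI:
  assumes "f \<in> borel_measurable M" "\<And>x. x \<in> space M \<Longrightarrow> f x \<in> X"
  shows "f \<in> measurable M \<mu>"
  unfolding measurable_cong_sets[OF refl sets_eq]
  by (rule measurable_restrict_space2) (use assms in auto)

lemma sets_window: "finite K \<Longrightarrow> {x \<in> X. restrict x K \<in> S} \<in> sets \<mu>"
  using sets_coordinate[OF id_measurable, of K S] by (simp add: space_eq)

lemma sets_cylinder: "finite K \<Longrightarrow> {x \<in> X. \<forall>k\<in>K. x k = t k} \<in> sets \<mu>"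
  using sets_window[of K "{restrict t K}"] by (simp only: singleton_iff restrict_eq_iff)

lemma continuous_on_measurable: "continuous_on X \<phi> \<Longrightarrow> \<phi> \<in> borel_measurable \<mu>"
  unfolding measurable_cong_sets[OF sets_eq refl]
  by (rule borel_measurable_continuous_on_restrict)

lemma sets_coord: "{x \<in> X. x h = a} \<in> sets \<mu>"
  using sets_window[of "{h}" "{p. p h = a}"] by simp

lemma shift_map_measurable: "shift_map g \<in> measurable \<mu> \<mu>"
  by (rule measurable_intoI, rule measurable_shiftI)
    (auto simp: space_eq shift_map_def sets_coord subshift_shift_map[OF X, unfolded shift_map_def])

sublocale mp_action \<mu> "shift_map :: 'g \<Rightarrow> ('g \<Rightarrow> 'a) \<Rightarrow> ('g \<Rightarrow> 'a)"
proof (intro mp_action.intro mp_action_axioms.intro)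
  show "prob_space \<mu>" "distr \<mu> \<mu> (shift_map g) = \<mu>" for g
    using \<mu> by (auto simp: invariant_measures_def)
  show "shift_map g \<in> measurable \<mu> \<mu>" for g by (rule shift_map_measurable)
  show "shift_map g (shift_map k x) = shift_map (k + g) x" for g k x by (rule shift_map_shift_map)
qed

lemma orbit_eq_window: "orbit (\<lambda>x. x 0) K = (\<lambda>x. restrict x K)"
  by (rule ext) (rule orbit_shift)

lemma simple_window: "finite K \<Longrightarrow> simple_function \<mu> (\<lambda>x. restrict x K)"
  by (rule simple_function_window[OF id_measurable])

lemma simple_symbol: "simple_function \<mu> (\<lambda>x. x 0)"
  by (rule simple_function_determined[OF simple_window[of "{0}"]]) (auto simp: restrict_eq_iff)

lemma ent_indicator: "ent \<mu> (\<lambda>x. x \<in> D) = eta (prob (D \<inter> X)) + eta (1 - prob (D \<inter> X))" if "D \<in> sets \<mu>"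
proof -
  have "ent \<mu> (\<lambda>x. x \<in> D) = (\<Sum>b\<in>UNIV. eta (prob ((\<lambda>x. x \<in> D) -` {b} \<inter> space \<mu>)))"
    by (rule ent_superset) auto
  also have "\<dots> = eta (prob (D \<inter> X)) + eta (prob (X - D))"
  proof -
    have "(\<lambda>x. x \<in> D) -` {True} \<inter> space \<mu> = D \<inter> X" "(\<lambda>x. x \<in> D) -` {False} \<inter> space \<mu> = X - D"
      by (auto simp: space_eq)
    then show ?thesis by (simp add: UNIV_bool)
  qed
  also have "prob (X - D) = 1 - prob (D \<inter> X)"
  proof -
    have "D \<inter> X = D" using that in_sets_iff by blast
    then show ?thesis using prob_compl[OF that] by (simp add: space_eq)
  qed
  finally show ?thesis .
qed

text \<open>A level set of f is close to a window event B. Once B is known, membership in the level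
  set is decided by the symmetric difference D, and the entropy of D is small because its
  probability is. Finitely many level sets share one window.\<close>

lemma cond_ent_small:
  assumes f: "simple_function \<mu> f" and e: "0 < e"
  obtains K where "finite K" "cond_ent \<mu> f (\<lambda>x. restrict x K) \<le> e"
proof -
  define V where "V = f ` X"
  have V: "finite V" using simple_functionD(1)[OF f] by (simp add: V_def space_eq)
  define d where "d = e / (real (card V) + 1)"
  have d: "0 < d" "real (card V) * d \<le> e" using e by (auto simp: d_def field_simps)
  have "((\<lambda>t::real. - t * ln t - (1 - t) * ln (1 - t)) \<longlongrightarrow> 0) (at_right 0)"
    by real_asymp
  then have "\<forall>\<^sub>F t in at_right 0. eta t + eta (1 - t) < d"
    by (rule order_tendstoD(2)[THEN eventually_mono, OF _ d(1)]) (simp add: eta_def algebra_simps)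
  then obtain c where c: "0 < c" "\<And>t. 0 < t \<Longrightarrow> t < c \<Longrightarrow> eta t + eta (1 - t) < d"
    unfolding eventually_at_right_field by auto
  define N where "N = distr \<mu> borel (\<lambda>x. x)"
  have N: "finite_measure N" "sets N = sets borel"
    using prob_space_distr[OF id_measurable] by (auto simp: N_def prob_space_def)
  have mN: "measure N B = prob (B \<inter> X)" if "B \<in> sets borel" for B
    using measure_distr[OF id_measurable that] by (simp add: N_def space_eq)
  have fib: "f -` {a} \<inter> X \<in> sets borel" for a
    using simple_functionD(2)[OF f, of "{a}"] by (simp add: in_sets_iff space_eq)
  have "\<exists>K S. finite K \<and> measure N (sym_diff (f -` {a} \<inter> X) {x. restrict x K \<in> S}) < c" for a
    using approximate_by_window[OF N(1) N(1) N(2) N(2) fib c(1)] by metis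
  then obtain K S where K: "\<And>a. finite (K a)"
    and KS: "\<And>a. measure N (sym_diff (f -` {a} \<inter> X) {x. restrict x (K a) \<in> S a}) < c" by metis
  define L where "L = (\<Union>a\<in>V. K a)"
  have L: "finite L" using V K by (auto simp: L_def)
  have sfA: "simple_function \<mu> (\<lambda>x. f x = a)" for a
    by (rule simple_function_determined[OF f]) simp
  have cA: "cond_ent \<mu> (\<lambda>x. f x = a) (\<lambda>x. restrict x L) \<le> d" if a: "a \<in> V" for a
  proof -
    define B where "B = {x \<in> X. restrict x (K a) \<in> S a}"
    define D where "D = sym_diff (f -` {a} \<inter> X) B"
    have B: "B \<in> sets \<mu>" unfolding B_def by (rule sets_window[OF K])
    have D: "D \<in> sets \<mu>" using B simple_functionD(2)[OF f, of "{a}"] by (auto simp: D_def space_eq)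
    have sfB: "simple_function \<mu> (\<lambda>x. x \<in> B)"
      by (rule simple_function_determined[OF simple_window[OF K[of a]]]) (auto simp: B_def space_eq)
    have sfD: "simple_function \<mu> (\<lambda>x. x \<in> D)"
      by (rule simple_function_determined[OF simple_function_Pair[OF f sfB]]) (auto simp: D_def space_eq)
    have "cond_ent \<mu> (\<lambda>x. f x = a) (\<lambda>x. restrict x L) \<le> cond_ent \<mu> (\<lambda>x. f x = a) (\<lambda>x. x \<in> B)"
    proof (rule cond_ent_antimono[OF sfA simple_window[OF L]])
      fix x y assume "x \<in> space \<mu>" "y \<in> space \<mu>" "restrict x L = restrict y L"
      then have "restrict x (K a) = restrict y (K a)"
        using a unfolding restrict_eq_iff L_def by blast
      then show "(x \<in> B) = (y \<in> B)" using \<open>x \<in> space \<mu>\<close> \<open>y \<in> space \<mu>\<close> by (simp add: B_def space_eq)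
    qed
    also have "\<dots> \<le> cond_ent \<mu> (\<lambda>x. x \<in> D) (\<lambda>x. x \<in> B)"
      by (rule cond_ent_mono[OF sfD sfB]) (auto simp: D_def space_eq)
    also have "\<dots> \<le> ent \<mu> (\<lambda>x. x \<in> D)" by (rule cond_ent_le_ent[OF sfD sfB])
    also have "\<dots> = eta (prob (D \<inter> X)) + eta (1 - prob (D \<inter> X))"
      by (rule ent_indicator[OF D])
    also have "\<dots> \<le> d"
    proof -
      have "prob (D \<inter> X) = measure N (sym_diff (f -` {a} \<inter> X) {x. restrict x (K a) \<in> S a})"
      proof (subst mN)
        show "sym_diff (f -` {a} \<inter> X) {x. restrict x (K a) \<in> S a} \<in> sets borel"
          by (intro sets.Un sets.Diff fib sets_borel_restrict K)
        have "D \<inter> X = sym_diff (f -` {a} \<inter> X) {x. restrict x (K a) \<in> S a} \<inter> X"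
          unfolding D_def B_def by blast
        then show "prob (D \<inter> X) = prob (sym_diff (f -` {a} \<inter> X) {x. restrict x (K a) \<in> S a} \<inter> X)"
          by (rule arg_cong)
      qed
      then have "prob (D \<inter> X) < c" using KS by simp
      \<comment> \<open>The choice of c speaks of positive probabilities only; at 0 both entropy
        terms vanish.\<close>
      then show ?thesis using c(2)[of "prob (D \<inter> X)"] d(1) measure_nonneg[of \<mu> "D \<inter> X"]
        by (cases "prob (D \<inter> X) = 0") auto
    qed
    finally show ?thesis .
  qed
  have "cond_ent \<mu> f (\<lambda>x. restrict x L) \<le> cond_ent \<mu> (tuple (\<lambda>a x. f x = a) V) (\<lambda>x. restrict x L)"
    by (rule cond_ent_mono[OF simple_function_tuple[OF V sfA] simple_window[OF L]])
      (auto simp: tuple_eq_iff V_def space_eq)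
  also have "\<dots> \<le> (\<Sum>a\<in>V. cond_ent \<mu> (\<lambda>x. f x = a) (\<lambda>x. restrict x L))"
    by (rule cond_ent_tuple_le[OF V sfA simple_window[OF L]])
  also have "\<dots> \<le> (\<Sum>a\<in>V. d)" by (intro sum_mono cA)
  also have "\<dots> \<le> e" using d(2) by simp
  finally show thesis using that L by blast
qed

text \<open>The Kolmogorov-Sinai generator theorem for the symbol at the origin: by
  \<open>cond_ent_small\<close> any finite partition is almost a function of a finite window. It
  also shows that the supremum is a real number, without which a strict gain of pressure could not
  be concluded.\<close>

lemma ks_entropy_eq:
  fixes \<F> :: "nat \<Rightarrow> 'g set"
  assumes fol: "folner_sequence \<F>"
  shows "ks_entropy \<mu> shift_map = ereal (entropy_rate \<mu> shift_map (fibres \<mu> (\<lambda>x. x 0)))"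
  unfolding ks_entropy_def
proof (rule antisym)
  show "ereal (entropy_rate \<mu> shift_map (fibres \<mu> (\<lambda>x. x 0)))
    \<le> (SUP P\<in>{P. measurable_partition \<mu> P}. ereal (entropy_rate \<mu> shift_map P))"
    by (rule SUP_upper) (simp add: measurable_partition_fibres[OF simple_symbol])
  show "(SUP P\<in>{P. measurable_partition \<mu> P}. ereal (entropy_rate \<mu> shift_map P))
     \<le> ereal (entropy_rate \<mu> shift_map (fibres \<mu> (\<lambda>x. x 0)))"
  proof (rule SUP_least)
    fix P assume "P \<in> {P. measurable_partition \<mu> P}"
    then obtain f :: "('g \<Rightarrow> 'a) \<Rightarrow> ('g \<Rightarrow> 'a) set set" where f: "simple_function \<mu> f" "P = fibres \<mu> f"
      using measurable_partition_eq_fibres by blast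
    have "entropy_rate \<mu> shift_map P \<le> entropy_rate \<mu> shift_map (fibres \<mu> (\<lambda>x. x 0)) + e" if e: "0 < e" for e
    proof -
      obtain K where "finite K" "cond_ent \<mu> f (\<lambda>x. restrict x K) \<le> e"
        using cond_ent_small[OF f(1) e] by blast
      then show ?thesis
        using entropy_rate_le_of_cond_ent[OF f(1) simple_symbol fol, of K e] by (simp add: f(2) orbit_eq_window)
    qed
    then show "ereal (entropy_rate \<mu> shift_map P) \<le> ereal (entropy_rate \<mu> shift_map (fibres \<mu> (\<lambda>x. x 0)))"
      unfolding ereal_less_eq by (rule field_le_epsilon)
  qed
qed

end

subsection \<open>Local oscillations of a potential of summable variation\<close>

lemma abs_diff_le_variation:
  fixes X :: "('g::group_add \<Rightarrow> 'a::{finite, discrete_topology}) set"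
  assumes X: "subshift X" and \<phi>: "potential X \<phi>"
    and xy: "x \<in> X" "y \<in> X" "\<forall>h\<in>E. x h = y h"
  shows "\<bar>\<phi> x - \<phi> y\<bar> \<le> variation X E \<phi>"
proof -
  obtain B where B: "\<And>x. x \<in> X \<Longrightarrow> \<bar>\<phi> x\<bar> \<le> B"
    using bounded_on_closed_shift X \<phi> unfolding potential_def subshift_def by metis
  let ?S = "{\<phi> x - \<phi> y | x y. x \<in> X \<and> y \<in> X \<and> restrict x E = restrict y E}"
  have "bdd_above ?S"
  proof (rule bdd_aboveI[of _ "2 * B"])
    fix t assume "t \<in> ?S"
    then obtain x y where "t = \<phi> x - \<phi> y" "x \<in> X" "y \<in> X" by auto
    then show "t \<le> 2 * B" using B[of x] B[of y] by linarith
  qed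
  moreover have "\<phi> x - \<phi> y \<in> ?S" "\<phi> y - \<phi> x \<in> ?S"
    using xy by (auto simp: restrict_eq_iff) (metis restrict_eq_iff)+
  ultimately have "\<phi> x - \<phi> y \<le> variation X E \<phi>" "\<phi> y - \<phi> x \<le> variation X E \<phi>"
    unfolding variation_def by (auto intro: cSup_upper)
  then show ?thesis by linarith
qed

text \<open>V h bounds the effect on \<open>\<phi>\<close> of a change confined to h + F. If h + F
  misses \<open>E k\<close> but meets \<open>E (Suc k)\<close>, the effect is at most the variation
  over \<open>E k\<close>, and some h + f lies in \<open>E (Suc k) - E k\<close>. Hence at most
  \<open>card F * card (E (Suc k) - E k)\<close> elements h belong to the same k, and up to the
  factor \<open>card F\<close> this is the weight in the definition of summable variation.\<close>

lemma summable_variation_oscillation: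
  fixes X :: "('g::group_add \<Rightarrow> 'a::{finite, discrete_topology}) set"
  assumes X: "subshift X" "X \<noteq> {}" and \<phi>: "summable_variation X \<phi>" and F: "finite F"
  obtains V :: "'g \<Rightarrow> real" where "\<And>h. 0 \<le> V h" "V summable_on UNIV"
    "\<And>h x y. x \<in> X \<Longrightarrow> y \<in> X \<Longrightarrow> (\<And>k. k \<notin> (+) h ` F \<Longrightarrow> x k = y k) \<Longrightarrow> \<bar>\<phi> x - \<phi> y\<bar> \<le> V h"
proof (cases "F = {}")
  case True
  show thesis
  proof (rule that[of "\<lambda>_. 0"])
    fix h and x y :: "'g \<Rightarrow> 'a" assume "\<And>k. k \<notin> (+) h ` F \<Longrightarrow> x k = y k"
    then have "x = y" using True by (intro ext) blast
    then show "\<bar>\<phi> x - \<phi> y\<bar> \<le> 0" by simp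
  qed simp_all
next
  case False
  obtain E where pot: "potential X \<phi>" and ex: "exhaustive_sequence E"
    and sm: "summable (\<lambda>n. real (card (uminus ` E (Suc n) - uminus ` E n)) * variation X (E n) \<phi>)"
    using \<phi> unfolding summable_variation_def by blast
  have E: "finite (E n)" "E n \<subseteq> E (Suc n)" "(\<Union>n. E n) = UNIV" for n
    using ex unfolding exhaustive_sequence_def by blast+
  note var = abs_diff_le_variation[OF X(1) pot]
  have var0: "0 \<le> variation X K \<phi>" for K using var X(2) by fastforce
  \<comment> \<open>Inversion is injective, so the weights can be counted without inverses.\<close>
  have cardE: "card (uminus ` E (Suc n) - uminus ` E n) = card (E (Suc n) - E n)" for n
    by (subst image_set_diff[symmetric]) (auto intro: card_image)
  define hit where "hit h n \<longleftrightarrow> (+) h ` F \<inter> E n \<noteq> {}" for h n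
  \<comment> \<open>The index before the first hit: unless h + F already meets \<open>E 0\<close>,
    the set \<open>E (n h)\<close> is still missed.\<close>
  define n where "n h = (LEAST n. hit h (Suc n))" for h
  have hitn: "hit h (Suc (n h))" for h
    unfolding n_def
  proof (rule LeastI_ex)
    obtain f where f: "f \<in> F" using False by auto
    obtain m where "h + f \<in> E m" using E(3) by blast
    then have "h + f \<in> E (Suc m)" using E(2) by blast
    then show "\<exists>m. hit h (Suc m)" using f unfolding hit_def by blast
  qed
  have nohit: "\<not> hit h (n h)" if "\<not> hit h 0" for h
  proof (cases "n h")
    case 0
    then show ?thesis using that by simp
  next
    case (Suc m)
    then show ?thesis using not_less_Least[of m "\<lambda>n. hit h (Suc n)"] unfolding n_def by simp
  qed
  \<comment> \<open>The finitely many h whose translate meets \<open>E 0\<close> receive the total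
    oscillation of \<open>\<phi>\<close>.\<close>
  define V where "V h = (if hit h 0 then variation X {} \<phi> else variation X (E (n h)) \<phi>)" for h
  have fin: "finite (\<Union>f\<in>F. (\<lambda>e. e - f) ` A)" "card (\<Union>f\<in>F. (\<lambda>e. e - f) ` A) \<le> card F * card A"
    if "finite A" for A :: "'g set"
  proof -
    show "finite (\<Union>f\<in>F. (\<lambda>e. e - f) ` A)" using F that by auto
    have "card (\<Union>f\<in>F. (\<lambda>e. e - f) ` A) \<le> (\<Sum>f\<in>F. card ((\<lambda>e. e - f) ` A))"
      by (rule card_UN_le[OF F])
    also have "\<dots> \<le> (\<Sum>f\<in>F. card A)" using that by (intro sum_mono card_image_le)
    finally show "card (\<Union>f\<in>F. (\<lambda>e. e - f) ` A) \<le> card F * card A" by simp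
  qed
  have B0: "finite {h. hit h 0}"
  proof (rule finite_subset[OF _ fin(1)[OF E(1)[of 0]]])
    show "{h. hit h 0} \<subseteq> (\<Union>f\<in>F. (\<lambda>e. e - f) ` E 0)"
    proof
      fix h assume "h \<in> {h. hit h 0}"
      then obtain f where f: "f \<in> F" "h + f \<in> E 0" by (auto simp: hit_def)
      then show "h \<in> (\<Union>f\<in>F. (\<lambda>e. e - f) ` E 0)"
        by (intro UN_I[of f] image_eqI[of _ _ "h + f"]) auto
    qed
  qed
  have level: "card {h \<in> T. \<not> hit h 0 \<and> n h = k} \<le> card F * card (E (Suc k) - E k)" for T k
  proof -
    have "{h \<in> T. \<not> hit h 0 \<and> n h = k} \<subseteq> (\<Union>f\<in>F. (\<lambda>e. e - f) ` (E (Suc k) - E k))"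
    proof
      fix h assume h: "h \<in> {h \<in> T. \<not> hit h 0 \<and> n h = k}"
      then obtain f where f: "f \<in> F" "h + f \<in> E (Suc k)" using hitn[of h] by (auto simp: hit_def)
      moreover have "h + f \<notin> E k" using nohit[of h] h f by (auto simp: hit_def)
      ultimately show "h \<in> (\<Union>f\<in>F. (\<lambda>e. e - f) ` (E (Suc k) - E k))"
        by (intro UN_I[of f] image_eqI[of _ _ "h + f"]) auto
    qed
    then show ?thesis
      using fin[of "E (Suc k) - E k"] E(1) by (meson card_mono le_trans finite_Diff)
  qed
  have V0: "0 \<le> V h" for h using var0 by (simp add: V_def)
  have "V summable_on UNIV"
  proof (rule nonneg_bdd_above_summable_on[OF V0])
    let ?w = "\<lambda>k. real (card (E (Suc k) - E k)) * variation X (E k) \<phi>"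
    have sw: "summable ?w" using sm by (simp add: cardE)
    show "bdd_above (sum V ` {T. T \<subseteq> UNIV \<and> finite T})"
    proof (rule bdd_aboveI)
      fix t assume "t \<in> sum V ` {T. T \<subseteq> UNIV \<and> finite T}"
      then obtain T where T: "finite T" "t = sum V T" by auto
      let ?T1 = "{h \<in> T. \<not> hit h 0}"
      have "t = sum V {h \<in> T. hit h 0} + sum V ?T1"
        unfolding T(2) using T(1) by (subst sum.union_disjoint[symmetric]) (auto intro: sum.cong)
      also have "sum V {h \<in> T. hit h 0} \<le> sum V {h. hit h 0}"
        using B0 V0 by (intro sum_mono2) auto
      also have "sum V ?T1 = (\<Sum>k\<in>n ` ?T1. sum V {h \<in> ?T1. n h = k})"
        using T(1) by (intro sum.image_gen) auto
      also have "\<dots> \<le> (\<Sum>k\<in>n ` ?T1. card F * ?w k)"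
      proof (rule sum_mono)
        fix k
        have "sum V {h \<in> ?T1. n h = k} = (\<Sum>h\<in>{h \<in> T. \<not> hit h 0 \<and> n h = k}. variation X (E k) \<phi>)"
          by (rule sum.cong) (auto simp: V_def)
        also have "\<dots> = real (card {h \<in> T. \<not> hit h 0 \<and> n h = k}) * variation X (E k) \<phi>" by simp
        also have "\<dots> \<le> real (card F * card (E (Suc k) - E k)) * variation X (E k) \<phi>"
          using level[of T k] var0 by (intro mult_right_mono of_nat_mono)
        finally show "sum V {h \<in> ?T1. n h = k} \<le> card F * ?w k" by simp
      qed
      also have "\<dots> = card F * (\<Sum>k\<in>n ` ?T1. ?w k)" by (simp add: sum_distrib_left)
      also have "\<dots> \<le> card F * suminf ?w"
        using T(1) var0 by (intro mult_left_mono sum_le_suminf[OF sw]) auto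
      finally show "t \<le> sum V {h. hit h 0} + card F * suminf ?w" by simp
    qed
  qed
  moreover have "\<bar>\<phi> x - \<phi> y\<bar> \<le> V h"
    if xy: "x \<in> X" "y \<in> X" "\<And>k. k \<notin> (+) h ` F \<Longrightarrow> x k = y k" for h x y
  proof (cases "hit h 0")
    case True
    then show ?thesis using var[OF xy(1,2), of "{}"] by (simp add: V_def)
  next
    case False
    then have "\<forall>k\<in>E (n h). x k = y k" using nohit[OF False] xy(3) unfolding hit_def by blast
    then show ?thesis using var[OF xy(1,2)] False by (simp add: V_def)
  qed
  ultimately show thesis using that V0 by blast
qed

subsection \<open>Replacing a pattern at a sparse set of sites\<close>

text \<open>The assumption \<open>swap\<close> is the inclusion of extender sets in the form in
  which it is used.\<close>

locale swap_pattern =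
  fixes X :: "('g::{group_add, countable} \<Rightarrow> 'a::{finite, discrete_topology}) set"
    and F :: "'g set" and v w :: "'g \<Rightarrow> 'a"
  assumes X: "subshift X" and F: "finite F"
    and swap: "x \<in> X \<Longrightarrow> (\<And>f. f \<in> F \<Longrightarrow> x f = v f) \<Longrightarrow> override_on x w F \<in> X"
begin

definition occurs :: "('g \<Rightarrow> 'a) \<Rightarrow> ('g \<Rightarrow> 'a) \<Rightarrow> 'g \<Rightarrow> bool" where
  "occurs u x g \<longleftrightarrow> (\<forall>f\<in>F. x (g + f) = u f)"

text \<open>The sites h for which h + F meets g + F. For nonempty F the site g is among them, hence
  the frequent removal of g.\<close>

definition conflict :: "'g \<Rightarrow> 'g set" where
  "conflict g = {h. \<exists>f\<in>F. \<exists>f'\<in>F. h = g + f - f'}"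

definition sep :: "'g set \<Rightarrow> bool" where
  "sep S \<longleftrightarrow> (\<forall>g\<in>S. \<forall>h\<in>S. h \<in> conflict g \<longrightarrow> h = g)"

text \<open>Pastes w at every site of S. On a separated S the choice made by \<open>SOME\<close> has
  only one candidate.\<close>

definition rep :: "'g set \<Rightarrow> ('g \<Rightarrow> 'a) \<Rightarrow> 'g \<Rightarrow> 'a" where
  "rep S x j = (if \<exists>f\<in>F. j - f \<in> S then w (SOME f. f \<in> F \<and> j - f \<in> S) else x j)"

text \<open>A conflicting mark blocks g whether or not v occurs at the other site. So the condition
  on the marks does not involve x, and under the product measure it is independent of the occurrence
  of v.\<close>

definition act :: "('g \<Rightarrow> 'a) \<Rightarrow> ('g \<Rightarrow> bool) \<Rightarrow> 'g set" where
  "act x \<omega> = {g. \<omega> g \<and> occurs v x g \<and> (\<forall>h\<in>conflict g - {g}. \<not> \<omega> h)}"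

lemma add_eq_self_iff: "(g :: 'g) + x = g \<longleftrightarrow> x = 0"
  by (metis add.right_neutral add_left_cancel)

lemma finite_conflict: "finite (conflict g)"
proof -
  have "conflict g = (\<lambda>(f, f'). g + f - f') ` (F \<times> F)" by (auto simp: conflict_def)
  then show ?thesis using F by simp
qed

lemma conflict_translate: "conflict (k + g) = (+) k ` conflict g"
proof (intro equalityI subsetI)
  fix h assume "h \<in> conflict (k + g)"
  then obtain f f' where f: "f \<in> F" "f' \<in> F" "h = k + g + f - f'" by (auto simp: conflict_def)
  then have "h = k + (g + f - f')" by (simp add: add.assoc add_diff_eq)
  then show "h \<in> (+) k ` conflict g" using f(1,2) unfolding conflict_def by blast
next
  fix h assume "h \<in> (+) k ` conflict g"
  then obtain f f' where "f \<in> F" "f' \<in> F" "h = k + (g + f - f')" by (auto simp: conflict_def)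
  moreover from this have "h = k + g + f - f'" by (simp add: add.assoc add_diff_eq)
  ultimately show "h \<in> conflict (k + g)" unfolding conflict_def by blast
qed

lemma card_conflict_remove: "card (conflict g - {g}) = card (conflict 0 - {0})"
proof -
  have "conflict g - {g} = (+) g ` (conflict 0 - {0})"
    using conflict_translate[of g 0] by (auto simp: image_iff add_eq_self_iff)
  then show ?thesis by (simp add: card_image)
qed

lemma card_conflict: "card (conflict g) = card (conflict 0)"
  using conflict_translate[of g 0] by (simp add: card_image)

lemma conflictI: "f \<in> F \<Longrightarrow> f' \<in> F \<Longrightarrow> g + f = h + f' \<Longrightarrow> h \<in> conflict g"
  unfolding conflict_def by (rule CollectI, intro bexI[of _ f] bexI[of _ f']) simp_all

lemma sep_act: "sep (act x \<omega>)"
  unfolding sep_def act_def by blast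

lemma sep_subset: "sep S \<Longrightarrow> S' \<subseteq> S \<Longrightarrow> sep S'"
  unfolding sep_def by blast

lemma sep_unique:
  assumes "sep S" "g \<in> S" "h \<in> S" "f \<in> F" "f' \<in> F" "g + f = h + f'"
  shows "h = g" "f' = f"
proof -
  have "h \<in> conflict g" using assms(4-6) by (rule conflictI)
  then show "h = g" using assms unfolding sep_def by blast
  then show "f' = f" using assms(6) by simp
qed

lemma rep_site:
  assumes "sep S" "g \<in> S" "f \<in> F"
  shows "rep S x (g + f) = w f"
proof -
  have ex: "f \<in> F \<and> (g + f) - f \<in> S" using assms by simp
  have "(SOME f'. f' \<in> F \<and> (g + f) - f' \<in> S) = f"
  proof (rule some_equality[where P = "\<lambda>f'. f' \<in> F \<and> g + f - f' \<in> S", OF ex])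
    fix f' assume f': "f' \<in> F \<and> g + f - f' \<in> S"
    have "g + f = (g + f - f') + f'" by simp
    then show "f' = f" using sep_unique(2)[OF assms(1,2) _ assms(3)] f' by blast
  qed
  then show ?thesis using ex unfolding rep_def by auto
qed

lemma rep_off: "(\<And>f. f \<in> F \<Longrightarrow> j - f \<notin> S) \<Longrightarrow> rep S x j = x j"
  unfolding rep_def by auto

lemma rep_cong:
  assumes "\<And>f. f \<in> F \<Longrightarrow> j - f \<in> S \<longleftrightarrow> j - f \<in> S'" "(\<And>f. f \<in> F \<Longrightarrow> j - f \<notin> S) \<Longrightarrow> x j = x' j"
  shows "rep S x j = rep S' x' j"
proof -
  have "(\<lambda>f. f \<in> F \<and> j - f \<in> S) = (\<lambda>f. f \<in> F \<and> j - f \<in> S')" using assms(1) by auto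
  moreover have "(\<exists>f\<in>F. j - f \<in> S) \<longleftrightarrow> (\<exists>f\<in>F. j - f \<in> S')" using assms(1) by blast
  ultimately show ?thesis unfolding rep_def using assms(2) by auto
qed

lemma rep_empty [simp]: "rep {} x = x"
  by (rule ext) (simp add: rep_def)

lemma shift_map_rep: "shift_map k (rep S x) = rep {h. k + h \<in> S} (shift_map k x)"
  unfolding rep_def shift_map_def by (auto simp: fun_eq_iff add_diff_eq)

lemma rep_0: "rep {0} x = override_on x w F"
proof
  fix j
  have "sep {0}" by (simp add: sep_def)
  show "rep {0} x j = override_on x w F j"
  proof (cases "j \<in> F")
    case True
    then show ?thesis using rep_site[OF \<open>sep {0}\<close>, of 0 j x] by simp
  next
    case False
    then have "rep {0} x j = x j" by (intro rep_off) auto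
    with False show ?thesis by simp
  qed
qed

lemma rep_single: "rep {g} x = shift_map (- g) (override_on (shift_map g x) w F)"
proof -
  have "{h. g + h \<in> {g}} = {0}" by (auto simp: add_eq_self_iff)
  then have "shift_map g (rep {g} x) = override_on (shift_map g x) w F"
    by (simp add: shift_map_rep rep_0)
  then have "shift_map (- g) (shift_map g (rep {g} x)) = shift_map (- g) (override_on (shift_map g x) w F)" by simp
  then show ?thesis by (simp add: shift_map_shift_map)
qed

lemma rep_single_in: "x \<in> X \<Longrightarrow> occurs v x g \<Longrightarrow> rep {g} x \<in> X"
  unfolding rep_single
  by (intro subshift_shift_map[OF X] swap) (auto simp: occurs_def shift_map_def)

lemma rep_insert:
  assumes "sep (insert g S)" "g \<notin> S"
  shows "rep (insert g S) x = rep {g} (rep S x)"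
proof
  fix j
  show "rep (insert g S) x j = rep {g} (rep S x) j"
  proof (cases "\<exists>f\<in>F. j - f = g")
    case True
    then obtain f where f: "f \<in> F" "j = g + f" by (metis diff_add_cancel)
    have "sep {g}" by (simp add: sep_def)
    then show ?thesis using rep_site[OF assms(1), of g f] rep_site[of "{g}" g f] f by simp
  next
    case False
    then have "rep {g} (rep S x) j = rep S x j" by (intro rep_off) auto
    also have "\<dots> = rep (insert g S) x j" using False by (intro rep_cong) auto
    finally show ?thesis by simp
  qed
qed

text \<open>Replacements at the other sites of a separated set do not touch the v at g, so that
  replacements can be carried out one at a time inside X.\<close>

lemma occurs_rep:
  assumes "sep (insert g S)" "g \<notin> S" "occurs v x g"
  shows "occurs v (rep S x) g"
  unfolding occurs_def
proof
  fix f assume f: "f \<in> F"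
  have "rep S x (g + f) = x (g + f)"
  proof (rule rep_off)
    fix f' assume f': "f' \<in> F"
    show "g + f - f' \<notin> S"
    proof
      assume h: "g + f - f' \<in> S"
      have "g + f = (g + f - f') + f'" by simp
      then have "g + f - f' = g" using sep_unique(1)[OF assms(1), of g "g + f - f'" f f'] h f f' by blast
      then show False using h assms(2) by simp
    qed
  qed
  then show "rep S x (g + f) = v f" using assms(3) f by (simp add: occurs_def)
qed

lemma rep_finite_in:
  assumes "finite S" "sep S" "\<And>g. g \<in> S \<Longrightarrow> occurs v x g" "x \<in> X"
  shows "rep S x \<in> X"
  using assms(1-3)
proof (induction S rule: finite_induct)
  case empty
  then show ?case using assms(4) by simp
next
  case (insert g S)
  have "rep S x \<in> X"
  proof (rule insert.IH)
    show "sep S" using insert.prems(1) by (rule sep_subset) blast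
    show "occurs v x h" if "h \<in> S" for h using insert.prems(2) that by blast
  qed
  moreover have "occurs v (rep S x) g"
    using insert.prems insert.hyps(2) by (intro occurs_rep) blast+
  ultimately show ?case
    unfolding rep_insert[OF insert.prems(1) insert.hyps(2)] by (rule rep_single_in)
qed

definition sites :: "'g set \<Rightarrow> 'g set" where
  "sites K = {h. \<exists>f\<in>F. h + f \<in> K}"

lemma finite_sites: "finite K \<Longrightarrow> finite (sites K)"
proof -
  assume K: "finite K"
  have "sites K \<subseteq> (\<lambda>(k, f). k - f) ` (K \<times> F)"
  proof
    fix h assume "h \<in> sites K"
    then obtain f where "f \<in> F" "h + f \<in> K" by (auto simp: sites_def)
    then show "h \<in> (\<lambda>(k, f). k - f) ` (K \<times> F)" by (intro image_eqI[of _ _ "(h + f, f)"]) auto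
  qed
  then show ?thesis using K F finite_subset by blast
qed

lemma rep_sites:
  assumes "j \<in> K" "sites K \<subseteq> T"
  shows "rep (S \<inter> T) x j = rep S x j"
proof (rule rep_cong)
  fix f assume "f \<in> F"
  then have "j - f \<in> sites K" using assms(1) unfolding sites_def by (auto intro!: bexI[of _ f])
  then show "j - f \<in> S \<inter> T \<longleftrightarrow> j - f \<in> S" using assms(2) by blast
qed simp

text \<open>S may be infinite: X is closed, and in a finite window only the finitely many sites
  whose translate of F meets it have an effect.\<close>

lemma rep_in:
  assumes "sep S" "\<And>g. g \<in> S \<Longrightarrow> occurs v x g" "x \<in> X"
  shows "rep S x \<in> X"
proof (rule closed_cylinder_limit[OF subshift_closed[OF X]])
  fix K :: "'g set" assume K: "finite K"
  have "rep (S \<inter> sites K) x \<in> X"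
    using assms finite_sites[OF K] sep_subset[OF assms(1)] by (intro rep_finite_in) auto
  moreover have "\<forall>j\<in>K. rep (S \<inter> sites K) x j = rep S x j"
    using rep_sites[of _ K "sites K"] by blast
  ultimately show "\<exists>x'\<in>X. \<forall>h\<in>K. x' h = rep S x h" by blast
qed

lemma act_occurs: "g \<in> act x \<omega> \<Longrightarrow> occurs v x g" and act_mark: "g \<in> act x \<omega> \<Longrightarrow> \<omega> g"
  by (auto simp: act_def)

lemma rep_act_in: "x \<in> X \<Longrightarrow> rep (act x \<omega> \<inter> T) x \<in> X"
  by (rule rep_in) (auto intro: sep_subset[OF sep_act] dest: act_occurs)

lemma act_translate: "{h. k + h \<in> act x \<omega>} = act (shift_map k x) (shift_map k \<omega>)"
proof -
  have "(\<forall>i\<in>conflict (k + h) - {k + h}. \<not> \<omega> i) \<longleftrightarrow> (\<forall>i\<in>conflict h - {h}. \<not> \<omega> (k + i))" for h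
    unfolding conflict_translate by auto
  then show ?thesis unfolding act_def occurs_def shift_map_def by (simp add: add.assoc)
qed

text \<open>Activity refers to relative positions only, so the replacement commutes with shifting
  configuration and marks together. Invariance of the new law rests on this.\<close>

lemma rep_act_translate:
  "shift_map k (rep (act x \<omega>) x) = rep (act (shift_map k x) (shift_map k \<omega>)) (shift_map k x)"
  by (simp add: shift_map_rep act_translate)

text \<open>A finite window of configuration and marks that decides activity at g. Replacement is
  therefore a block code, whence its measurability.\<close>

definition dep :: "'g \<Rightarrow> 'g set" where
  "dep g = insert g (conflict g \<union> (+) g ` F)"

lemma finite_dep: "finite (dep g)"
  using F finite_conflict by (simp add: dep_def)

lemma act_cong:
  assumes "\<And>h. h \<in> dep g \<Longrightarrow> x h = x' h" "\<And>h. h \<in> dep g \<Longrightarrow> \<omega> h = \<omega>' h"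
  shows "g \<in> act x \<omega> \<longleftrightarrow> g \<in> act x' \<omega>'"
proof -
  have "occurs v x g \<longleftrightarrow> occurs v x' g"
    unfolding occurs_def using assms(1) by (auto simp: dep_def)
  moreover have "\<omega> g = \<omega>' g" using assms(2) by (simp add: dep_def)
  moreover have "(\<forall>h\<in>conflict g - {g}. \<not> \<omega> h) \<longleftrightarrow> (\<forall>h\<in>conflict g - {g}. \<not> \<omega>' h)"
    using assms(2) by (auto simp: dep_def)
  ultimately show ?thesis unfolding act_def by simp
qed

lemma rep_act_cong:
  assumes "\<And>h. h \<in> insert j (\<Union>f\<in>F. dep (j - f)) \<Longrightarrow> x h = x' h"
    "\<And>h. h \<in> insert j (\<Union>f\<in>F. dep (j - f)) \<Longrightarrow> \<omega> h = \<omega>' h"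
  shows "rep (act x \<omega> \<inter> T) x j = rep (act x' \<omega>' \<inter> T) x' j"
proof (rule rep_cong)
  fix f assume f: "f \<in> F"
  have "j - f \<in> act x \<omega> \<longleftrightarrow> j - f \<in> act x' \<omega>'"
  proof (rule act_cong)
    fix h assume h: "h \<in> dep (j - f)"
    show "x h = x' h" by (rule assms(1)) (use f h in blast)
    show "\<omega> h = \<omega>' h" by (rule assms(2)) (use f h in blast)
  qed
  then show "j - f \<in> act x \<omega> \<inter> T \<longleftrightarrow> j - f \<in> act x' \<omega>' \<inter> T" by blast
qed (rule assms(1), simp)

end

subsection \<open>Entropies of events\<close>

context prob_space
begin

lemma ent_pred:
  assumes E: "simple_function M E"
  shows "ent M E = eta (prob {x \<in> space M. E x}) + eta (1 - prob {x \<in> space M. E x})"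
proof -
  have "ent M E = (\<Sum>b\<in>UNIV. eta (prob (E -` {b} \<inter> space M)))"
    by (rule ent_superset) auto
  moreover have "E -` {True} \<inter> space M = {x \<in> space M. E x}" by auto
  moreover have "E -` {False} \<inter> space M = space M - {x \<in> space M. E x}" by auto
  moreover have "{x \<in> space M. E x} \<in> sets M" using simple_functionD(2)[OF E, of "{True}"] calculation(2) by simp
  ultimately show ?thesis by (simp add: UNIV_bool prob_compl)
qed

text \<open>Since E lies in G, the pair has only the cells E, G - E and the complement of G, and the
  contribution of the last one cancels against \<open>ent M G\<close>.\<close>

lemma cond_ent_pred:
  assumes E: "simple_function M E" and G: "simple_function M G"
    and EG: "\<And>x. x \<in> space M \<Longrightarrow> E x \<Longrightarrow> G x"
  shows "cond_ent M E G = eta (prob {x \<in> space M. E x})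
    + eta (prob {x \<in> space M. G x} - prob {x \<in> space M. E x}) - eta (prob {x \<in> space M. G x})"
proof -
  let ?E = "{x \<in> space M. E x}" and ?G = "{x \<in> space M. G x}"
  have "?E = E -` {True} \<inter> space M" "?G = G -` {True} \<inter> space M" by auto
  then have sets: "?E \<in> sets M" "?G \<in> sets M" using simple_functionD(2) E G by metis+
  have "ent M (\<lambda>x. (E x, G x)) = (\<Sum>b\<in>UNIV \<times> UNIV. eta (prob ((\<lambda>x. (E x, G x)) -` {b} \<inter> space M)))"
    by (rule ent_superset) auto
  also have "\<dots> = (\<Sum>a\<in>UNIV. \<Sum>b\<in>UNIV. eta (prob ((\<lambda>x. (E x, G x)) -` {(a, b)} \<inter> space M)))"
    by (simp add: sum.cartesian_product)
  also have "\<dots> = eta (prob ((\<lambda>x. (E x, G x)) -` {(True, True)} \<inter> space M))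
      + eta (prob ((\<lambda>x. (E x, G x)) -` {(True, False)} \<inter> space M))
      + eta (prob ((\<lambda>x. (E x, G x)) -` {(False, True)} \<inter> space M))
      + eta (prob ((\<lambda>x. (E x, G x)) -` {(False, False)} \<inter> space M))"
    by (simp add: UNIV_bool)
  also have "(\<lambda>x. (E x, G x)) -` {(True, True)} \<inter> space M = ?E" using EG by auto
  also have "(\<lambda>x. (E x, G x)) -` {(True, False)} \<inter> space M = {}" using EG by auto
  also have "(\<lambda>x. (E x, G x)) -` {(False, True)} \<inter> space M = ?G - ?E" by auto
  also have "(\<lambda>x. (E x, G x)) -` {(False, False)} \<inter> space M = space M - ?G" using EG by auto
  also have "prob (?G - ?E) = prob ?G - prob ?E"
    using EG sets by (intro finite_measure_Diff) auto
  also have "prob (space M - ?G) = 1 - prob ?G" using sets(2) by (rule prob_compl)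
  finally show ?thesis unfolding cond_ent_def ent_pred[OF G] by simp
qed

text \<open>With a and b the probabilities of E and G, \<open>eta (b - a) - eta b\<close> equals (b
  - a) (ln b - ln (b - a)) + a ln b, and the first summand is at most a. The term
  \<open>a * ln \<beta>\<close> is kept exactly, for it is what the frequency of v will be compared
  with.\<close>

lemma cond_ent_pred_le:
  assumes E: "simple_function M E" and G: "simple_function M G"
    and EG: "\<And>x. x \<in> space M \<Longrightarrow> E x \<Longrightarrow> G x"
    and \<beta>: "0 < \<beta>" "prob {x \<in> space M. G x} \<le> \<beta>"
  shows "cond_ent M E G \<le> eta (prob {x \<in> space M. E x}) + prob {x \<in> space M. E x}
     + prob {x \<in> space M. E x} * ln \<beta>"
proof -
  define a where "a = prob {x \<in> space M. E x}"
  define b where "b = prob {x \<in> space M. G x}"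
  have "{x \<in> space M. G x} = G -` {True} \<inter> space M" by auto
  then have "{x \<in> space M. G x} \<in> sets M" using simple_functionD(2) G by metis
  then have ab: "0 \<le> a" "a \<le> b" unfolding a_def b_def
    using EG by (auto intro!: finite_measure_mono)
  have "eta (b - a) - eta b \<le> a + a * ln \<beta>"
  proof (cases "b = a")
    case True
    show ?thesis
    proof (cases "a = 0")
      case False
      then have "ln a \<le> ln \<beta>" using ab \<beta> True unfolding b_def by simp
      then have "a * ln a \<le> a * ln \<beta>" using ab by (intro mult_left_mono) auto
      then show ?thesis using True ab by (simp add: eta_def)
    qed (use True in simp)
  next
    case False
    then have lt: "0 < b - a" "0 < b" using ab by auto
    have "ln (b / (b - a)) \<le> b / (b - a) - 1" using lt by (intro ln_le_minus_one) auto
    then have "(b - a) * ln (b / (b - a)) \<le> (b - a) * (b / (b - a) - 1)"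
      using lt by (intro mult_left_mono) auto
    also have "\<dots> = a" using lt by (simp add: field_simps)
    finally have 1: "(b - a) * (ln b - ln (b - a)) \<le> a" using lt by (simp add: ln_div)
    have "a * ln b \<le> a * ln \<beta>" using ab lt \<beta> unfolding b_def by (intro mult_left_mono) auto
    with 1 show ?thesis by (simp add: eta_def algebra_simps)
  qed
  moreover have "cond_ent M E G = eta a + eta (b - a) - eta b"
    unfolding a_def b_def using E G EG by (rule cond_ent_pred)
  ultimately show ?thesis unfolding a_def[symmetric] by linarith
qed

lemma ent_Pair_indep:
  assumes f: "simple_function M f" and g: "simple_function M g"
    and indep: "\<And>a b. prob (f -` {a} \<inter> (g -` {b} \<inter> space M)) = prob (f -` {a} \<inter> space M) * prob (g -` {b} \<inter> space M)"
  shows "ent M (\<lambda>x. (f x, g x)) = ent M f + ent M g"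
proof -
  let ?A = "f ` space M" and ?B = "g ` space M"
  let ?p = "\<lambda>a. prob (f -` {a} \<inter> space M)" and ?q = "\<lambda>b. prob (g -` {b} \<inter> space M)"
  have 1: "(\<Sum>a\<in>?A. ?p a) = 1" "(\<Sum>b\<in>?B. ?q b) = 1"
    using measure_eq_sum_fibres[OF f sets.top] measure_eq_sum_fibres[OF g sets.top] by (simp_all add: prob_space)
  have "ent M (\<lambda>x. (f x, g x)) = (\<Sum>a\<in>?A. \<Sum>b\<in>?B. ?p a * eta (?q b) + ?q b * eta (?p a))"
    unfolding ent_Pair_eq[OF f g] indep by (simp add: eta_mult_nonneg)
  also have "\<dots> = (\<Sum>a\<in>?A. ?p a * (\<Sum>b\<in>?B. eta (?q b)) + (\<Sum>b\<in>?B. ?q b) * eta (?p a))"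
    by (simp add: sum.distrib sum_distrib_left sum_distrib_right)
  also have "\<dots> = (\<Sum>a\<in>?A. ?p a) * (\<Sum>b\<in>?B. eta (?q b)) + (\<Sum>a\<in>?A. eta (?p a))"
    using 1(2) by (simp add: sum.distrib sum_distrib_right)
  also have "\<dots> = ent M f + ent M g" using 1(1) by (simp add: ent_def)
  finally show ?thesis .
qed

end

subsection \<open>Random marks\<close>

locale random_swap = invariant_measure X \<mu> + swap_pattern X F v w
  for X :: "('g::{group_add, countable} \<Rightarrow> 'a::{finite, discrete_topology}) set"
    and \<mu> :: "('g \<Rightarrow> 'a) measure" and F :: "'g set" and v w :: "'g \<Rightarrow> 'a" +
  fixes p :: real
  assumes p: "0 < p" "p < 1"
begin

definition bern :: "('g \<Rightarrow> bool) measure" where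
  "bern = PiM UNIV (\<lambda>_. measure_pmf (bernoulli_pmf p))"

definition joint :: "(('g \<Rightarrow> 'a) \<times> ('g \<Rightarrow> bool)) measure" where
  "joint = \<mu> \<Otimes>\<^sub>M bern"

lemma space_bern [simp]: "space bern = UNIV"
  by (simp add: bern_def space_PiM)

lemma space_joint: "space joint = X \<times> UNIV"
  by (simp add: joint_def space_pair_measure space_eq)

sublocale bern: prob_space bern
  unfolding bern_def by (intro prob_space_PiM measure_pmf.prob_space_axioms)

sublocale joint: prob_space joint
proof -
  interpret pair_prob_space \<mu> bern ..
  show "prob_space joint" unfolding joint_def by (rule P.prob_space_axioms)
qed

lemma bern_coord_measurable: "(\<lambda>\<omega>. \<omega> i) \<in> measurable bern (count_space UNIV)"
proof -
  have "(\<lambda>\<omega>. \<omega> i) \<in> measurable bern (measure_pmf (bernoulli_pmf p))"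
    unfolding bern_def by (rule measurable_component_singleton) simp
  then show ?thesis by (simp add: measurable_cong_sets[OF refl sets_measure_pmf_count_space])
qed

lemma bern_sets: "finite I \<Longrightarrow> {\<omega>. \<forall>i\<in>I. \<omega> i = b i} \<in> sets bern"
proof -
  assume I: "finite I"
  have "{\<omega> \<in> space bern. \<omega> i = b i} \<in> sets bern" for i
    using measurable_sets[OF bern_coord_measurable[of i], of "{b i}"] by (simp add: vimage_def)
  then have "{\<omega> \<in> space bern. \<forall>i\<in>I. \<omega> i = b i} \<in> sets bern"
    using I by (intro sets.sets_Collect_finite_All) auto
  then show ?thesis by simp
qed

lemma bern_cylinder:
  assumes "finite I"
  shows "measure bern {\<omega>. \<forall>i\<in>I. \<omega> i = b i} = (\<Prod>i\<in>I. if b i then p else 1 - p)"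
proof -
  interpret B: product_prob_space "\<lambda>_::'g. measure_pmf (bernoulli_pmf p)" UNIV
    by (intro product_prob_spaceI measure_pmf.prob_space_axioms)
  have "{\<omega>. \<forall>i\<in>I. \<omega> i = b i} = {\<omega> \<in> space (PiM UNIV (\<lambda>_. measure_pmf (bernoulli_pmf p))). \<forall>i\<in>I. \<omega> i \<in> {b i}}"
    by (simp add: space_PiM)
  then have "emeasure bern {\<omega>. \<forall>i\<in>I. \<omega> i = b i} = (\<Prod>i\<in>I. emeasure (measure_pmf (bernoulli_pmf p)) {b i})"
    unfolding bern_def using assms by (simp only:) (rule B.emeasure_PiM_Collect, auto)
  also have "\<dots> = (\<Prod>i\<in>I. ennreal (if b i then p else 1 - p))"
  proof (rule prod.cong[OF refl])
    fix i
    show "emeasure (measure_pmf (bernoulli_pmf p)) {b i} = ennreal (if b i then p else 1 - p)"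
      using p by (cases "b i") (simp_all add: emeasure_pmf_single)
  qed
  also have "\<dots> = ennreal (\<Prod>i\<in>I. if b i then p else 1 - p)"
    using p by (intro prod_ennreal) auto
  finally show ?thesis
    using p by (intro measure_eq_emeasure_eq_ennreal prod_nonneg) auto
qed

lemma joint_rect:
  assumes "A \<in> sets \<mu>" "B \<in> sets bern"
  shows "joint.prob (A \<times> B) = prob A * bern.prob B" "A \<times> B \<in> sets joint"
proof -
  show "A \<times> B \<in> sets joint" unfolding joint_def using assms by (rule pair_measureI)
  have "emeasure joint (A \<times> B) = ennreal (prob A * bern.prob B)"
    unfolding joint_def using assms
    by (simp add: bern.emeasure_pair_measure_Times emeasure_eq_measure bern.emeasure_eq_measure ennreal_mult)
  then show "joint.prob (A \<times> B) = prob A * bern.prob B"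
    by (intro measure_eq_emeasure_eq_ennreal) auto
qed

lemma fst_measurable: "fst \<in> measurable joint \<mu>" and snd_measurable: "snd \<in> measurable joint bern"
  by (simp_all add: joint_def)

lemma fst_borel: "fst \<in> borel_measurable joint"
  using measurable_compose[OF fst_measurable id_measurable] by simp

lemma distr_fst: "distr joint \<mu> fst = \<mu>"
  unfolding joint_def by (rule bern.distr_pair_fst)

lemma simple_mark: "simple_function joint (\<lambda>u. snd u i)"
  unfolding simple_function_eq_measurable
  using measurable_compose[OF snd_measurable bern_coord_measurable] by simp

lemma simple_dep:
  assumes "finite K"
    and "\<And>u u'. u \<in> space joint \<Longrightarrow> u' \<in> space joint \<Longrightarrow> (\<And>h. h \<in> K \<Longrightarrow> fst u h = fst u' h) \<Longrightarrow> (\<And>h. h \<in> K \<Longrightarrow> snd u h = snd u' h) \<Longrightarrow> f u = f u'"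
  shows "simple_function joint f"
proof (rule simple_function_determined)
  show "simple_function joint (\<lambda>u. (restrict (fst u) K, tuple (\<lambda>i u. snd u i) K u))"
    using assms(1) by (intro simple_function_Pair simple_function_window[OF fst_borel] simple_function_tuple simple_mark)
  fix u u' assume u: "u \<in> space joint" "u' \<in> space joint"
    and "(restrict (fst u) K, tuple (\<lambda>i u. snd u i) K u) = (restrict (fst u') K, tuple (\<lambda>i u. snd u i) K u')"
  then have eq: "\<forall>h\<in>K. fst u h = fst u' h" "\<forall>h\<in>K. snd u h = snd u' h"
    unfolding prod.inject restrict_eq_iff tuple_eq_iff by blast+
  show "f u = f u'" by (rule assms(2)[OF u]) (use eq in blast)+
qed

abbreviation active :: "'g \<Rightarrow> ('g \<Rightarrow> 'a) \<times> ('g \<Rightarrow> bool) \<Rightarrow> bool" where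
  "active g u \<equiv> g \<in> act (fst u) (snd u)"

text \<open>T limits the replacement: the interior of a window when entropy is counted, a finite set
  when energy is, and everything for the new measure.\<close>

definition repl :: "'g set \<Rightarrow> ('g \<Rightarrow> 'a) \<times> ('g \<Rightarrow> bool) \<Rightarrow> 'g \<Rightarrow> 'a" where
  "repl T u = rep (act (fst u) (snd u) \<inter> T) (fst u)"

lemma simple_active: "simple_function joint (active g)"
  by (rule simple_dep[OF finite_dep[of g]]) (rule act_cong)

lemma simple_occurs: "simple_function joint (\<lambda>u. occurs t (fst u) g)"
  by (rule simple_dep[of "(+) g ` F"]) (auto simp: F occurs_def)

lemma simple_repl_coord: "simple_function joint (\<lambda>u. repl T u j)"
proof (rule simple_dep)
  show "finite (insert j (\<Union>f\<in>F. dep (j - f)))" using F finite_dep by auto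
qed (unfold repl_def, rule rep_act_cong)

lemma repl_borel: "repl T \<in> borel_measurable joint"
proof (rule measurable_shiftI)
  fix h a
  have "{u \<in> space joint. repl T u h = a} = (\<lambda>u. repl T u h) -` {a} \<inter> space joint" by auto
  then show "{u \<in> space joint. repl T u h = a} \<in> sets joint"
    using simple_functionD(2)[OF simple_repl_coord] by metis
qed

lemma repl_in: "u \<in> space joint \<Longrightarrow> repl T u \<in> X"
  unfolding repl_def space_joint by (intro rep_act_in) auto

lemma repl_measurable: "repl T \<in> measurable joint \<mu>"
  by (rule measurable_intoI[OF repl_borel repl_in])

lemma simple_repl: "finite D \<Longrightarrow> simple_function joint (\<lambda>u. restrict (repl T u) D)"
  by (rule simple_function_window[OF repl_borel])

definition freq :: "('g \<Rightarrow> 'a) \<Rightarrow> real" where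
  "freq t = prob {x \<in> X. occurs t x 0}"

lemma sets_occurs: "{x \<in> X. occurs t x g} \<in> sets \<mu>"
proof -
  have "{x \<in> X. occurs t x g} = {x \<in> X. \<forall>k\<in>(+) g ` F. x k = t (- g + k)}"
    by (simp add: occurs_def add.assoc[symmetric])
  then show ?thesis
    using sets_cylinder[OF finite_imageI[OF F], of "(+) g" "\<lambda>k. t (- g + k)"] by (simp only:)
qed

lemma prob_occurs: "prob {x \<in> X. occurs t x g} = freq t"
proof -
  have "freq t = measure (distr \<mu> \<mu> (shift_map g)) {x \<in> X. occurs t x 0}"
    by (simp add: freq_def T_distr)
  also have "\<dots> = prob (shift_map g -` {x \<in> X. occurs t x 0} \<inter> space \<mu>)"
    by (rule measure_distr[OF shift_map_measurable sets_occurs])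
  also have "shift_map g -` {x \<in> X. occurs t x 0} \<inter> space \<mu> = {x \<in> X. occurs t x g}"
    using subshift_shift_map[OF X] by (auto simp: space_eq occurs_def shift_map_def)
  finally show ?thesis by simp
qed

text \<open>The density of sites that are marked while no conflicting site is.\<close>

definition q :: real where
  "q = p * (1 - p) ^ card (conflict 0 - {0})"

lemma q_le: "0 \<le> q" "q \<le> p"
proof -
  have "0 \<le> (1 - p) ^ card (conflict 0 - {0})" "(1 - p) ^ card (conflict 0 - {0}) \<le> 1"
    using p by (simp_all add: power_le_one)
  then show "0 \<le> q" "q \<le> p" using p unfolding q_def by (simp_all add: mult_left_le)
qed

lemma bern_isolated: "bern.prob {\<omega>. \<omega> g \<and> (\<forall>h\<in>conflict g - {g}. \<not> \<omega> h)} = q"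
  and sets_isolated: "{\<omega>. \<omega> g \<and> (\<forall>h\<in>conflict g - {g}. \<not> \<omega> h)} \<in> sets bern"
proof -
  let ?I = "insert g (conflict g - {g})"
  have eq: "{\<omega>. \<omega> g \<and> (\<forall>h\<in>conflict g - {g}. \<not> \<omega> h)} = {\<omega>. \<forall>i\<in>?I. \<omega> i = (i = g)}" by auto
  have fin: "finite ?I" using finite_conflict by simp
  show "{\<omega>. \<omega> g \<and> (\<forall>h\<in>conflict g - {g}. \<not> \<omega> h)} \<in> sets bern"
    unfolding eq by (rule bern_sets[OF fin])
  have "(\<Prod>i\<in>?I. if i = g then p else 1 - p) = p * (\<Prod>i\<in>conflict g - {g}. if i = g then p else 1 - p)"
    using fin by (subst prod.insert) auto
  also have "(\<Prod>i\<in>conflict g - {g}. if i = g then p else 1 - p) = (\<Prod>i\<in>conflict g - {g}. 1 - p)"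
    by (rule prod.cong) auto
  finally show "bern.prob {\<omega>. \<omega> g \<and> (\<forall>h\<in>conflict g - {g}. \<not> \<omega> h)} = q"
    unfolding eq bern_cylinder[OF fin] q_def card_conflict_remove[of g, symmetric] by (simp only: prod_constant)
qed

lemma active_rect:
  "{u \<in> space joint. active g u} = {x \<in> X. occurs v x g} \<times> {\<omega>. \<omega> g \<and> (\<forall>h\<in>conflict g - {g}. \<not> \<omega> h)}"
proof (rule set_eqI)
  fix u
  show "u \<in> {u \<in> space joint. active g u} \<longleftrightarrow>
    u \<in> {x \<in> X. occurs v x g} \<times> {\<omega>. \<omega> g \<and> (\<forall>h\<in>conflict g - {g}. \<not> \<omega> h)}"
    unfolding act_def space_joint mem_Collect_eq mem_Times_iff by blast
qed

lemma prob_active: "joint.prob {u \<in> space joint. active g u} = freq v * q"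
  unfolding active_rect joint_rect(1)[OF sets_occurs sets_isolated] prob_occurs bern_isolated ..

lemma bern_mark: "bern.prob {\<omega>. \<omega> g} = p" "{\<omega>. \<omega> g} \<in> sets bern"
  using bern_cylinder[of "{g}" "\<lambda>_. True"] bern_sets[of "{g}" "\<lambda>_. True"] by simp_all

lemma prob_mark: "joint.prob {u \<in> space joint. snd u g} = p"
proof -
  have "{u \<in> space joint. snd u g} = X \<times> {\<omega>. \<omega> g}" by (auto simp: space_joint)
  then show ?thesis
    using joint_rect(1)[OF sets.top bern_mark(2)[of g]] prob_space by (simp add: bern_mark space_eq)
qed

lemma prob_two_marks:
  assumes "g \<noteq> h"
  shows "joint.prob {u \<in> space joint. snd u g \<and> snd u h} = p * p"
proof -
  have "{u \<in> space joint. snd u g \<and> snd u h} = X \<times> {\<omega>. \<forall>i\<in>{g, h}. \<omega> i = True}" by (auto simp: space_joint)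
  then show ?thesis
    using joint_rect(1)[OF sets.top bern_sets[of "{g, h}" "\<lambda>_. True"]] prob_space assms
      bern_cylinder[of "{g, h}" "\<lambda>_. True"]
    by (simp add: space_eq)
qed

lemma prob_occurs_mark: "joint.prob {u \<in> space joint. occurs v (fst u) g \<and> snd u g} = freq v * p"
proof -
  have "{u \<in> space joint. occurs v (fst u) g \<and> snd u g} = {x \<in> X. occurs v x g} \<times> {\<omega>. \<omega> g}"
    by (auto simp: space_joint)
  then show ?thesis using joint_rect(1)[OF sets_occurs bern_mark(2)] by (simp add: bern_mark prob_occurs)
qed

lemma prob_joint_occurs: "joint.prob {u \<in> space joint. occurs t (fst u) g} = freq t"
proof -
  have "{u \<in> space joint. occurs t (fst u) g} = {x \<in> X. occurs t x g} \<times> UNIV" by (auto simp: space_joint)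
  then show ?thesis using joint_rect(1)[OF sets_occurs sets.top] bern.prob_space by (simp add: prob_occurs)
qed

lemma simple_pred_sets: "simple_function joint E \<Longrightarrow> {u \<in> space joint. E u} \<in> sets joint"
proof -
  assume "simple_function joint E"
  from simple_functionD(2)[OF this, of "{True}"]
  show ?thesis by (simp add: vimage_def Int_def conj_commute)
qed

lemma simple_occurs_repl: "simple_function joint (\<lambda>u. occurs t (repl T u) g)"
proof (rule simple_function_determined)
  show "simple_function joint (\<lambda>u. restrict (repl T u) ((+) g ` F))" using F by (intro simple_repl) simp
qed (auto simp: restrict_eq_iff occurs_def)

text \<open>A w seen at g after the replacement was there before unless a site in
  \<open>conflict g\<close> is marked. The crude union bound suffices, its error being of order
  p.\<close>

lemma prob_occurs_repl:
  "joint.prob {u \<in> space joint. occurs w (repl T u) g} \<le> freq w + real (card (conflict 0)) * p"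
proof -
  let ?O = "{u \<in> space joint. occurs w (fst u) g}" and ?Mk = "\<lambda>h. {u \<in> space joint. snd u h}"
  have O: "?O \<in> sets joint" by (rule simple_pred_sets[OF simple_occurs])
  have Mk: "?Mk h \<in> sets joint" for h by (rule simple_pred_sets[OF simple_mark])
  have UM: "(\<Union>h\<in>conflict g. ?Mk h) \<in> sets joint"
    using Mk finite_conflict by (intro sets.finite_UN) auto
  have sub: "{u \<in> space joint. occurs w (repl T u) g} \<subseteq> ?O \<union> (\<Union>h\<in>conflict g. ?Mk h)"
  proof
    fix u assume u: "u \<in> {u \<in> space joint. occurs w (repl T u) g}"
    show "u \<in> ?O \<union> (\<Union>h\<in>conflict g. ?Mk h)"
    proof (cases "\<exists>h\<in>conflict g. snd u h")
      case False
      have "repl T u (g + f) = fst u (g + f)" if f: "f \<in> F" for f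
        unfolding repl_def
      proof (rule rep_off)
        fix f' assume "f' \<in> F"
        then have "g + f - f' \<in> conflict g" using f unfolding conflict_def by blast
        then show "g + f - f' \<notin> act (fst u) (snd u) \<inter> T" using False act_mark by blast
      qed
      then show ?thesis using u by (simp add: occurs_def)
    qed (use u in blast)
  qed
  have "joint.prob {u \<in> space joint. occurs w (repl T u) g} \<le> joint.prob (?O \<union> (\<Union>h\<in>conflict g. ?Mk h))"
    using sub O UM by (intro joint.finite_measure_mono) auto
  also have "\<dots> \<le> joint.prob ?O + joint.prob (\<Union>h\<in>conflict g. ?Mk h)"
    by (rule measure_Un_le[OF O UM])
  also have "joint.prob (\<Union>h\<in>conflict g. ?Mk h) \<le> (\<Sum>h\<in>conflict g. joint.prob (?Mk h))"
    by (rule measure_UNION_le[OF finite_conflict Mk])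
  finally show ?thesis by (simp add: prob_mark prob_joint_occurs card_conflict[of g])
qed


section \<open>Entropy balance of the replacement\<close>

abbreviation mark :: "'g \<Rightarrow> ('g \<Rightarrow> 'a) \<times> ('g \<Rightarrow> bool) \<Rightarrow> bool" where
  "mark g u \<equiv> snd u g"

lemma ent_mark: "ent joint (mark g) = eta p + eta (1 - p)"
  using joint.ent_pred[OF simple_mark[of g]] prob_mark[of g] by simp

lemma joint_cylinder:
  "A \<in> sets \<mu> \<Longrightarrow> finite I \<Longrightarrow>
    joint.prob (A \<times> {\<omega>. \<forall>i\<in>I. \<omega> i = b i}) = prob A * (\<Prod>i\<in>I. if b i then p else 1 - p)"
  by (simp only: joint_rect(1) bern_sets bern_cylinder)

text \<open>Each further mark is independent of the window together with the earlier marks, so the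
  entropies add up exactly. The other entropy estimates of this part are inequalities without
  independence of sites.\<close>

lemma ent_window_marks:
  assumes D: "finite D" and "finite I"
  shows "ent joint (\<lambda>u. (restrict (fst u) D, tuple mark I u))
    = ent \<mu> (\<lambda>x. restrict x D) + card I * (eta p + eta (1 - p))"
  using assms(2)
proof (induction I rule: finite_induct)
  case empty
  have "ent joint (\<lambda>u. (restrict (fst u) D, tuple mark {} u)) = ent joint (\<lambda>u. restrict (fst u) D)"
    by (rule ent_cong_fibres) (simp add: tuple_eq_iff)
  also have "\<dots> = ent \<mu> (\<lambda>x. restrict x D)"
    by (rule ent_distr[OF fst_measurable simple_window[OF D] distr_fst, symmetric])
  finally show ?case by (simp only: card.empty of_nat_0 mult_zero_left add_0_right)
next
  case (insert j I)
  have sf: "simple_function joint (\<lambda>u. (restrict (fst u) D, tuple mark I u))"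
    using D insert.hyps(1)
    by (intro simple_function_Pair simple_function_window[OF fst_borel] simple_function_tuple simple_mark)
  let ?f = "\<lambda>u. (restrict (fst u) D, tuple mark I u)"
  have "ent joint (\<lambda>u. (restrict (fst u) D, tuple mark (insert j I) u)) = ent joint (\<lambda>u. (?f u, mark j u))"
    by (rule ent_cong_fibres) (auto simp: tuple_eq_iff)
  also have "\<dots> = ent joint ?f + ent joint (mark j)"
  proof (rule joint.ent_Pair_indep[OF sf simple_mark])
    fix ab :: "('g \<Rightarrow> 'a) \<times> ('g \<Rightarrow> bool)" and c :: bool
    obtain a b where ab: "ab = (a, b)" by (cases ab)
    show "joint.prob (?f -` {ab} \<inter> (mark j -` {c} \<inter> space joint))
      = joint.prob (?f -` {ab} \<inter> space joint) * joint.prob (mark j -` {c} \<inter> space joint)"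
    \<comment> \<open>A value b that is not \<open>undefined\<close> off I is never taken; for the
      others the fibre is a product of cylinders.\<close>
    proof (cases "b \<in> extensional I")
      case False
      have "tuple mark I u \<noteq> b" for u
        using False by (auto simp: tuple_def)
      then have "?f -` {ab} = {}" using ab by blast
      then show ?thesis by simp
    next
      case True
      have tb: "tuple mark I u = b \<longleftrightarrow> (\<forall>i\<in>I. snd u i = b i)" for u :: "('g \<Rightarrow> 'a) \<times> ('g \<Rightarrow> bool)"
        using True unfolding tuple_def by (auto simp: fun_eq_iff restrict_def extensional_def)
      let ?A = "{x \<in> X. restrict x D \<in> {a}}"
      let ?b = "b(j := c)"
      have A: "?A \<in> sets \<mu>" by (rule sets_window[OF D])
      have bb: "?b i = b i" if "i \<in> I" for i using that insert.hyps(2) by auto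
      have 1: "?f -` {ab} \<inter> (mark j -` {c} \<inter> space joint) = ?A \<times> {\<omega>. \<forall>i\<in>insert j I. \<omega> i = ?b i}"
        unfolding ab space_joint vimage_def using bb by (auto simp: tb)
      have 2: "?f -` {ab} \<inter> space joint = ?A \<times> {\<omega>. \<forall>i\<in>I. \<omega> i = b i}"
        unfolding ab space_joint
        by (rule set_eqI)
          (simp only: vimage_eq Int_iff prod.inject mem_Times_iff mem_Collect_eq tb singleton_iff UNIV_I, blast)
      have 3: "mark j -` {c} \<inter> space joint = X \<times> {\<omega>. \<forall>i\<in>{j}. \<omega> i = c}"
        unfolding space_joint by (rule set_eqI) (simp add: mem_Times_iff conj_commute)
      have P: "(\<Prod>i\<in>insert j I. if ?b i then p else 1 - p) = (if c then p else 1 - p) * (\<Prod>i\<in>I. if b i then p else 1 - p)"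
        using insert.hyps bb by (subst prod.insert) (auto intro!: prod.cong)
      have X: "X \<in> sets \<mu>" "prob X = 1" using sets.top[of \<mu>] prob_space by (simp_all add: space_eq)
      have fin: "finite (insert j I)" using insert.hyps(1) by simp
      note cyl = joint_cylinder[OF A fin, of ?b] joint_cylinder[OF A insert.hyps(1), of b]
        joint_cylinder[OF X(1) finite.insertI[OF finite.emptyI], of j "\<lambda>_. c"]
      have S: "(\<Prod>i\<in>{j}. if c then p else 1 - p) = (if c then p else 1 - p)" by simp
      show ?thesis
        unfolding 1 unfolding 2 3 cyl P S X(2) by (simp only: mult_1_left mult_ac)
    qed
  qed
  also have "\<dots> = ent \<mu> (\<lambda>x. restrict x D) + card (insert j I) * (eta p + eta (1 - p))"
    using insert.hyps unfolding insert.IH ent_mark by (simp add: algebra_simps)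
  finally show ?case .
qed

text \<open>The entropy of one mark minus the bounds of \<open>cond_ent_mark_le\<close> and
  \<open>cond_ent_active_le\<close>: what each mark is certain to add to the new pattern.\<close>

definition site_gain :: "real \<Rightarrow> real" where
  "site_gain \<beta> = eta (freq v * p) - eta (freq v * q) - eta (freq v * p - freq v * q)
    + eta (freq v - freq v * q) - eta (freq v) - freq v * q - freq v * q * ln \<beta>"

text \<open>Let V be an occurrence of v, W a marked one and A activity, so that A implies W and W
  implies V. Subadditivity gives H(mark | V, A) at most H(mark) + H(A | W) - H(A | V), and the last
  two terms are explicit because the events are nested.\<close>

lemma cond_ent_mark_le:
  "cond_ent joint (mark g) (\<lambda>u. (occurs v (fst u) g, active g u))
    \<le> eta p + eta (1 - p) + eta (freq v * p - freq v * q) - eta (freq v * p)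
      - eta (freq v - freq v * q) + eta (freq v)"
proof -
  let ?V = "\<lambda>u. occurs v (fst u) g" and ?W = "\<lambda>u. occurs v (fst u) g \<and> mark g u"
  note sf = simple_mark[of g] simple_occurs[of v g] simple_active[of g]
  have sVm: "simple_function joint (\<lambda>u. (mark g u, ?V u))" by (rule simple_function_Pair[OF sf(1,2)])
  have sW: "simple_function joint ?W" by (rule simple_function_determined[OF sVm]) auto
  have "ent joint (\<lambda>u. (mark g u, ?V u, active g u)) = ent joint (\<lambda>u. (active g u, mark g u, ?V u))"
    by (rule ent_cong_fibres) auto
  also have "\<dots> = ent joint (\<lambda>u. (mark g u, ?V u)) + cond_ent joint (active g) (\<lambda>u. (mark g u, ?V u))"
    by (simp add: cond_ent_def)
  also have "cond_ent joint (active g) (\<lambda>u. (mark g u, ?V u)) \<le> cond_ent joint (active g) ?W"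
    by (rule joint.cond_ent_antimono[OF sf(3) sVm]) auto
  also have "ent joint (\<lambda>u. (mark g u, ?V u)) \<le> ent joint (mark g) + ent joint ?V"
    using joint.cond_ent_le_ent[OF sf(1,2)] by (simp add: cond_ent_def)
  finally have 1: "ent joint (\<lambda>u. (mark g u, ?V u, active g u))
     \<le> ent joint (mark g) + ent joint ?V + cond_ent joint (active g) ?W" by simp
  have "ent joint (\<lambda>u. (?V u, active g u)) = ent joint (\<lambda>u. (active g u, ?V u))"
    by (rule ent_cong_fibres) auto
  then have 2: "ent joint (\<lambda>u. (?V u, active g u)) = ent joint ?V + cond_ent joint (active g) ?V"
    by (simp add: cond_ent_def)
  have 3: "cond_ent joint (active g) ?W = eta (freq v * q) + eta (freq v * p - freq v * q) - eta (freq v * p)"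
  proof -
    have "cond_ent joint (active g) ?W = eta (joint.prob {u \<in> space joint. active g u})
       + eta (joint.prob {u \<in> space joint. ?W u} - joint.prob {u \<in> space joint. active g u})
       - eta (joint.prob {u \<in> space joint. ?W u})"
      by (rule joint.cond_ent_pred[OF sf(3) sW]) (blast intro: act_occurs act_mark)
    then show ?thesis by (simp only: prob_active prob_occurs_mark)
  qed
  have 4: "cond_ent joint (active g) ?V = eta (freq v * q) + eta (freq v - freq v * q) - eta (freq v)"
  proof -
    have "cond_ent joint (active g) ?V = eta (joint.prob {u \<in> space joint. active g u})
       + eta (joint.prob {u \<in> space joint. ?V u} - joint.prob {u \<in> space joint. active g u})
       - eta (joint.prob {u \<in> space joint. ?V u})"
      by (rule joint.cond_ent_pred[OF sf(3,2)]) (rule act_occurs)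
    then show ?thesis by (simp only: prob_active prob_joint_occurs)
  qed
  show ?thesis
    using 1 2 3 4 ent_mark[of g] unfolding cond_ent_def[of joint "mark g"] by linarith
qed

text \<open>An active site in T carries w after the replacement, so activity is contained in an
  event of probability at most \<open>\<beta>\<close>.\<close>

lemma cond_ent_active_le:
  assumes "g \<in> T" and \<beta>: "0 < \<beta>" "freq w + card (conflict 0) * p \<le> \<beta>"
  shows "cond_ent joint (active g) (\<lambda>u. occurs w (repl T u) g)
    \<le> eta (freq v * q) + freq v * q + freq v * q * ln \<beta>"
  unfolding prob_active[of g, symmetric]
proof (rule joint.cond_ent_pred_le[OF simple_active simple_occurs_repl _ \<beta>(1)])
  show "joint.prob {u \<in> space joint. occurs w (repl T u) g} \<le> \<beta>"
    using prob_occurs_repl \<beta>(2) by (rule order_trans)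
  show "occurs w (repl T u) g" if "active g u" for u
    unfolding occurs_def repl_def
    using rep_site[OF sep_subset[OF sep_act Int_lower1], of g] assms(1) that by blast
qed

text \<open>The marks can be recovered from the pair of the old pattern and the active sites up to a
  small conditional entropy, and the active sites from the new pattern up to the entropy of
  deciding which occurrences of \<open>w\<close> are new.\<close>

lemma ent_repl_ge:
  assumes D: "finite D" and I: "I = {g \<in> D. \<forall>f\<in>F. g + f \<in> D}"
    and \<beta>: "0 < \<beta>" "freq w + card (conflict 0) * p \<le> \<beta>"
  shows "ent \<mu> (\<lambda>x. restrict x D) + card I * site_gain \<beta> \<le> ent joint (\<lambda>u. restrict (repl I u) D)"
proof -
  have fI: "finite I" using D I by simp
  let ?x = "\<lambda>u :: ('g \<Rightarrow> 'a) \<times> ('g \<Rightarrow> bool). restrict (fst u) D"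
  let ?z = "\<lambda>u. restrict (repl I u) D"
  let ?A = "tuple active I" and ?m = "tuple mark I"
  have sx: "simple_function joint ?x" by (rule simple_function_window[OF fst_borel D])
  have sz: "simple_function joint ?z" by (rule simple_repl[OF D])
  have sA: "simple_function joint ?A" by (rule simple_function_tuple[OF fI simple_active])
  have sm: "simple_function joint ?m" by (rule simple_function_tuple[OF fI simple_mark])
  have sxA: "simple_function joint (\<lambda>u. (?A u, ?x u))" by (rule simple_function_Pair[OF sA sx])
  \<comment> \<open>Given the active sites, old and new pattern determine each other: wherever w was
    pasted, the erased symbols were those of v.\<close>
  have zA: "ent joint (\<lambda>u. (?A u, ?z u)) = ent joint (\<lambda>u. (?A u, ?x u))"
  proof (rule ent_cong_fibres)
    fix u u' :: "('g \<Rightarrow> 'a) \<times> ('g \<Rightarrow> bool)"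
    show "(?A u, ?z u) = (?A u', ?z u') \<longleftrightarrow> (?A u, ?x u) = (?A u', ?x u')"
    proof (cases "?A u = ?A u'")
      case True
      then have act: "g \<in> act (fst u) (snd u) \<inter> I \<longleftrightarrow> g \<in> act (fst u') (snd u') \<inter> I" for g
        unfolding tuple_eq_iff by blast
      have "(\<forall>j\<in>D. repl I u j = repl I u' j) \<longleftrightarrow> (\<forall>j\<in>D. fst u j = fst u' j)"
      proof
        assume eq: "\<forall>j\<in>D. repl I u j = repl I u' j"
        show "\<forall>j\<in>D. fst u j = fst u' j"
        proof
          fix j assume j: "j \<in> D"
          show "fst u j = fst u' j"
          proof (cases "\<exists>f\<in>F. j - f \<in> act (fst u) (snd u) \<inter> I")
            case True
            then obtain f where f: "f \<in> F" "j - f \<in> act (fst u) (snd u)" "j - f \<in> act (fst u') (snd u')"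
              using act by blast
            have "fst u (j - f + f) = v f" "fst u' (j - f + f) = v f"
              using act_occurs[OF f(2)] act_occurs[OF f(3)] f(1) unfolding occurs_def by blast+
            then show ?thesis by simp
          next
            case False
            then have "repl I u j = fst u j" unfolding repl_def by (intro rep_off) blast
            moreover have "repl I u' j = fst u' j" using False act unfolding repl_def by (intro rep_off) blast
            ultimately show ?thesis using eq j by simp
          qed
        qed
      next
        assume eq: "\<forall>j\<in>D. fst u j = fst u' j"
        show "\<forall>j\<in>D. repl I u j = repl I u' j"
          unfolding repl_def using act eq by (intro ballI rep_cong) blast+
      qed
      then show ?thesis using True unfolding prod.inject restrict_eq_iff by blast
    qed blast
  qed
  have "ent joint (\<lambda>u. (?x u, ?m u)) \<le> ent joint (\<lambda>u. (?m u, ?A u, ?x u))"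
    by (rule joint.ent_mono[OF simple_function_Pair[OF sm sxA]]) auto
  then have 0: "ent joint (\<lambda>u. (?x u, ?m u)) \<le> ent joint (\<lambda>u. (?A u, ?x u)) + cond_ent joint ?m (\<lambda>u. (?A u, ?x u))"
    unfolding cond_ent_def by linarith
  have "cond_ent joint ?m (\<lambda>u. (?A u, ?x u)) \<le> (\<Sum>g\<in>I. cond_ent joint (mark g) (\<lambda>u. (?A u, ?x u)))"
    by (rule joint.cond_ent_tuple_le[OF fI simple_mark sxA])
  also have "\<dots> \<le> (\<Sum>g\<in>I. cond_ent joint (mark g) (\<lambda>u. (occurs v (fst u) g, active g u)))"
  proof (rule sum_mono)
    fix g assume g: "g \<in> I"
    show "cond_ent joint (mark g) (\<lambda>u. (?A u, ?x u)) \<le> cond_ent joint (mark g) (\<lambda>u. (occurs v (fst u) g, active g u))"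
    proof (rule joint.cond_ent_antimono[OF simple_mark sxA])
      fix u u' :: "('g \<Rightarrow> 'a) \<times> ('g \<Rightarrow> bool)"
      assume "(?A u, ?x u) = (?A u', ?x u')"
      then have e: "\<forall>g\<in>I. active g u = active g u'" "\<forall>h\<in>D. fst u h = fst u' h"
        unfolding prod.inject tuple_eq_iff restrict_eq_iff by blast+
      have "\<forall>f\<in>F. fst u (g + f) = fst u' (g + f)" using e(2) g I by blast
      then have "occurs v (fst u) g = occurs v (fst u') g" unfolding occurs_def by auto
      then show "(occurs v (fst u) g, active g u) = (occurs v (fst u') g, active g u')"
        using e(1) g by blast
    qed
  qed
  finally have 1: "ent joint (\<lambda>u. (?x u, ?m u)) \<le> ent joint (\<lambda>u. (?A u, ?x u))
     + (\<Sum>g\<in>I. cond_ent joint (mark g) (\<lambda>u. (occurs v (fst u) g, active g u)))" using 0 by linarith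
  \<comment> \<open>Activity at g is guessed merely from whether w stands at g in the new pattern;
    ignoring the rest of the window only raises the conditional entropy.\<close>
  have "cond_ent joint ?A ?z \<le> (\<Sum>g\<in>I. cond_ent joint (active g) ?z)"
    by (rule joint.cond_ent_tuple_le[OF fI simple_active sz])
  also have "\<dots> \<le> (\<Sum>g\<in>I. cond_ent joint (active g) (\<lambda>u. occurs w (repl I u) g))"
  proof (rule sum_mono)
    fix g assume g: "g \<in> I"
    show "cond_ent joint (active g) ?z \<le> cond_ent joint (active g) (\<lambda>u. occurs w (repl I u) g)"
    proof (rule joint.cond_ent_antimono[OF simple_active sz])
      fix u u' :: "('g \<Rightarrow> 'a) \<times> ('g \<Rightarrow> bool)"
      assume "?z u = ?z u'"
      then have "\<forall>f\<in>F. repl I u (g + f) = repl I u' (g + f)"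
        using g I unfolding restrict_eq_iff by blast
      then show "occurs w (repl I u) g = occurs w (repl I u') g" unfolding occurs_def by auto
    qed
  qed
  finally have 2: "ent joint (\<lambda>u. (?A u, ?z u))
     \<le> ent joint ?z + (\<Sum>g\<in>I. cond_ent joint (active g) (\<lambda>u. occurs w (repl I u) g))"
    unfolding cond_ent_def[of joint ?A ?z] by linarith
  have "(\<Sum>g\<in>I. cond_ent joint (mark g) (\<lambda>u. (occurs v (fst u) g, active g u)))
     + (\<Sum>g\<in>I. cond_ent joint (active g) (\<lambda>u. occurs w (repl I u) g))
     \<le> (\<Sum>g\<in>I. eta p + eta (1 - p) - site_gain \<beta>)"
    unfolding sum.distrib[symmetric]
  proof (rule sum_mono)
    fix g assume g: "g \<in> I"
    show "cond_ent joint (mark g) (\<lambda>u. (occurs v (fst u) g, active g u))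
        + cond_ent joint (active g) (\<lambda>u. occurs w (repl I u) g) \<le> eta p + eta (1 - p) - site_gain \<beta>"
      using cond_ent_mark_le[of g] cond_ent_active_le[OF g \<beta>] unfolding site_gain_def by linarith
  qed
  also have "\<dots> = card I * (eta p + eta (1 - p)) - card I * site_gain \<beta>"
    by (simp add: algebra_simps)
  finally show ?thesis using 1 2 zA ent_window_marks[OF D fI] by linarith
qed

section \<open>The law of the configuration after replacement\<close>

definition \<nu> :: "('g \<Rightarrow> 'a) measure" where
  "\<nu> = distr joint \<mu> (repl UNIV)"

lemma distr_shift_bern: "distr bern bern (shift_map k) = bern"
proof -
  let ?M = "\<lambda>_::'g. measure_pmf (bernoulli_pmf p)"
  have "distr (PiM UNIV ?M) (\<Pi>\<^sub>M i\<in>UNIV. ?M (k + i)) (\<lambda>\<omega>. \<lambda>n\<in>UNIV. \<omega> (k + n)) = (\<Pi>\<^sub>M i\<in>UNIV. ?M (k + i))"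
    by (rule distr_PiM_reindex) (auto simp: inj_on_def measure_pmf.prob_space_axioms)
  moreover have "(\<lambda>\<omega>. \<lambda>n\<in>UNIV. \<omega> (k + n)) = (shift_map k :: ('g \<Rightarrow> bool) \<Rightarrow> _)"
    by (intro ext) (simp add: shift_map_def)
  ultimately show ?thesis by (simp only: bern_def)
qed

lemma shift_bern_measurable: "shift_map k \<in> measurable bern bern"
  unfolding bern_def
  by (rule measurable_PiM_single') (auto simp: shift_map_def space_PiM intro!: measurable_component_singleton)

lemma shift_joint_measurable: "(\<lambda>(x, \<omega>). (shift_map k x, shift_map k \<omega>)) \<in> measurable joint joint"
  unfolding joint_def
  by (rule measurable_pair) (auto simp: comp_def split_beta intro!: measurable_compose[OF measurable_fst shift_map_measurable] measurable_compose[OF measurable_snd shift_bern_measurable])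

lemma distr_shift_joint: "distr joint joint (\<lambda>(x, \<omega>). (shift_map k x, shift_map k \<omega>)) = joint"
proof -
  have "distr \<mu> \<mu> (shift_map k) \<Otimes>\<^sub>M distr bern bern (shift_map k)
     = distr (\<mu> \<Otimes>\<^sub>M bern) (\<mu> \<Otimes>\<^sub>M bern) (\<lambda>(x, y). (shift_map k x, shift_map k y))"
    using distr_shift_bern bern.sigma_finite_measure_axioms
    by (intro pair_measure_distr shift_map_measurable shift_bern_measurable) simp
  then show ?thesis by (simp add: joint_def T_distr distr_shift_bern)
qed

lemma nu_invariant: "\<nu> \<in> invariant_measures X"
proof -
  have "distr \<nu> \<nu> (shift_map k) = \<nu>" for k
  proof -
    have "distr \<nu> \<nu> (shift_map k) = distr \<nu> \<mu> (shift_map k)"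
      by (rule distr_cong) (auto simp: \<nu>_def)
    also have "\<dots> = distr joint \<mu> (shift_map k \<circ> repl UNIV)"
      unfolding \<nu>_def by (rule distr_distr[OF shift_map_measurable repl_measurable])
    also have "\<dots> = distr joint \<mu> (repl UNIV \<circ> (\<lambda>(x, \<omega>). (shift_map k x, shift_map k \<omega>)))"
      by (rule distr_cong) (auto simp: repl_def rep_act_translate)
    also have "\<dots> = distr (distr joint joint (\<lambda>(x, \<omega>). (shift_map k x, shift_map k \<omega>))) \<mu> (repl UNIV)"
      by (rule distr_distr[OF repl_measurable shift_joint_measurable, symmetric])
    also have "\<dots> = \<nu>" unfolding distr_shift_joint \<nu>_def ..
    finally show ?thesis .
  qed
  moreover have "prob_space \<nu>" unfolding \<nu>_def by (rule joint.prob_space_distr[OF repl_measurable])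
  moreover have "space \<nu> = X" "sets \<nu> = sets (restrict_space borel X)"
    by (simp_all add: \<nu>_def space_eq sets_eq)
  ultimately show ?thesis unfolding invariant_measures_def by blast
qed

sublocale nu: invariant_measure X \<nu>
  by (intro invariant_measure.intro X nu_invariant)

lemma ent_nu: "finite D \<Longrightarrow> ent \<nu> (\<lambda>x. restrict x D) = ent joint (\<lambda>u. restrict (repl UNIV u) D)"
proof (rule ent_distr)
  show "repl UNIV \<in> measurable joint \<nu>"
    by (rule nu.measurable_intoI[OF repl_borel repl_in])
  show "distr joint \<nu> (repl UNIV) = \<nu>" by (subst \<nu>_def, rule distr_cong) (auto simp: \<nu>_def)
qed (rule nu.simple_window)

text \<open>Replacements at sites outside I can alter the window only at the places collected in R,
  near its boundary. Revealing the symbols there costs at most the logarithm of the alphabet size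
  for each place.\<close>

lemma ent_nu_ge:
  assumes D: "finite D" and I: "I = {g \<in> D. \<forall>f\<in>F. g + f \<in> D}"
  shows "ent joint (\<lambda>u. restrict (repl I u) D)
    \<le> ent \<nu> (\<lambda>x. restrict x D) + card {j \<in> D. \<exists>f\<in>F. j - f \<notin> I} * ln (real CARD('a))"
proof -
  define R where "R = {j \<in> D. \<exists>f\<in>F. j - f \<notin> I}"
  have R: "finite R" using D by (simp add: R_def)
  let ?z = "\<lambda>u. restrict (repl I u) D" and ?y = "\<lambda>u. restrict (repl UNIV u) D"
    and ?r = "tuple (\<lambda>j u. repl I u j) R"
  have sr: "simple_function joint ?r" by (rule simple_function_tuple[OF R simple_repl_coord])
  have sy: "simple_function joint ?y" by (rule simple_repl[OF D])
  have "ent joint ?z \<le> ent joint (\<lambda>u. (?r u, ?y u))"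
  proof (rule joint.ent_mono[OF simple_function_Pair[OF sr sy]])
    fix u u' :: "('g \<Rightarrow> 'a) \<times> ('g \<Rightarrow> bool)"
    assume "(?r u, ?y u) = (?r u', ?y u')"
    then have e: "\<forall>j\<in>R. repl I u j = repl I u' j" "\<forall>j\<in>D. repl UNIV u j = repl UNIV u' j"
      unfolding prod.inject tuple_eq_iff restrict_eq_iff by blast+
    have off: "repl I t j = repl UNIV t j" if "j \<in> D" "j \<notin> R" for t j
      unfolding repl_def using that unfolding R_def by (intro rep_cong) auto
    show "?z u = ?z u'" unfolding restrict_eq_iff using e off by metis
  qed
  also have "\<dots> \<le> ent joint ?r + ent joint ?y"
    using joint.cond_ent_le_ent[OF sr sy] by (simp add: cond_ent_def)
  also have "ent joint ?r \<le> (\<Sum>j\<in>R. ent joint (\<lambda>u. repl I u j))"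
    by (rule joint.ent_tuple_le[OF R simple_repl_coord])
  also have "\<dots> \<le> (\<Sum>j\<in>R. ln (real CARD('a)))"
    by (intro sum_mono joint.ent_le_ln_card[OF simple_repl_coord]) auto
  also have "\<dots> = card R * ln (real CARD('a))" by simp
  finally show ?thesis unfolding ent_nu[OF D] R_def[symmetric] by linarith
qed

lemma entropy_rate_gain:
  fixes \<F> :: "nat \<Rightarrow> 'g set"
  assumes fol: "folner_sequence \<F>"
    and \<beta>: "0 < \<beta>" "freq w + card (conflict 0) * p \<le> \<beta>"
  shows "entropy_rate \<mu> shift_map (fibres \<mu> (\<lambda>x. x 0)) + site_gain \<beta>
    \<le> entropy_rate \<nu> shift_map (fibres \<nu> (\<lambda>x. x 0))"
proof -
  let ?I = "\<lambda>n. {g \<in> \<F> n. \<forall>f\<in>F. g + f \<in> \<F> n}"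
  \<comment> \<open>j - f fails to lie in I if j - f itself or some j - f + f' leaves D, which are
    right translations of j by - f and - f + f'.\<close>
  let ?S = "uminus ` F \<union> (\<lambda>(f, f'). - f + f') ` (F \<times> F)"
  let ?b1 = "\<lambda>n. real (card {d \<in> \<F> n. \<exists>s\<in>F. d + s \<notin> \<F> n}) / card (\<F> n)"
  let ?b2 = "\<lambda>n. real (card {d \<in> \<F> n. \<exists>s\<in>?S. d + s \<notin> \<F> n}) / card (\<F> n)"
  have b: "?b1 \<longlonglongrightarrow> 0" "?b2 \<longlonglongrightarrow> 0"
    by (rule folner_boundary(1)[OF fol], use F in simp)+
  note lim\<mu> = entropy_rate_tendsto[OF simple_symbol fol]
  note lim\<nu> = nu.entropy_rate_tendsto[OF nu.simple_symbol fol]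
  have "entropy_rate \<mu> shift_map (fibres \<mu> (\<lambda>x. x 0)) + (1 - 0) * site_gain \<beta>
     \<le> entropy_rate \<nu> shift_map (fibres \<nu> (\<lambda>x. x 0)) + 0 * ln (real CARD('a))"
  proof (rule LIMSEQ_le)
    show "(\<lambda>n. ent \<mu> (orbit (\<lambda>x. x 0) (\<F> n)) / card (\<F> n) + (1 - ?b1 n) * site_gain \<beta>)
       \<longlonglongrightarrow> entropy_rate \<mu> shift_map (fibres \<mu> (\<lambda>x. x 0)) + (1 - 0) * site_gain \<beta>"
      by (intro tendsto_intros lim\<mu> b)
    show "(\<lambda>n. ent \<nu> (nu.orbit (\<lambda>x. x 0) (\<F> n)) / card (\<F> n) + ?b2 n * ln (real CARD('a)))
       \<longlonglongrightarrow> entropy_rate \<nu> shift_map (fibres \<nu> (\<lambda>x. x 0)) + 0 * ln (real CARD('a))"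
      by (intro tendsto_intros lim\<nu> b)
    show "\<exists>N. \<forall>n\<ge>N. ent \<mu> (orbit (\<lambda>x. x 0) (\<F> n)) / card (\<F> n) + (1 - ?b1 n) * site_gain \<beta>
      \<le> ent \<nu> (nu.orbit (\<lambda>x. x 0) (\<F> n)) / card (\<F> n) + ?b2 n * ln (real CARD('a))"
    proof (intro exI[of _ 0] allI impI)
      fix n
      define D where "D = \<F> n"
      define I where "I = ?I n"
      have I: "I = {g \<in> D. \<forall>f\<in>F. g + f \<in> D}" by (simp add: I_def D_def)
      have D: "finite D" "D \<noteq> {}" using fol unfolding D_def folner_sequence_def by blast+
      then have pos: "0 < real (card D)" by (simp add: card_gt_0_iff)
      have le: "ent \<mu> (\<lambda>x. restrict x D) + card I * site_gain \<beta>
        \<le> ent \<nu> (\<lambda>x. restrict x D) + card {j \<in> D. \<exists>f\<in>F. j - f \<notin> I} * ln (real CARD('a))"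
        using ent_repl_ge[OF D(1) I \<beta>] ent_nu_ge[OF D(1) I] by linarith
      have "card {j \<in> D. \<exists>f\<in>F. j - f \<notin> I} \<le> card {d \<in> D. \<exists>s\<in>?S. d + s \<notin> D}"
      proof (rule card_mono)
        show "{j \<in> D. \<exists>f\<in>F. j - f \<notin> I} \<subseteq> {d \<in> D. \<exists>s\<in>?S. d + s \<notin> D}"
        proof
          fix j assume "j \<in> {j \<in> D. \<exists>f\<in>F. j - f \<notin> I}"
          then obtain f where f: "j \<in> D" "f \<in> F" "j - f \<notin> I" by blast
          then consider "j + - f \<notin> D" | f' where "f' \<in> F" "j + (- f + f') \<notin> D"
            unfolding I by (auto simp: add.assoc[symmetric])
          then show "j \<in> {d \<in> D. \<exists>s\<in>?S. d + s \<notin> D}"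
            using f(1,2) by cases (blast, force)
        qed
      qed (use D in simp)
      moreover have "0 \<le> ln (real CARD('a))" by (simp add: Suc_le_eq card_gt_0_iff)
      ultimately have "card {j \<in> D. \<exists>f\<in>F. j - f \<notin> I} * ln (real CARD('a))
         \<le> card {d \<in> D. \<exists>s\<in>?S. d + s \<notin> D} * ln (real CARD('a))"
        by (intro mult_right_mono of_nat_mono)
      with le have le2: "ent \<mu> (\<lambda>x. restrict x D) + card I * site_gain \<beta>
        \<le> ent \<nu> (\<lambda>x. restrict x D) + card {d \<in> D. \<exists>s\<in>?S. d + s \<notin> D} * ln (real CARD('a))" by linarith
      have cI: "real (card I) = real (card D) - real (card {d \<in> D. \<exists>s\<in>F. d + s \<notin> D})"
      proof -
        have "D = I \<union> {d \<in> D. \<exists>s\<in>F. d + s \<notin> D}" "I \<inter> {d \<in> D. \<exists>s\<in>F. d + s \<notin> D} = {}"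
          unfolding I by blast+
        then have "card D = card I + card {d \<in> D. \<exists>s\<in>F. d + s \<notin> D}"
          using D(1) card_Un_disjoint[of I "{d \<in> D. \<exists>s\<in>F. d + s \<notin> D}"] I by simp
        then show ?thesis by simp
      qed
      have "(ent \<mu> (\<lambda>x. restrict x D) + card I * site_gain \<beta>) / card D
        \<le> (ent \<nu> (\<lambda>x. restrict x D) + card {d \<in> D. \<exists>s\<in>?S. d + s \<notin> D} * ln (real CARD('a))) / card D"
        using le2 pos by (intro divide_right_mono) auto
      moreover have "card I * site_gain \<beta> / card D = (1 - real (card {d \<in> D. \<exists>s\<in>F. d + s \<notin> D}) / card D) * site_gain \<beta>"
        unfolding cI using pos by (simp add: field_simps)
      ultimately show "ent \<mu> (orbit (\<lambda>x. x 0) (\<F> n)) / card (\<F> n) + (1 - ?b1 n) * site_gain \<beta>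
        \<le> ent \<nu> (nu.orbit (\<lambda>x. x 0) (\<F> n)) / card (\<F> n) + ?b2 n * ln (real CARD('a))"
        unfolding orbit_eq_window nu.orbit_eq_window D_def[symmetric]
        by (simp only: add_divide_distrib times_divide_eq_left)
    qed
  qed
  then show ?thesis by simp
qed


section \<open>Energy balance of the replacement\<close>

lemma rep_single_off: "k \<notin> (+) g ` F \<Longrightarrow> rep {g} x k = x k"
proof (rule rep_off)
  fix f assume k: "k \<notin> (+) g ` F" and f: "f \<in> F"
  show "k - f \<notin> {g}"
  proof
    assume "k - f \<in> {g}"
    then have "k = g + f" by (metis diff_add_cancel singletonD)
    then show False using k f by blast
  qed
qed

lemma repl_insert:
  assumes "h \<notin> S"
  shows "active h u \<Longrightarrow> repl (insert h S) u = rep {h} (repl S u)"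
    and "\<not> active h u \<Longrightarrow> repl (insert h S) u = repl S u"
proof -
  assume h: "active h u"
  then have eq: "act (fst u) (snd u) \<inter> insert h S = insert h (act (fst u) (snd u) \<inter> S)" by blast
  show "repl (insert h S) u = rep {h} (repl S u)"
    unfolding repl_def eq
  proof (rule rep_insert)
    show "sep (insert h (act (fst u) (snd u) \<inter> S))"
      by (rule sep_subset[OF sep_act[of "fst u" "snd u"]]) (use h in simp)
    show "h \<notin> act (fst u) (snd u) \<inter> S" using assms by simp
  qed
next
  assume "\<not> active h u"
  then show "repl (insert h S) u = repl S u" unfolding repl_def by (simp add: Int_insert_right)
qed

text \<open>The replacement at the origin; conjugated by shifts it describes the replacement at any
  site where v occurs.\<close>

definition \<tau> :: "('g \<Rightarrow> 'a) \<Rightarrow> 'g \<Rightarrow> 'a" where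
  "\<tau> x = (if occurs v x 0 then rep {0} x else x)"

lemma \<tau>_in: "x \<in> X \<Longrightarrow> \<tau> x \<in> X"
  by (simp add: \<tau>_def rep_single_in)

lemma \<tau>_shift: "occurs v x h \<Longrightarrow> shift_map (- h) (\<tau> (shift_map h x)) = rep {h} x"
proof -
  assume "occurs v x h"
  then have "occurs v (shift_map h x) 0" by (simp add: occurs_def shift_map_def)
  then show ?thesis unfolding \<tau>_def rep_single[of h] rep_single[of 0] by simp
qed

lemma \<tau>_measurable: "\<tau> \<in> measurable \<mu> \<mu>"
proof (rule measurable_intoI[OF measurable_shiftI])
  fix h a
  have "{x \<in> X. restrict x (insert h F) \<in> {y. \<tau> y h = a}} \<in> sets \<mu>"
    by (rule sets_window) (use F in simp)
  also have "{x \<in> X. restrict x (insert h F) \<in> {y. \<tau> y h = a}} = {x \<in> space \<mu>. \<tau> x h = a}"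
  proof -
    have "\<tau> (restrict x (insert h F)) h = \<tau> x h" for x
    proof -
      have "occurs v (restrict x (insert h F)) 0 \<longleftrightarrow> occurs v x 0" by (simp add: occurs_def)
      moreover have "rep {0} (restrict x (insert h F)) h = rep {0} x h"
        by (simp add: rep_0 override_on_def)
      ultimately show ?thesis by (simp add: \<tau>_def)
    qed
    then show ?thesis by (simp add: space_eq)
  qed
  finally show "{x \<in> space \<mu>. \<tau> x h = a} \<in> sets \<mu>" .
qed (simp add: space_eq \<tau>_in)

text \<open>Telescoping over the sites of R: each step changes \<open>\<phi>\<close> only if its
  site is active, hence marked. Bounding by the mark makes the expectation linear in p.\<close>

lemma oscillation_repl:
  fixes \<phi> :: "('g \<Rightarrow> 'a) \<Rightarrow> real"
  assumes V: "\<And>h. 0 \<le> V h"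
    "\<And>h x y. x \<in> X \<Longrightarrow> y \<in> X \<Longrightarrow> (\<And>k. k \<notin> (+) h ` F \<Longrightarrow> x k = y k) \<Longrightarrow> \<bar>\<phi> x - \<phi> y\<bar> \<le> V h"
    and "finite R" "R \<inter> S = {}" "u \<in> space joint"
  shows "\<bar>\<phi> (repl (R \<union> S) u) - \<phi> (repl S u)\<bar> \<le> (\<Sum>h\<in>R. V h * of_bool (mark h u))"
  using assms(3,4)
proof (induction R rule: finite_induct)
  case empty
  then show ?case by simp
next
  case (insert h R)
  have h: "h \<notin> R \<union> S" using insert by blast
  have IH: "\<bar>\<phi> (repl (R \<union> S) u) - \<phi> (repl S u)\<bar> \<le> (\<Sum>h\<in>R. V h * of_bool (mark h u))"
    using insert.IH insert.prems by blast
  have "\<bar>\<phi> (repl (insert h (R \<union> S)) u) - \<phi> (repl (R \<union> S) u)\<bar> \<le> V h * of_bool (mark h u)"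
  proof (cases "active h u")
    case True
    have "\<bar>\<phi> (repl (insert h (R \<union> S)) u) - \<phi> (repl (R \<union> S) u)\<bar> \<le> V h"
    proof (rule V(2))
      show "repl (insert h (R \<union> S)) u \<in> X" "repl (R \<union> S) u \<in> X"
        using assms(5) by (rule repl_in)+
      show "repl (insert h (R \<union> S)) u k = repl (R \<union> S) u k" if "k \<notin> (+) h ` F" for k
        unfolding repl_insert(1)[OF h True] using that by (rule rep_single_off)
    qed
    then show ?thesis using act_mark[OF True] by simp
  next
    case False
    then show ?thesis using V(1)[of h] by (simp add: repl_insert(2)[OF h False])
  qed
  then have "\<bar>\<phi> (repl (insert h (R \<union> S)) u) - \<phi> (repl S u)\<bar>
      \<le> V h * of_bool (mark h u) + (\<Sum>h\<in>R. V h * of_bool (mark h u))"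
    using IH by linarith
  then show ?case unfolding sum.insert[OF insert.hyps] Un_insert_left .
qed

text \<open>Sites outside T cost at most \<open>p * \<epsilon>\<close> on average, and two marks
  inside T have a probability of order \<open>p\<^sup>2\<close>. What remains is a single
  replacement at some h in T. Invariance of \<open>\<mu>\<close> moves it to the origin, and
  \<open>\<phi>\<close> is then read after the shift by - h; this is why the assumption on s sums
  over \<open>shift_map (- h)\<close>.\<close>

lemma energy_lower_bound:
  fixes \<phi> :: "('g \<Rightarrow> 'a) \<Rightarrow> real"
  assumes \<phi>: "continuous_on X \<phi>" and V: "\<And>h. 0 \<le> V h"
    "\<And>h x y. x \<in> X \<Longrightarrow> y \<in> X \<Longrightarrow> (\<And>k. k \<notin> (+) h ` F \<Longrightarrow> x k = y k) \<Longrightarrow> \<bar>\<phi> x - \<phi> y\<bar> \<le> V h"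
    and B: "0 \<le> B" "\<And>x. x \<in> X \<Longrightarrow> \<bar>\<phi> x\<bar> \<le> B"
    and T: "finite T" "\<And>T'. finite T' \<Longrightarrow> T' \<inter> T = {} \<Longrightarrow> sum V T' \<le> \<epsilon>"
    and s: "\<And>x. x \<in> X \<Longrightarrow> occurs v x 0 \<Longrightarrow>
      (\<Sum>h\<in>T. \<phi> (shift_map (- h) x) - \<phi> (shift_map (- h) (rep {0} x))) \<le> s"
  shows "(\<integral>x. \<phi> x \<partial>\<mu>) - freq v * q * s - p * \<epsilon> - 2 * B * (card T + 1) * (card T)\<^sup>2 * p\<^sup>2 \<le> (\<integral>x. \<phi> x \<partial>\<nu>)"
proof -
  have \<phi>m: "\<phi> \<in> borel_measurable \<mu>" by (rule continuous_on_measurable[OF \<phi>])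
  have \<phi>S: "(\<lambda>u. \<phi> (repl S u)) \<in> borel_measurable joint" for S
    by (rule measurable_compose[OF repl_measurable \<phi>m])
  have i\<phi>S: "integrable joint (\<lambda>u. \<phi> (repl S u))" for S
    by (rule joint.integrable_const_bound[where B = B]) (auto intro!: AE_I2 B(2) repl_in \<phi>S)
  have i\<phi>: "integrable joint (\<lambda>u. \<phi> (fst u))"
    by (rule joint.integrable_const_bound[where B = B])
      (auto intro!: AE_I2 B(2) measurable_compose[OF fst_measurable \<phi>m] simp: space_joint)
  have int_nu: "(\<integral>x. \<phi> x \<partial>\<nu>) = (\<integral>u. \<phi> (repl UNIV u) \<partial>joint)"
    unfolding \<nu>_def by (rule integral_distr[OF repl_measurable \<phi>m])
  have int_mu: "(\<integral>x. \<phi> x \<partial>\<mu>) = (\<integral>u. \<phi> (fst u) \<partial>joint)"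
    by (subst distr_fst[symmetric]) (rule integral_distr[OF fst_measurable \<phi>m])
  have imark: "integrable joint (\<lambda>u. of_bool (E u) :: real)" "(\<integral>u. of_bool (E u) \<partial>joint) = joint.prob {u \<in> space joint. E u}"
    if "simple_function joint E" for E
  proof -
    have sE: "{u \<in> space joint. E u} \<in> sets joint" by (rule simple_pred_sets[OF that])
    have "integrable joint (indicator {u \<in> space joint. E u} :: _ \<Rightarrow> real)"
      using sE by (intro integrable_real_indicator) (auto simp: joint.emeasure_eq_measure)
    moreover have "integrable joint (indicator {u \<in> space joint. E u} :: _ \<Rightarrow> real)
      \<longleftrightarrow> integrable joint (\<lambda>u. of_bool (E u) :: real)"
      by (rule Bochner_Integration.integrable_cong) (auto simp: indicator_def)
    ultimately show "integrable joint (\<lambda>u. of_bool (E u) :: real)" by blast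
    have "(\<integral>u. of_bool (E u) \<partial>joint) = (\<integral>u. indicator {u \<in> space joint. E u} u \<partial>joint)"
      by (rule Bochner_Integration.integral_cong) (auto simp: indicator_def)
    also have "\<dots> = joint.prob {u \<in> space joint. E u}" using sE by simp
    finally show "(\<integral>u. of_bool (E u) \<partial>joint) = joint.prob {u \<in> space joint. E u}" .
  qed
  have step1: "(\<integral>u. \<phi> (repl T u) \<partial>joint) - p * \<epsilon> \<le> (\<integral>u. \<phi> (repl UNIV u) \<partial>joint)"
  proof (rule field_le_epsilon)
    fix \<delta> :: real assume \<delta>: "0 < \<delta>"
    obtain K where K: "finite K"
      "\<And>x y. x \<in> X \<Longrightarrow> y \<in> X \<Longrightarrow> (\<forall>h\<in>K. x h = y h) \<Longrightarrow> \<bar>\<phi> x - \<phi> y\<bar> < \<delta>"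
      using uniformly_continuous_cylinder[OF subshift_closed[OF X] \<phi> \<delta>] by blast
    \<comment> \<open>Up to \<open>\<delta>\<close> only the sites that reach the window K matter,
      which reduces infinitely many replacements to finitely many; the bound
      \<open>p * \<epsilon>\<close> does not depend on \<open>\<delta>\<close>.\<close>
    define R where "R = sites K - T"
    have R: "finite R" "R \<inter> T = {}" using finite_sites[OF K(1)] by (auto simp: R_def)
    let ?g = "\<lambda>u. \<Sum>h\<in>R. V h * of_bool (mark h u)"
    have ig: "integrable joint ?g"
      by (intro Bochner_Integration.integrable_sum Bochner_Integration.integrable_mult_right imark simple_mark)
    have "\<phi> (repl T u) - \<delta> - ?g u \<le> \<phi> (repl UNIV u)" if u: "u \<in> space joint" for u
    proof -
      have "\<bar>\<phi> (repl (R \<union> T) u) - \<phi> (repl T u)\<bar> \<le> ?g u"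
        by (rule oscillation_repl[OF V R u])
      moreover have "\<bar>\<phi> (repl UNIV u) - \<phi> (repl (R \<union> T) u)\<bar> < \<delta>"
      proof (rule K(2)[OF repl_in[OF u] repl_in[OF u]])
        show "\<forall>h\<in>K. repl UNIV u h = repl (R \<union> T) u h"
          unfolding repl_def using rep_sites[of _ K "R \<union> T"] by (auto simp: R_def)
      qed
      ultimately show ?thesis by linarith
    qed
    then have "(\<integral>u. \<phi> (repl T u) - \<delta> - ?g u \<partial>joint) \<le> (\<integral>u. \<phi> (repl UNIV u) \<partial>joint)"
      by (intro integral_mono Bochner_Integration.integrable_diff i\<phi>S ig) auto
    moreover have "(\<integral>u. \<phi> (repl T u) - \<delta> - ?g u \<partial>joint) = (\<integral>u. \<phi> (repl T u) \<partial>joint) - \<delta> - (\<integral>u. ?g u \<partial>joint)"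
      using i\<phi>S ig by (simp add: Bochner_Integration.integral_diff joint.prob_space)
    moreover have "(\<integral>u. ?g u \<partial>joint) = (\<Sum>h\<in>R. V h * p)"
      using imark(1)[OF simple_mark] by (subst Bochner_Integration.integral_sum) (auto simp: imark(2)[OF simple_mark] prob_mark)
    moreover have "(\<Sum>h\<in>R. V h * p) \<le> p * \<epsilon>"
      using mult_right_mono[OF T(2)[OF R], of p] p unfolding sum_distrib_right mult.commute[of \<epsilon>] by simp
    ultimately show "(\<integral>u. \<phi> (repl T u) \<partial>joint) - p * \<epsilon> \<le> (\<integral>u. \<phi> (repl UNIV u) \<partial>joint) + \<delta>"
      by linarith
  qed
  define k where "k h x = \<phi> (shift_map (- h) (\<tau> x)) - \<phi> (shift_map (- h) x)" for h x
  define P where "P = {(h, h'). h \<in> T \<and> h' \<in> T \<and> h \<noteq> h'}"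
  have PT: "P \<subseteq> T \<times> T" by (auto simp: P_def)
  have P: "finite P" using finite_subset[OF PT] T(1) by simp
  have cP: "real (card P) \<le> (card T)\<^sup>2"
    using card_mono[OF _ PT] T(1) by (simp add: card_cartesian_product power2_eq_square flip: of_nat_mult)
  let ?iso = "\<lambda>h \<omega>. \<omega> h \<and> (\<forall>i\<in>conflict h - {h}. \<not> \<omega> i)"
  \<comment> \<open>The worst case with two marks in T: \<open>card T\<close> summands of size
    \<open>2 * B\<close>, and another \<open>2 * B\<close> for the actual change of
    \<open>\<phi>\<close>.\<close>
  let ?C = "2 * B * (card T + 1)"
  let ?a = "\<lambda>h u. of_bool (active h u) * k h (shift_map h (fst u))"
  let ?b = "\<lambda>u. \<Sum>hh\<in>P. of_bool (mark (fst hh) u \<and> mark (snd hh) u) :: real"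
  have kX: "\<bar>k h x\<bar> \<le> 2 * B" if "x \<in> X" for h x
    using B(2)[OF subshift_shift_map[OF X \<tau>_in[OF that], of "- h"]] B(2)[OF subshift_shift_map[OF X that, of "- h"]]
    unfolding k_def by linarith
  have kact: "k h (shift_map h (fst u)) = \<phi> (rep {h} (fst u)) - \<phi> (fst u)" if "active h u" for h u
    unfolding k_def \<tau>_shift[OF act_occurs[OF that]] by (simp add: shift_map_shift_map)
  \<comment> \<open>With at most one active site in T the sum is the exact change of
    \<open>\<phi>\<close>. Otherwise some pair in P is marked, \<open>?b u\<close> is at least 1,
    and the error term absorbs everything.\<close>
  have point: "(\<Sum>h\<in>T. ?a h u) - ?C * ?b u \<le> \<phi> (repl T u) - \<phi> (fst u)" if u: "u \<in> space joint" for u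
  proof (cases "\<exists>h\<in>T. \<exists>h'\<in>T. h \<noteq> h' \<and> active h u \<and> active h' u")
    case True
    then obtain h h' where hh: "(h, h') \<in> P" "mark h u" "mark h' u" unfolding P_def using act_mark by blast
    have x: "fst u \<in> X" using u by (auto simp: space_joint)
    have "of_bool (mark (fst (h, h')) u \<and> mark (snd (h, h')) u) \<le> ?b u"
      by (rule member_le_sum[OF hh(1) _ P, of "\<lambda>hh. of_bool (mark (fst hh) u \<and> mark (snd hh) u)"]) simp
    then have "1 \<le> ?b u" using hh by simp
    then have "?C * 1 \<le> ?C * ?b u" using B(1) by (intro mult_left_mono) auto
    moreover have "(\<Sum>h\<in>T. ?a h u) \<le> (\<Sum>h\<in>T. 2 * B)"
    proof (rule sum_mono)
      fix h
      have "k h (shift_map h (fst u)) \<le> 2 * B" using kX[OF subshift_shift_map[OF X x]] abs_le_D1 by blast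
      then show "?a h u \<le> 2 * B" using B(1) by simp
    qed
    moreover have "\<bar>\<phi> (repl T u)\<bar> \<le> B" "\<bar>\<phi> (fst u)\<bar> \<le> B" using B(2) repl_in[OF u] x by blast+
    ultimately show ?thesis by (simp add: algebra_simps)
  next
    case False
    have b0: "0 \<le> ?b u" by (rule sum_nonneg) auto
    have "(\<Sum>h\<in>T. ?a h u) = \<phi> (repl T u) - \<phi> (fst u)"
    proof (cases "\<exists>h\<in>T. active h u")
      case True
      then obtain h where h: "h \<in> T" "active h u" by blast
      have eq: "act (fst u) (snd u) \<inter> T = {h}" using h False by blast
      have "(\<Sum>g\<in>T. ?a g u) = (\<Sum>g\<in>T. if g = h then k h (shift_map h (fst u)) else 0)"
        by (rule sum.cong) (use h False in auto)
      then show ?thesis using h T(1) unfolding repl_def eq by (simp add: kact)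
    next
      case F: False
      then have "act (fst u) (snd u) \<inter> T = {}" by blast
      then show ?thesis using F unfolding repl_def by simp
    qed
    then show ?thesis using b0 B(1) by simp
  qed
  have km: "k h \<in> borel_measurable \<mu>" for h
    unfolding k_def
    by (intro borel_measurable_diff measurable_compose[OF measurable_compose[OF \<tau>_measurable shift_map_measurable] \<phi>m]
      measurable_compose[OF shift_map_measurable \<phi>m])
  have ik: "integrable \<mu> (k h)" for h
    by (rule integrable_const_bound[where B = "2 * B"]) (auto intro!: AE_I2 kX km simp: space_eq)
  have ia: "integrable joint (?a h)" for h
  proof (rule joint.integrable_const_bound[where B = "2 * B"])
    show "AE u in joint. norm (?a h u) \<le> 2 * B"
      using kX[OF subshift_shift_map[OF X]] B(1) by (intro AE_I2) (auto simp: space_joint)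
    have "(\<lambda>u. k h (shift_map h (fst u))) \<in> borel_measurable joint"
      by (rule measurable_compose[OF measurable_compose[OF fst_measurable shift_map_measurable] km])
    then show "?a h \<in> borel_measurable joint"
      using borel_measurable_integrable[OF imark(1)[OF simple_active]] by (intro borel_measurable_times)
  qed
  have inta: "(\<integral>u. ?a h u \<partial>joint) = q * (\<integral>x. k h x \<partial>\<mu>)" for h
  proof -
    interpret pair_prob_space \<mu> bern ..
    \<comment> \<open>\<open>k h\<close> vanishes where v does not occur, so activity can be
      replaced by its condition on the marks alone; then the integral over the product measure
      factorises.\<close>
    have eq: "?a h u = k h (shift_map h (fst u)) * of_bool (?iso h (snd u))" for u
    proof (cases "occurs v (fst u) h")
      case True
      then show ?thesis by (simp add: act_def)
    next
      case False
      then have "\<not> occurs v (shift_map h (fst u)) 0" by (simp add: occurs_def shift_map_def)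
      then have "k h (shift_map h (fst u)) = 0" by (simp add: k_def \<tau>_def)
      then show ?thesis by simp
    qed
    have inner: "(\<integral>\<omega>. k h (shift_map h x) * of_bool (?iso h \<omega>) \<partial>bern) = k h (shift_map h x) * q" for x
    proof -
      have "(\<integral>\<omega>. of_bool (?iso h \<omega>) \<partial>bern) = (\<integral>\<omega>. indicator {\<omega>. ?iso h \<omega>} \<omega> \<partial>bern :: real)"
        by (rule Bochner_Integration.integral_cong) (auto simp: indicator_def)
      also have "\<dots> = q" using sets_isolated[of h] bern_isolated[of h] by simp
      finally show ?thesis by simp
    qed
    have "integrable (\<mu> \<Otimes>\<^sub>M bern) (\<lambda>u. k h (shift_map h (fst u)) * of_bool (?iso h (snd u)))"
      using ia[of h] unfolding eq joint_def .
    from integral_fst'[OF this]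
    have "(\<integral>u. ?a h u \<partial>joint) = (\<integral>x. (\<integral>\<omega>. k h (shift_map h x) * of_bool (?iso h \<omega>) \<partial>bern) \<partial>\<mu>)"
      unfolding eq joint_def by simp
    also have "\<dots> = (\<integral>x. k h (shift_map h x) * q \<partial>\<mu>)" by (simp only: inner)
    also have "\<dots> = (\<integral>x. k h (shift_map h x) \<partial>\<mu>) * q" by simp
    also have "(\<integral>x. k h (shift_map h x) \<partial>\<mu>) = (\<integral>x. k h x \<partial>distr \<mu> \<mu> (shift_map h))"
      by (rule integral_distr[OF shift_map_measurable km, symmetric])
    finally show ?thesis by (simp add: T_distr)
  qed
  have sumk: "- s * freq v \<le> (\<Sum>h\<in>T. \<integral>x. k h x \<partial>\<mu>)"
  proof -
    have occ: "{x \<in> X. occurs v x 0} \<in> sets \<mu>" by (rule sets_occurs)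
    have "(\<integral>x. - s * indicator {x \<in> X. occurs v x 0} x \<partial>\<mu>) \<le> (\<integral>x. (\<Sum>h\<in>T. k h x) \<partial>\<mu>)"
    proof (rule integral_mono)
      show "integrable \<mu> (\<lambda>x. - s * indicator {x \<in> X. occurs v x 0} x)"
        using occ by (intro Bochner_Integration.integrable_mult_right integrable_real_indicator) (auto simp: emeasure_eq_measure)
      show "integrable \<mu> (\<lambda>x. \<Sum>h\<in>T. k h x)" by (intro Bochner_Integration.integrable_sum ik)
      fix x assume x: "x \<in> space \<mu>"
      show "- s * indicator {x \<in> X. occurs v x 0} x \<le> (\<Sum>h\<in>T. k h x)"
      proof (cases "occurs v x 0")
        case True
        have "(\<Sum>h\<in>T. k h x) = - (\<Sum>h\<in>T. \<phi> (shift_map (- h) x) - \<phi> (shift_map (- h) (rep {0} x)))"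
          unfolding sum_negf[symmetric] k_def \<tau>_def using True by (intro sum.cong) auto
        then show ?thesis using s[of x] x True by (simp add: space_eq)
      qed (simp add: k_def \<tau>_def)
    qed
    also have "(\<integral>x. - s * indicator {x \<in> X. occurs v x 0} x \<partial>\<mu>) = - s * freq v"
      using occ by (simp add: freq_def space_eq Int_absorb2)
    also have "(\<integral>x. (\<Sum>h\<in>T. k h x) \<partial>\<mu>) = (\<Sum>h\<in>T. \<integral>x. k h x \<partial>\<mu>)"
      by (intro Bochner_Integration.integral_sum ik)
    finally show ?thesis .
  qed
  have sPair: "simple_function joint (\<lambda>u. mark h u \<and> mark h' u)" for h h'
    by (rule simple_function_determined[OF simple_function_Pair[OF simple_mark[of h] simple_mark[of h']]]) auto
  have ib: "integrable joint ?b"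
    by (intro Bochner_Integration.integrable_sum imark(1)[OF sPair])
  have intb: "(\<integral>u. ?b u \<partial>joint) = card P * p\<^sup>2"
  proof -
    have "(\<integral>u. ?b u \<partial>joint) = (\<Sum>hh\<in>P. \<integral>u. of_bool (mark (fst hh) u \<and> mark (snd hh) u) \<partial>joint)"
      by (intro Bochner_Integration.integral_sum imark(1)[OF sPair])
    also have "\<dots> = (\<Sum>hh\<in>P. p\<^sup>2)"
    proof (rule sum.cong[OF refl])
      fix hh assume "hh \<in> P"
      then have "fst hh \<noteq> snd hh" by (auto simp: P_def)
      then show "(\<integral>u. of_bool (mark (fst hh) u \<and> mark (snd hh) u) \<partial>joint) = p\<^sup>2"
        unfolding imark(2)[OF sPair] power2_eq_square by (rule prob_two_marks)
    qed
    finally show ?thesis by simp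
  qed
  have "(\<integral>u. (\<Sum>h\<in>T. ?a h u) - ?C * ?b u \<partial>joint) \<le> (\<integral>u. \<phi> (repl T u) - \<phi> (fst u) \<partial>joint)"
    by (intro integral_mono Bochner_Integration.integrable_diff Bochner_Integration.integrable_sum Bochner_Integration.integrable_mult_right ia ib i\<phi>S i\<phi> point)
  moreover have "(\<integral>u. \<phi> (repl T u) - \<phi> (fst u) \<partial>joint) = (\<integral>u. \<phi> (repl T u) \<partial>joint) - (\<integral>x. \<phi> x \<partial>\<mu>)"
    unfolding int_mu by (rule Bochner_Integration.integral_diff[OF i\<phi>S i\<phi>])
  moreover have "(\<integral>u. (\<Sum>h\<in>T. ?a h u) - ?C * ?b u \<partial>joint) = q * (\<Sum>h\<in>T. \<integral>x. k h x \<partial>\<mu>) - ?C * (card P * p\<^sup>2)"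
  proof -
    have "(\<integral>u. (\<Sum>h\<in>T. ?a h u) - ?C * ?b u \<partial>joint) = (\<integral>u. (\<Sum>h\<in>T. ?a h u) \<partial>joint) - (\<integral>u. ?C * ?b u \<partial>joint)"
      by (intro Bochner_Integration.integral_diff Bochner_Integration.integrable_sum Bochner_Integration.integrable_mult_right ia ib)
    also have "(\<integral>u. (\<Sum>h\<in>T. ?a h u) \<partial>joint) = (\<Sum>h\<in>T. \<integral>u. ?a h u \<partial>joint)"
      by (intro Bochner_Integration.integral_sum ia)
    also have "\<dots> = q * (\<Sum>h\<in>T. \<integral>x. k h x \<partial>\<mu>)" unfolding inta sum_distrib_left ..
    also have "(\<integral>u. ?C * ?b u \<partial>joint) = ?C * (card P * p\<^sup>2)"
      unfolding intb[symmetric] by (rule integral_mult_right_zero)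
    finally show ?thesis .
  qed
  moreover have "q * (- s * freq v) \<le> q * (\<Sum>h\<in>T. \<integral>x. k h x \<partial>\<mu>)"
    using sumk q_le(1) by (rule mult_left_mono)
  moreover have "?C * (card P * p\<^sup>2) \<le> ?C * ((card T)\<^sup>2 * p\<^sup>2)"
    using cP B(1) by (intro mult_left_mono mult_right_mono) auto
  ultimately show ?thesis using step1 unfolding int_nu by (simp add: algebra_simps)
qed

end

subsection \<open>The first order gain at small density\<close>

text \<open>The case q = p c of \<open>site_gain\<close>. The product rule for \<open>eta\<close>
  splits off the multiples of \<open>eta (m * p)\<close>, the terms of order p ln (1/p), and they
  cancel. The estimate \<open>ln (1 - p * c) \<le> - (p * c)\<close> cancels the linear term - m p c
  up to a square, and the loss by blocked marks appears as the binary entropy of c.\<close>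

lemma entropy_gain_lower_bound:
  fixes m p c \<beta> :: real
  assumes m: "0 < m" and p: "0 < p" "p < 1" and c: "0 < c" "c \<le> 1"
  shows "p * (m * c * (ln m - ln \<beta>) - m * (eta c + eta (1 - c)) - m * p * c\<^sup>2)
    \<le> eta (m * p) - eta (m * (p * c)) - eta (m * p - m * (p * c))
      + eta (m - m * (p * c)) - eta m - m * (p * c) - m * (p * c) * ln \<beta>"
proof -
  have 1: "eta (m * (p * c)) = m * p * eta c + c * eta (m * p)"
    using eta_mult_nonneg[of "m * p" c] m p c by (simp add: mult.assoc)
  have "m * p - m * (p * c) = m * p * (1 - c)" by (simp add: algebra_simps)
  then have 2: "eta (m * p - m * (p * c)) = m * p * eta (1 - c) + (1 - c) * eta (m * p)"
    using eta_mult_nonneg[of "m * p" "1 - c"] m p c by simp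
  have pc: "0 < p * c" "p * c < 1"
  proof -
    show "0 < p * c" using p c by simp
    have "p * c \<le> p * 1" using p c by (intro mult_left_mono) auto
    then show "p * c < 1" using p by linarith
  qed
  have "m - m * (p * c) = m * (1 - p * c)" by (simp add: algebra_simps)
  then have 3: "eta (m - m * (p * c)) = m * eta (1 - p * c) + (1 - p * c) * eta m"
    using eta_mult_nonneg[of m "1 - p * c"] m pc by simp
  have "ln (1 - p * c) \<le> - (p * c)" using ln_le_minus_one[of "1 - p * c"] pc by simp
  then have "(1 - p * c) * ln (1 - p * c) \<le> (1 - p * c) * (- (p * c))"
    using pc by (intro mult_left_mono) auto
  then have 4: "p * c - (p * c)\<^sup>2 \<le> eta (1 - p * c)"
    by (simp add: eta_def algebra_simps power2_eq_square)
  have "m * (p * c - (p * c)\<^sup>2) \<le> m * eta (1 - p * c)" using 4 m by (intro mult_left_mono) auto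
  then show ?thesis
    unfolding 1 2 3 by (simp add: eta_def algebra_simps power2_eq_square)
qed

text \<open>Divided by p, the quantity tends to m (ln m - ln \<open>\<beta>\<close> - s) -
  \<open>\<epsilon>\<close> as p decreases to 0: a marked site is then rarely blocked, so
  \<open>(1 - p) ^ N\<close> tends to 1 and its binary entropy to 0.\<close>

lemma exists_small_density:
  fixes m \<beta> s \<epsilon> C b :: real and N :: nat
  assumes "\<epsilon> < m * (ln m - ln \<beta> - s)" and b: "0 < b"
  obtains p where "0 < p" "p < 1" "p < b"
    "0 < p * (m * (1 - p) ^ N * (ln m - ln \<beta>) - m * (eta ((1 - p) ^ N) + eta (1 - (1 - p) ^ N))
        - m * p * ((1 - p) ^ N)\<^sup>2) - m * (p * (1 - p) ^ N) * s - p * \<epsilon> - C * p\<^sup>2"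
proof -
  have c: "((\<lambda>p::real. (1 - p) ^ N) \<longlongrightarrow> (1 - 0) ^ N) (at_right 0)"
    by (intro tendsto_intros)
  have e: "((\<lambda>p::real. eta ((1 - p) ^ N) + eta (1 - (1 - p) ^ N)) \<longlongrightarrow> 0) (at_right 0)"
  \<comment> \<open>For N = 0 the argument \<open>1 - (1 - p) ^ N\<close> is constantly 0 and does
    not approach 0 from the right.\<close>
  proof (cases "N = 0")
    case False
    have "((\<lambda>t::real. - t * ln t - (1 - t) * ln (1 - t)) \<longlongrightarrow> 0) (at_right 0)"
      by real_asymp
    then have 1: "((\<lambda>t::real. eta (1 - t) + eta t) \<longlongrightarrow> 0) (at_right 0)"
      by (simp add: eta_def algebra_simps)
    have "filterlim (\<lambda>p::real. 1 - (1 - p) ^ N) (at_right 0) (at_right 0)"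
    proof (rule filterlim_at_withinI)
      show "((\<lambda>p::real. 1 - (1 - p) ^ N) \<longlongrightarrow> 0) (at_right 0)"
        using tendsto_diff[OF tendsto_const[of 1] c] by simp
      have "\<forall>\<^sub>F p::real in at_right 0. 0 < p \<and> p < 1"
        unfolding eventually_at_right_field by (intro exI[of _ 1]) auto
      then show "\<forall>\<^sub>F p::real in at_right 0. 1 - (1 - p) ^ N \<in> {0<..} - {0}"
        by eventually_elim (use False in \<open>simp add: power_less_one_iff\<close>)
    qed
    from filterlim_compose[OF 1 this] show ?thesis by simp
  qed simp
  let ?H = "\<lambda>p. m * (1 - p) ^ N * (ln m - ln \<beta>) - m * (eta ((1 - p) ^ N) + eta (1 - (1 - p) ^ N))
        - m * p * ((1 - p) ^ N)\<^sup>2 - m * (1 - p) ^ N * s - \<epsilon> - C * p"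
  have "(?H \<longlongrightarrow> m * (1 - 0) ^ N * (ln m - ln \<beta>) - m * 0 - m * 0 * ((1 - 0) ^ N)\<^sup>2 - m * (1 - 0) ^ N * s - \<epsilon> - C * 0) (at_right 0)"
    by (intro tendsto_intros e)
  then have "\<forall>\<^sub>F p in at_right 0. 0 < ?H p"
    by (rule order_tendstoD(1)) (use assms(1) in \<open>simp add: algebra_simps\<close>)
  moreover have "\<forall>\<^sub>F p::real in at_right 0. 0 < p \<and> p < min 1 b"
    unfolding eventually_at_right_field using b by (intro exI[of _ "min 1 b"]) auto
  ultimately have "\<forall>\<^sub>F p in at_right 0. 0 < ?H p \<and> 0 < p \<and> p < min 1 b" by (rule eventually_conj)
  then obtain p where p: "0 < ?H p" "0 < p" "p < min 1 b"
    using eventually_happens[of _ "at_right (0::real)"] by (auto simp: trivial_limit_at_right_real)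
  have "0 < p * ?H p" using p(1,2) by (rule mult_pos_pos[rotated])
  then show thesis
    using p by (intro that[of p]) (auto simp: algebra_simps power2_eq_square)
qed

subsection \<open>Unconditional sums\<close>

lemma summable_on_tail:
  fixes V :: "'i \<Rightarrow> real"
  assumes V: "V summable_on UNIV" "\<And>h. 0 \<le> V h" and e: "0 < e"
  obtains T where "finite T" "\<And>T'. finite T' \<Longrightarrow> T' \<inter> T = {} \<Longrightarrow> sum V T' \<le> e"
proof -
  have "\<forall>\<^sub>F T in finite_subsets_at_top UNIV. infsum V UNIV - e < sum V T"
    using e by (intro order_tendstoD(1)[OF infsum_tendsto[OF V(1)]]) simp
  then obtain T where T: "finite T" "infsum V UNIV - e < sum V T"
    unfolding eventually_finite_subsets_at_top by auto
  show thesis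
  proof (rule that[OF T(1)])
    fix T' :: "'i set" assume T': "finite T'" "T' \<inter> T = {}"
    have "sum V T' + sum V T = sum V (T' \<union> T)" using T(1) T' by (simp add: sum.union_disjoint)
    also have "\<dots> \<le> infsum V UNIV"
      using V T(1) T'(1) by (intro finite_sum_le_infsum) auto
    finally show "sum V T' \<le> e" using T(2) by simp
  qed
qed

lemma summable_on_dominated:
  fixes a V :: "'i \<Rightarrow> real"
  assumes "V summable_on UNIV" "\<And>h. \<bar>a h\<bar> \<le> V h"
  shows "a summable_on UNIV"
proof -
  have "(\<lambda>h. norm (a h)) summable_on UNIV"
    by (rule Infinite_Sum.abs_summable_on_comparison_test'[OF assms(1)]) (use assms(2) in simp)
  then show ?thesis by (rule abs_summable_summable)
qed

text \<open>The same finite set T serves every family dominated by V, which makes the truncation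
  uniform in the configuration.\<close>

lemma sum_le_infsum_tail:
  fixes a V :: "'i \<Rightarrow> real"
  assumes V: "V summable_on UNIV" and a: "\<And>h. \<bar>a h\<bar> \<le> V h"
    and T: "finite T" "\<And>T'. finite T' \<Longrightarrow> T' \<inter> T = {} \<Longrightarrow> sum V T' \<le> e"
  shows "\<bar>sum a T - infsum a UNIV\<bar> \<le> e"
proof -
  have lim: "((\<lambda>T'. \<bar>sum a T - sum a T'\<bar>) \<longlongrightarrow> \<bar>sum a T - infsum a UNIV\<bar>) (finite_subsets_at_top UNIV)"
    by (intro tendsto_intros infsum_tendsto summable_on_dominated[OF V a])
  have "\<forall>\<^sub>F T' in finite_subsets_at_top UNIV. \<bar>sum a T - sum a T'\<bar> \<le> e"
    unfolding eventually_finite_subsets_at_top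
  proof (intro exI[of _ T] conjI allI impI)
    fix T' assume T': "finite T' \<and> T \<subseteq> T' \<and> T' \<subseteq> UNIV"
    then have "sum a T' = sum a (T' - T) + sum a T" using sum.subset_diff by blast
    then have "\<bar>sum a T - sum a T'\<bar> = \<bar>sum a (T' - T)\<bar>" by simp
    also have "\<dots> \<le> (\<Sum>h\<in>T' - T. \<bar>a h\<bar>)" by (rule sum_abs)
    also have "\<dots> \<le> sum V (T' - T)" by (rule sum_mono[OF a])
    also have "\<dots> \<le> e" using T' by (intro T(2)) auto
    finally show "\<bar>sum a T - sum a T'\<bar> \<le> e" .
  qed (use T in auto)
  then show ?thesis by (rule tendsto_upperbound[OF lim]) simp
qed

text \<open>A change on F, seen after the shift by g, is a change on - g + F.\<close>

lemma oscillation_shift: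
  fixes V :: "'g::group_add \<Rightarrow> real"
  assumes V: "\<And>h x y. x \<in> X \<Longrightarrow> y \<in> X \<Longrightarrow> (\<And>k. k \<notin> (+) h ` F \<Longrightarrow> x k = y k) \<Longrightarrow> \<bar>\<phi> x - \<phi> y\<bar> \<le> V h"
    and X: "subshift X" and xy: "x \<in> X" "y \<in> X" "\<And>k. k \<notin> F \<Longrightarrow> x k = y k"
  shows "\<bar>\<phi> (shift_map g x) - \<phi> (shift_map g y)\<bar> \<le> V (- g)"
proof (rule V)
  show "shift_map g x \<in> X" "shift_map g y \<in> X" using subshift_shift_map[OF X] xy by auto
  fix k assume k: "k \<notin> (+) (- g) ` F"
  have "g + k \<notin> F"
  proof
    assume "g + k \<in> F"
    then have "- g + (g + k) \<in> (+) (- g) ` F" by (rule imageI)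
    then show False using k by (simp add: add.assoc[symmetric])
  qed
  then show "shift_map g x k = shift_map g y k" unfolding shift_map_def by (rule xy(3))
qed

subsection \<open>The cylinder inequality\<close>

lemma cylinder_inequality:
  fixes X :: "('g::{group_add, countable} \<Rightarrow> 'a::{finite, discrete_topology}) set"
    and \<phi> :: "('g \<Rightarrow> 'a) \<Rightarrow> real"
  assumes am: "amenable TYPE('g)" and X: "subshift X" and F: "finite F"
    and swap: "\<And>x. x \<in> X \<Longrightarrow> (\<And>f. f \<in> F \<Longrightarrow> x f = v f) \<Longrightarrow> override_on x w F \<in> X"
    and sv: "summable_variation X \<phi>" and eq: "equilibrium_state X \<phi> \<mu>"
    and s: "\<And>x. x \<in> X \<Longrightarrow> (\<And>f. f \<in> F \<Longrightarrow> x f = v f) \<Longrightarrow>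
      (\<Sum>\<^sub>\<infinity>g. \<phi> (shift_map g x) - \<phi> (shift_map g (override_on x w F))) \<le> s"
  shows "measure \<mu> {x \<in> X. \<forall>f\<in>F. x f = v f} \<le> exp s * measure \<mu> {x \<in> X. \<forall>f\<in>F. x f = w f}"
proof (rule ccontr)
  define m where "m = measure \<mu> {x \<in> X. \<forall>f\<in>F. x f = v f}"
  define b where "b = measure \<mu> {x \<in> X. \<forall>f\<in>F. x f = w f}"
  assume "\<not> ?thesis"
  then have mb: "exp s * b < m" by (simp add: m_def b_def)
  have b0: "0 \<le> b" by (simp add: b_def)
  have m: "0 < m" using mb b0 by (metis exp_ge_zero le_less_trans mult_nonneg_nonneg)
  have bm: "b < m * exp (- s)" using mb by (simp add: exp_minus field_simps)
  \<comment> \<open>The gap above b makes room for the w that the replacement creates, and a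
    positive \<open>\<beta>\<close> also covers the case b = 0.\<close>
  obtain \<beta> where \<beta>: "b < \<beta>" "\<beta> < m * exp (- s)" using dense[OF bm] by blast
  have \<beta>0: "0 < \<beta>" using b0 \<beta> by simp
  have "ln \<beta> < ln (m * exp (- s))" using \<beta> \<beta>0 by (intro ln_less_cancel_iff[THEN iffD2]) auto
  then have d: "0 < ln m - ln \<beta> - s" using m by (simp add: ln_mult)
  \<comment> \<open>Half of the available gain divided by m + 1: \<open>\<epsilon>\<close> is spent
    once on the sites outside T, and m times because the finite sum over T is only bounded by s +
    \<open>\<epsilon>\<close>.\<close>
  define \<epsilon> where "\<epsilon> = m * (ln m - ln \<beta> - s) / (2 * (m + 1))"
  have \<epsilon>: "0 < \<epsilon>" using d m by (simp add: \<epsilon>_def)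
  have \<epsilon>2: "\<epsilon> < m * (ln m - ln \<beta> - (s + \<epsilon>))"
  proof -
    have "2 * ((m + 1) * \<epsilon>) = m * (ln m - ln \<beta> - s)" using m by (simp add: \<epsilon>_def field_simps)
    moreover have "0 < (m + 1) * \<epsilon>" using m \<epsilon> by simp
    ultimately show ?thesis by (simp add: algebra_simps)
  qed
  obtain \<F> :: "nat \<Rightarrow> 'g set" where fol: "folner_sequence \<F>" using am by (auto simp: amenable_def)
  have \<phi>: "continuous_on X \<phi>" using sv by (simp add: summable_variation_def potential_def)
  have inv: "\<mu> \<in> invariant_measures X" using eq by (simp add: equilibrium_state_def)
  interpret mu: invariant_measure X \<mu> using X inv by (rule invariant_measure.intro)
  have Xne: "X \<noteq> {}" using mu.not_empty by (simp add: mu.space_eq)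
  obtain V :: "'g \<Rightarrow> real" where V: "\<And>h. 0 \<le> V h" "V summable_on UNIV"
    "\<And>h x y. x \<in> X \<Longrightarrow> y \<in> X \<Longrightarrow> (\<And>k. k \<notin> (+) h ` F \<Longrightarrow> x k = y k) \<Longrightarrow> \<bar>\<phi> x - \<phi> y\<bar> \<le> V h"
    using summable_variation_oscillation[OF X Xne sv F] by blast
  obtain T where T: "finite T" "\<And>T'. finite T' \<Longrightarrow> T' \<inter> T = {} \<Longrightarrow> sum V T' \<le> \<epsilon>"
    using summable_on_tail[OF V(2,1) \<epsilon>] by blast
  obtain B where B: "0 \<le> B" "\<And>x. x \<in> X \<Longrightarrow> \<bar>\<phi> x\<bar> \<le> B"
    using bounded_on_closed_shift[OF subshift_closed[OF X] \<phi>] by blast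
  interpret sp: swap_pattern X F v w by (rule swap_pattern.intro[OF X F swap])
  define N where "N = card (sp.conflict 0 - {0})"
  define C where "C = 2 * B * (card T + 1) * (card T)\<^sup>2"
  \<comment> \<open>This bound on p keeps the frequency of w after the replacement below
    \<open>\<beta>\<close>.\<close>
  have b1: "0 < (\<beta> - b) / (real (card (sp.conflict 0)) + 1)" using \<beta> by simp
  obtain p where p: "0 < p" "p < 1" "p < (\<beta> - b) / (real (card (sp.conflict 0)) + 1)"
    and gain: "0 < p * (m * (1 - p) ^ N * (ln m - ln \<beta>) - m * (eta ((1 - p) ^ N) + eta (1 - (1 - p) ^ N))
        - m * p * ((1 - p) ^ N)\<^sup>2) - m * (p * (1 - p) ^ N) * (s + \<epsilon>) - p * \<epsilon> - C * p\<^sup>2"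
    using exists_small_density[OF \<epsilon>2 b1, of N C] by blast
  interpret r: random_swap X \<mu> F v w p using p by unfold_locales
  have fv: "r.freq v = m" and fw: "r.freq w = b"
    by (simp_all add: r.freq_def m_def b_def sp.occurs_def)
  have "b + card (sp.conflict 0) * p \<le> \<beta>"
  proof -
    have "p * (real (card (sp.conflict 0)) + 1) < \<beta> - b" using p(3) by (simp add: pos_less_divide_eq)
    then show ?thesis using p(1) by (simp add: algebra_simps)
  qed
  then have rate: "entropy_rate \<mu> shift_map (fibres \<mu> (\<lambda>x. x 0)) + r.site_gain \<beta>
     \<le> entropy_rate r.\<nu> shift_map (fibres r.\<nu> (\<lambda>x. x 0))"
    using r.entropy_rate_gain[OF fol \<beta>0] fw by simp
  have sT: "(\<Sum>h\<in>T. \<phi> (shift_map (- h) x) - \<phi> (shift_map (- h) (sp.rep {0} x))) \<le> s + \<epsilon>"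
    if x: "x \<in> X" "sp.occurs v x 0" for x
  proof -
    have xv: "\<And>f. f \<in> F \<Longrightarrow> x f = v f" using x(2) by (simp add: sp.occurs_def)
    let ?y = "override_on x w F"
    let ?a = "\<lambda>h. \<phi> (shift_map (- h) x) - \<phi> (shift_map (- h) ?y)"
    have a: "\<bar>?a h\<bar> \<le> V h" for h
    proof -
      have y: "?y \<in> X" using x(1) xv by (rule swap)
      have "\<bar>?a h\<bar> \<le> V (- (- h))"
      proof (rule oscillation_shift[where V = V and F = F, OF _ X x(1) y])
        show "\<bar>\<phi> x - \<phi> y\<bar> \<le> V h" if "x \<in> X" "y \<in> X" "\<And>k. k \<notin> (+) h ` F \<Longrightarrow> x k = y k" for h x y
          using that by (rule V(3))
      qed simp
      then show ?thesis by simp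
    qed
    \<comment> \<open>Inversion of the group matches the shifts by - h of the energy estimate with
      the sum in the assumption.\<close>
    have "infsum ?a UNIV = (\<Sum>\<^sub>\<infinity>g. \<phi> (shift_map g x) - \<phi> (shift_map g ?y))"
      by (rule infsum_reindex_bij_betw[of uminus UNIV UNIV "\<lambda>g. \<phi> (shift_map g x) - \<phi> (shift_map g ?y)"])
        (rule bij_betw_byWitness[of _ uminus], auto)
    also have "\<dots> \<le> s" using s[OF x(1) xv] .
    finally have "infsum ?a UNIV \<le> s" .
    moreover have "\<bar>sum ?a T - infsum ?a UNIV\<bar> \<le> \<epsilon>"
      by (rule sum_le_infsum_tail[OF V(2) a T])
    ultimately have "sum ?a T \<le> s + \<epsilon>" by linarith
    then show ?thesis by (simp only: sp.rep_0)
  qed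
  have energy: "(\<integral>x. \<phi> x \<partial>\<mu>) - m * r.q * (s + \<epsilon>) - p * \<epsilon> - C * p\<^sup>2 \<le> (\<integral>x. \<phi> x \<partial>r.\<nu>)"
    unfolding C_def fv[symmetric]
  proof (rule r.energy_lower_bound[OF \<phi> V(1) _ B T sT])
    show "\<bar>\<phi> x - \<phi> y\<bar> \<le> V h" if "x \<in> X" "y \<in> X" "\<And>k. k \<notin> (+) h ` F \<Longrightarrow> x k = y k" for h x y
      using that by (rule V(3))
  qed
  have q: "r.q = p * (1 - p) ^ N" by (simp add: r.q_def N_def)
  have c: "0 < (1 - p) ^ N" "(1 - p) ^ N \<le> 1" using p by (auto intro: power_le_one)
  have "p * (m * (1 - p) ^ N * (ln m - ln \<beta>) - m * (eta ((1 - p) ^ N) + eta (1 - (1 - p) ^ N))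
        - m * p * ((1 - p) ^ N)\<^sup>2) \<le> r.site_gain \<beta>"
    unfolding r.site_gain_def fv q by (rule entropy_gain_lower_bound[OF m p(1,2) c])
  with rate energy gain have "entropy_rate \<mu> shift_map (fibres \<mu> (\<lambda>x. x 0)) + (\<integral>x. \<phi> x \<partial>\<mu>)
     < entropy_rate r.\<nu> shift_map (fibres r.\<nu> (\<lambda>x. x 0)) + (\<integral>x. \<phi> x \<partial>r.\<nu>)"
    unfolding q by linarith
  moreover have "pressure_of r.\<nu> \<phi> \<le> pressure_of \<mu> \<phi>"
    using eq r.nu_invariant by (simp add: equilibrium_state_def)
  \<comment> \<open>Both entropies are real numbers by \<open>ks_entropy_eq\<close>, so the strict
    inequality persists in \<open>ereal\<close>.\<close>
  ultimately show False
    unfolding pressure_of_def mu.ks_entropy_eq[OF fol] r.nu.ks_entropy_eq[OF fol] by simp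
qed

subsection \<open>From cylinders to Borel sets\<close>

lemma measure_window_le:
  fixes N1 N2 :: "('g::countable \<Rightarrow> 'a::{finite, discrete_topology}) measure"
  assumes fin: "finite_measure N1" "finite_measure N2" and N: "sets N1 = sets borel" "sets N2 = sets borel"
    and K: "finite K" and c: "0 \<le> c"
    and le: "\<And>p. measure N1 {y. \<forall>k\<in>K. y k = p k} \<le> c * measure N2 {y. \<forall>k\<in>K. y k = p k}"
  shows "measure N1 {y. restrict y K \<in> S} \<le> c * measure N2 {y. restrict y K \<in> S}"
proof -
  interpret N1: finite_measure N1 by fact
  interpret N2: finite_measure N2 by fact
  let ?I = "S \<inter> (\<Pi>\<^sub>E k\<in>K. UNIV)"
  let ?C = "\<lambda>p. {y :: 'g \<Rightarrow> 'a. \<forall>k\<in>K. y k = p k}"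
  have "finite (\<Pi>\<^sub>E k\<in>K. (UNIV :: 'a set))" by (rule finite_PiE[OF K]) simp
  then have finI: "finite ?I" by simp
  have eq: "{y. restrict y K \<in> S} = (\<Union>p\<in>?I. ?C p)"
  proof (intro equalityI subsetI)
    fix y assume "y \<in> {y. restrict y K \<in> S}"
    then show "y \<in> (\<Union>p\<in>?I. ?C p)" by (intro UN_I[of "restrict y K"]) auto
  next
    fix y assume "y \<in> (\<Union>p\<in>?I. ?C p)"
    then obtain p where p: "p \<in> S" "p \<in> (\<Pi>\<^sub>E k\<in>K. UNIV)" "\<forall>k\<in>K. y k = p k" by blast
    have "restrict y K = p"
      using p(2,3) by (auto simp: fun_eq_iff restrict_def PiE_def extensional_def)
    then show "y \<in> {y. restrict y K \<in> S}" using p(1) by simp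
  qed
  have C: "?C p \<in> sets borel" for p by (rule borel_open[OF open_cylinder[OF K]])
  have dj: "disjoint_family_on ?C ?I"
  proof -
    have "p = p'" if "p \<in> ?I" "p' \<in> ?I" "y \<in> ?C p" "y \<in> ?C p'" for p p' y
      using that by (intro extensionalityI[of p K p']) (auto simp: PiE_def)
    then show ?thesis unfolding disjoint_family_on_def by blast
  qed
  have "measure N1 {y. restrict y K \<in> S} = (\<Sum>p\<in>?I. measure N1 (?C p))"
    unfolding eq by (rule N1.finite_measure_finite_Union[OF finI _ dj]) (use C N in auto)
  also have "\<dots> \<le> (\<Sum>p\<in>?I. c * measure N2 (?C p))" by (intro sum_mono le)
  also have "\<dots> = c * measure N2 {y. restrict y K \<in> S}"
    unfolding eq sum_distrib_left[symmetric]
    by (subst N2.finite_measure_finite_Union[OF finI _ dj]) (use C N in auto)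
  finally show ?thesis .
qed

text \<open>Enlarging a window turns its events into events of the larger one, so it is enough to
  know the inequality for windows containing K0. This permits hypotheses that hold only for
  sufficiently small cylinders.\<close>

lemma measure_le_of_windows:
  fixes N1 N2 :: "('g::countable \<Rightarrow> 'a::{finite, discrete_topology}) measure"
  assumes fin: "finite_measure N1" "finite_measure N2" and N: "sets N1 = sets borel" "sets N2 = sets borel"
    and K0: "finite K0" and c: "0 \<le> c" and A: "A \<in> sets borel"
    and le: "\<And>K p. finite K \<Longrightarrow> K0 \<subseteq> K \<Longrightarrow>
      measure N1 {y. \<forall>k\<in>K. y k = p k} \<le> c * measure N2 {y. \<forall>k\<in>K. y k = p k}"
  shows "measure N1 A \<le> c * measure N2 A"
proof (rule field_le_epsilon)
  interpret N1: finite_measure N1 by fact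
  interpret N2: finite_measure N2 by fact
  fix e :: real assume e: "0 < e"
  define d where "d = e / (c + 1)"
  have d: "0 < d" using e c by (simp add: d_def)
  have "d * (c + 1) = e" using c by (simp add: d_def)
  then have dc: "d + c * d = e" by (simp add: algebra_simps)
  obtain K S where K: "finite K" and KS: "measure N1 (sym_diff A {x. restrict x K \<in> S}) < d"
    "measure N2 (sym_diff A {x. restrict x K \<in> S}) < d"
    using approximate_by_window[OF fin N A d] by blast
  let ?C = "{x :: 'g \<Rightarrow> 'a. restrict x K \<in> S}"
  have C: "?C \<in> sets borel" using K by (rule sets_borel_restrict)
  have "?C = {x. restrict x (K \<union> K0) \<in> {y. restrict y K \<in> S}}"
    by (simp add: Int_absorb1 Int_commute)
  moreover have "measure N1 {x. restrict x (K \<union> K0) \<in> {y. restrict y K \<in> S}}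
      \<le> c * measure N2 {x. restrict x (K \<union> K0) \<in> {y. restrict y K \<in> S}}"
    using K K0 by (intro measure_window_le[OF fin N _ c] le) auto
  ultimately have 1: "measure N1 ?C \<le> c * measure N2 ?C" by simp
  have "measure N1 A \<le> measure N1 (?C \<union> sym_diff A ?C)"
    by (rule N1.finite_measure_mono) (use A C N in auto)
  also have "\<dots> \<le> measure N1 ?C + measure N1 (sym_diff A ?C)"
    by (rule measure_Un_le) (use A C N in auto)
  finally have 2: "measure N1 A \<le> measure N1 ?C + d" using KS by simp
  have "measure N2 ?C \<le> measure N2 (A \<union> sym_diff A ?C)"
    by (rule N2.finite_measure_mono) (use A C N in auto)
  also have "\<dots> \<le> measure N2 A + measure N2 (sym_diff A ?C)"
    by (rule measure_Un_le) (use A C N in auto)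
  finally have "measure N2 ?C \<le> measure N2 A + d" using KS by simp
  then have "c * measure N2 ?C \<le> c * (measure N2 A + d)" using c by (rule mult_left_mono)
  then show "measure N1 A \<le> c * measure N2 A + e" using 1 2 dc by (simp add: algebra_simps)
qed

section \<open>The energy of a swap and local domination\<close>

lemma override_restrict: "override_on (restrict x (- F)) t F = override_on x t F"
  by (auto simp: override_on_def fun_eq_iff)

locale swap_equilibrium =
  fixes X :: "('g::{group_add, countable} \<Rightarrow> 'a::{finite, discrete_topology}) set"
    and F :: "'g set" and v w :: "'g \<Rightarrow> 'a"
    and \<phi> :: "('g \<Rightarrow> 'a) \<Rightarrow> real" and \<mu> :: "('g \<Rightarrow> 'a) measure"
  assumes am: "amenable TYPE('g)" and X: "subshift X" and F: "finite F"
    and v: "v \<in> extensional F" and w: "w \<in> extensional F"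
    and swap: "\<And>x. x \<in> X \<Longrightarrow> (\<And>f. f \<in> F \<Longrightarrow> x f = v f) \<Longrightarrow> override_on x w F \<in> X"
    and sv: "summable_variation X \<phi>" and eq: "equilibrium_state X \<phi> \<mu>"
begin

sublocale invariant_measure X \<mu>
  using X eq by (auto intro!: invariant_measure.intro simp: equilibrium_state_def)

abbreviation ov :: "('g \<Rightarrow> 'a) \<Rightarrow> 'g \<Rightarrow> 'a" where "ov x \<equiv> override_on x w F"
abbreviation vo :: "('g \<Rightarrow> 'a) \<Rightarrow> 'g \<Rightarrow> 'a" where "vo x \<equiv> override_on x v F"
abbreviation \<xi> :: "('g \<Rightarrow> 'a) \<Rightarrow> 'g \<Rightarrow> 'a" where "\<xi> \<equiv> swap_map X F v w"

text \<open>For x in [v] this is the exponent of the claim at the point \<open>ov x\<close>,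
  expressed on the side of v, where the swap is always carried out.\<close>

definition \<psi> :: "('g \<Rightarrow> 'a) \<Rightarrow> real" where
  "\<psi> x = (\<Sum>\<^sub>\<infinity>g. \<phi> (shift_map g x) - \<phi> (shift_map g (ov x)))"

definition Xv :: "('g \<Rightarrow> 'a) set" where "Xv = {x \<in> X. \<forall>f\<in>F. x f = v f}"
definition Xw :: "('g \<Rightarrow> 'a) set" where "Xw = {x \<in> X. \<forall>f\<in>F. x f = w f}"
text \<open>The points of [w] that the swap pairs with points of [v]. The extender set of w may be
  the larger one, and the other points of [w] are fixed.\<close>

definition W :: "('g \<Rightarrow> 'a) set" where "W = {x \<in> Xw. vo x \<in> X}"

lemma phi_continuous: "continuous_on X \<phi>"
  using sv by (simp add: summable_variation_def potential_def)

lemma phi_measurable: "\<phi> \<in> borel_measurable \<mu>"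
  by (rule continuous_on_measurable[OF phi_continuous])

lemma oscillation:
  obtains V :: "'g \<Rightarrow> real" where "\<And>h. 0 \<le> V h" "V summable_on UNIV"
    "\<And>x y g. x \<in> X \<Longrightarrow> y \<in> X \<Longrightarrow> (\<And>k. k \<notin> F \<Longrightarrow> x k = y k) \<Longrightarrow>
      \<bar>\<phi> (shift_map g x) - \<phi> (shift_map g y)\<bar> \<le> V g"
proof -
  have "X \<noteq> {}" using not_empty by (simp add: space_eq)
  then obtain V :: "'g \<Rightarrow> real" where V: "\<And>h. 0 \<le> V h" "V summable_on UNIV"
    "\<And>h x y. x \<in> X \<Longrightarrow> y \<in> X \<Longrightarrow> (\<And>k. k \<notin> (+) h ` F \<Longrightarrow> x k = y k) \<Longrightarrow> \<bar>\<phi> x - \<phi> y\<bar> \<le> V h"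
    using summable_variation_oscillation[OF X _ sv F] by blast
  have bij: "bij_betw uminus (UNIV :: 'g set) UNIV"
    by (rule bij_betw_byWitness[of _ uminus]) auto
  have "(\<lambda>g. V (- g)) summable_on UNIV"
    using V(2) summable_on_reindex_bij_betw[OF bij, of V] by simp
  moreover have "\<bar>\<phi> (shift_map g x) - \<phi> (shift_map g y)\<bar> \<le> V (- g)"
    if "x \<in> X" "y \<in> X" "\<And>k. k \<notin> F \<Longrightarrow> x k = y k" for x y g
  proof (rule oscillation_shift[where V = V and F = F, OF _ X that(1,2)])
    show "\<bar>\<phi> x - \<phi> y\<bar> \<le> V h" if "x \<in> X" "y \<in> X" "\<And>k. k \<notin> (+) h ` F \<Longrightarrow> x k = y k" for h x y
      using that by (rule V(3))
    show "x k = y k" if "k \<notin> F" for k using \<open>\<And>k. k \<notin> F \<Longrightarrow> x k = y k\<close> that .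
  qed
  ultimately show thesis using V(1) that[of "\<lambda>g. V (- g)"] by blast
qed

lemma Xv_ov: "x \<in> Xv \<Longrightarrow> ov x \<in> X"
  unfolding Xv_def by (intro swap) auto

text \<open>Truncating the sum to T costs e / 3 for each of the two points, uniformly because V does
  not depend on them. The remaining finite sum is uniformly continuous and takes the last
  third.\<close>

lemma psi_uniform:
  assumes e: "0 < e"
  obtains K where "finite K" "F \<subseteq> K"
    "\<And>x y. x \<in> Xv \<Longrightarrow> y \<in> Xv \<Longrightarrow> (\<forall>k\<in>K. x k = y k) \<Longrightarrow> \<bar>\<psi> x - \<psi> y\<bar> \<le> e"
proof -
  obtain V :: "'g \<Rightarrow> real" where V: "\<And>h. 0 \<le> V h" "V summable_on UNIV"
    "\<And>x y g. x \<in> X \<Longrightarrow> y \<in> X \<Longrightarrow> (\<And>k. k \<notin> F \<Longrightarrow> x k = y k) \<Longrightarrow>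
      \<bar>\<phi> (shift_map g x) - \<phi> (shift_map g y)\<bar> \<le> V g"
    using oscillation by blast
  have e3: "0 < e / 3" using e by simp
  obtain T where T: "finite T" "\<And>T'. finite T' \<Longrightarrow> T' \<inter> T = {} \<Longrightarrow> sum V T' \<le> e / 3"
    using summable_on_tail[OF V(2,1) e3] by blast
  define d where "d = e / (6 * (real (card T) + 1))"
  have d: "0 < d" using e by (simp add: d_def)
  have dT: "real (card T) * (2 * d) \<le> e / 3" using e by (simp add: d_def field_simps)
  obtain K where K: "finite K"
    "\<And>x y. x \<in> X \<Longrightarrow> y \<in> X \<Longrightarrow> (\<forall>h\<in>K. x h = y h) \<Longrightarrow> \<bar>\<phi> x - \<phi> y\<bar> < d"
    using uniformly_continuous_cylinder[OF subshift_closed[OF X] phi_continuous d] by blast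
  let ?a = "\<lambda>x g. \<phi> (shift_map g x) - \<phi> (shift_map g (ov x))"
  have tail: "\<bar>sum (?a x) T - \<psi> x\<bar> \<le> e / 3" if x: "x \<in> Xv" for x
    unfolding \<psi>_def
  proof (rule sum_le_infsum_tail[OF V(2) _ T])
    show "\<bar>?a x g\<bar> \<le> V g" for g
      by (rule V(3)) (use x Xv_ov[OF x] in \<open>auto simp: Xv_def override_on_def\<close>)
  qed
  show thesis
  proof (rule that[of "F \<union> (\<Union>g\<in>T. (+) g ` K)"])
    show "finite (F \<union> (\<Union>g\<in>T. (+) g ` K))" using F T K by auto
    fix x y assume x: "x \<in> Xv" and y: "y \<in> Xv" and xy: "\<forall>k\<in>F \<union> (\<Union>g\<in>T. (+) g ` K). x k = y k"
    have xX: "x \<in> X" "y \<in> X" using x y by (auto simp: Xv_def)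
    have near: "\<bar>?a x g - ?a y g\<bar> \<le> 2 * d" if g: "g \<in> T" for g
    proof -
      have gk: "\<forall>k\<in>K. x (g + k) = y (g + k)" using xy g by blast
      have "\<bar>\<phi> (shift_map g x) - \<phi> (shift_map g y)\<bar> < d"
        using gk by (intro K(2) subshift_shift_map[OF X] xX) (simp add: shift_map_def)
      moreover have "\<bar>\<phi> (shift_map g (ov x)) - \<phi> (shift_map g (ov y))\<bar> < d"
        using gk by (intro K(2) subshift_shift_map[OF X] Xv_ov x y) (simp add: shift_map_def override_on_def)
      ultimately show ?thesis by linarith
    qed
    have "\<bar>sum (?a x) T - sum (?a y) T\<bar> \<le> (\<Sum>g\<in>T. \<bar>?a x g - ?a y g\<bar>)"
      unfolding sum_subtractf[symmetric] by (rule sum_abs)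
    also have "\<dots> \<le> (\<Sum>g\<in>T. 2 * d)" by (intro sum_mono near)
    also have "\<dots> \<le> e / 3" using dT by simp
    finally show "\<bar>\<psi> x - \<psi> y\<bar> \<le> e" using tail[OF x] tail[OF y] by linarith
  qed simp
qed

lemma override_measurable: "(\<lambda>x. override_on x t F) \<in> borel_measurable \<mu>"
proof (rule measurable_shiftI)
  fix h a
  show "{x \<in> space \<mu>. override_on x t F h = a} \<in> sets \<mu>"
  proof (cases "h \<in> F")
    case True
    then have "{x \<in> space \<mu>. override_on x t F h = a} = (if t h = a then space \<mu> else {})" by auto
    then show ?thesis by simp
  next
    case False
    then show ?thesis using sets_coord[of h a] by (simp add: space_eq)
  qed
qed

text \<open>For a window K containing K0, the pattern u before the swap and the pattern u' after it
  differ only on F, and pasting u' on K into a point showing u is the same as pasting w on F. So the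
  cylinder inequality applies to all these windows with one s, and from windows it passes to Borel
  sets.\<close>

lemma local_domination:
  assumes x0: "x0 \<in> Xv" and K0: "finite K0" "F \<subseteq> K0" and A: "A \<in> sets borel"
    and s: "\<And>x. x \<in> Xv \<Longrightarrow> (\<forall>k\<in>K0. x k = x0 k) \<Longrightarrow> \<psi> x \<le> s"
  shows "prob {x \<in> X. (\<forall>k\<in>K0. x k = x0 k) \<and> ov x \<in> A}
    \<le> exp s * prob {y \<in> X. (\<forall>k\<in>K0. y k = ov x0 k) \<and> y \<in> A}"
proof -
  define U where "U = {x \<in> X. \<forall>k\<in>K0. x k = x0 k}"
  define U' where "U' = {x \<in> X. \<forall>k\<in>K0. x k = ov x0 k}"
  have U: "U \<in> sets \<mu>" "U' \<in> sets \<mu>" unfolding U_def U'_def using K0(1) by (rule sets_cylinder)+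
  define N1 where "N1 = distr (restrict_space \<mu> U) borel ov"
  define N2 where "N2 = distr (restrict_space \<mu> U') borel (\<lambda>x. x)"
  have ovU: "ov \<in> borel_measurable (restrict_space \<mu> U)"
    by (rule measurable_restrict_space1[OF override_measurable])
  have idU: "(\<lambda>x. x) \<in> borel_measurable (restrict_space \<mu> U')"
    by (rule measurable_restrict_space1[OF id_measurable])
  have fin: "finite_measure N1" "finite_measure N2"
    unfolding N1_def N2_def using U
    by (auto intro!: finite_measure.finite_measure_distr finite_measure_restrict_space ovU idU)
  have N: "sets N1 = sets borel" "sets N2 = sets borel" by (simp_all add: N1_def N2_def)
  have Usub: "U \<subseteq> X" "U' \<subseteq> X" by (auto simp: U_def U'_def)
  have m1: "measure N1 C = prob {x \<in> U. ov x \<in> C}" if "C \<in> sets borel" for C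
  proof -
    have "measure N1 C = measure (restrict_space \<mu> U) (ov -` C \<inter> space (restrict_space \<mu> U))"
      unfolding N1_def by (rule measure_distr[OF ovU that])
    also have "ov -` C \<inter> space (restrict_space \<mu> U) = {x \<in> U. ov x \<in> C}"
      using Usub by (auto simp: space_restrict_space space_eq)
    also have "measure (restrict_space \<mu> U) {x \<in> U. ov x \<in> C} = prob {x \<in> U. ov x \<in> C}"
      using U by (intro measure_restrict_space) auto
    finally show ?thesis .
  qed
  have m2: "measure N2 C = prob {x \<in> U'. x \<in> C}" if "C \<in> sets borel" for C
  proof -
    have "measure N2 C = measure (restrict_space \<mu> U') ((\<lambda>x. x) -` C \<inter> space (restrict_space \<mu> U'))"
      unfolding N2_def by (rule measure_distr[OF idU that])
    also have "(\<lambda>x. x) -` C \<inter> space (restrict_space \<mu> U') = {x \<in> U'. x \<in> C}"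
      using Usub by (auto simp: space_restrict_space space_eq)
    also have "measure (restrict_space \<mu> U') {x \<in> U'. x \<in> C} = prob {x \<in> U'. x \<in> C}"
      using U by (intro measure_restrict_space) auto
    finally show ?thesis .
  qed
  have x0v: "\<And>f. f \<in> F \<Longrightarrow> x0 f = v f" using x0 by (simp add: Xv_def)
  have "measure N1 A \<le> exp s * measure N2 A"
  proof (rule measure_le_of_windows[OF fin N K0(1) _ A])
    fix K p assume K: "finite K" "K0 \<subseteq> K"
    let ?C = "{y :: 'g \<Rightarrow> 'a. \<forall>k\<in>K. y k = p k}"
    have C: "?C \<in> sets borel" by (rule borel_open[OF open_cylinder[OF K(1)]])
    show "measure N1 ?C \<le> exp s * measure N2 ?C"
    \<comment> \<open>A pattern that contradicts \<open>ov x0\<close> on K0 is never produced from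
      points of U, so its mass under N1 is 0.\<close>
    proof (cases "\<forall>k\<in>K0. p k = ov x0 k")
      case False
      then obtain k where k: "k \<in> K0" "p k \<noteq> ov x0 k" by blast
      have empty: "{x \<in> U. ov x \<in> ?C} = {}"
      proof -
        have "ov x k = ov x0 k" if "x \<in> U" for x using that k(1) by (auto simp: U_def override_on_def)
        then show ?thesis using k K(2) by fastforce
      qed
      then have "measure N1 ?C = 0" unfolding m1[OF C] empty by simp
      then show ?thesis by simp
    next
      case True
      \<comment> \<open>p prescribes the symbols after the swap: u is the pattern before it, and u'
        gives p back on K.\<close>
      define u where "u = vo p"
      define u' where "u' = ov u"
      have FK: "F \<subseteq> K" using K0(2) K(2) by blast
      have u_x0: "u k = x0 k" if "k \<in> K0" for k
        using True that x0v by (auto simp: u_def override_on_def)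
      have u'_p: "u' k = p k" if "k \<in> K" for k
      proof (cases "k \<in> F")
        case kF: True
        then have "p k = w k" using True K0(2) by auto
        then show ?thesis using kF by (simp add: u'_def)
      qed (simp add: u'_def u_def)
      have over: "override_on x u' K = ov x" if "\<And>k. k \<in> K \<Longrightarrow> x k = u k" for x
        using that FK by (auto simp: override_on_def u'_def fun_eq_iff)
      have uv: "x \<in> Xv" if "x \<in> X" "\<And>k. k \<in> K \<Longrightarrow> x k = u k" for x
        unfolding Xv_def
      proof (intro CollectI conjI that(1) ballI)
        fix f assume f: "f \<in> F"
        then have "f \<in> K" "f \<in> K0" using FK K0(2) by blast+
        then show "x f = v f" using that(2)[of f] u_x0[of f] x0v[OF f] by simp
      qed
      have "prob {x \<in> X. \<forall>k\<in>K. x k = u k} \<le> exp s * prob {x \<in> X. \<forall>k\<in>K. x k = u' k}"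
      proof (rule cylinder_inequality[OF am X K(1) _ sv eq])
        fix x assume x: "x \<in> X" "\<And>k. k \<in> K \<Longrightarrow> x k = u k"
        have xv: "x \<in> Xv" by (rule uv[OF x])
        have ovx: "override_on x u' K = ov x" by (rule over) (rule x(2))
        show "override_on x u' K \<in> X" unfolding ovx by (rule Xv_ov[OF xv])
        have "\<psi> x \<le> s" by (rule s[OF xv]) (use x(2) K(2) u_x0 in auto)
        then show "(\<Sum>\<^sub>\<infinity>g. \<phi> (shift_map g x) - \<phi> (shift_map g (override_on x u' K))) \<le> s"
          by (simp only: ovx \<psi>_def)
      qed
      moreover have "{x \<in> U. ov x \<in> ?C} = {x \<in> X. \<forall>k\<in>K. x k = u k}"
      proof (intro equalityI subsetI)
        fix x assume "x \<in> {x \<in> U. ov x \<in> ?C}"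
        then have x: "x \<in> X" "\<And>k. k \<in> K0 \<Longrightarrow> x k = x0 k" "\<And>k. k \<in> K \<Longrightarrow> ov x k = p k"
          by (auto simp: U_def)
        have "x k = u k" if "k \<in> K" for k
        proof (cases "k \<in> F")
          case kF: True
          then have "k \<in> K0" using K0(2) by blast
          then show ?thesis using x(2)[of k] u_x0[of k] by simp
        next
          case False
          then show ?thesis using x(3)[OF that] by (simp add: u_def)
        qed
        then show "x \<in> {x \<in> X. \<forall>k\<in>K. x k = u k}" using x(1) by blast
      next
        fix x assume "x \<in> {x \<in> X. \<forall>k\<in>K. x k = u k}"
        then have x: "x \<in> X" "\<And>k. k \<in> K \<Longrightarrow> x k = u k" by auto
        have "x \<in> U" unfolding U_def using x u_x0 K(2) by auto
        moreover have "ov x k = p k" if "k \<in> K" for k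
          using over[OF x(2)] u'_p[OF that] that by (metis override_on_apply_in)
        ultimately show "x \<in> {x \<in> U. ov x \<in> ?C}" by simp
      qed
      moreover have "{x \<in> U'. x \<in> ?C} = {x \<in> X. \<forall>k\<in>K. x k = u' k}"
        using u'_p True K(2) unfolding U'_def by auto
      ultimately show ?thesis unfolding m1[OF C] m2[OF C] by simp
    qed
  qed simp
  then show ?thesis unfolding m1[OF A] m2[OF A] U_def U'_def by simp
qed

end

section \<open>Densities, images under involutions and measurability of sums\<close>

lemma ennreal_le_exp_epsilon:
  fixes a I :: ennreal
  assumes le: "\<And>e. 0 < e \<Longrightarrow> a \<le> ennreal (exp e) * I"
  shows "a \<le> I"
proof (rule tendsto_lowerbound)
  have "((\<lambda>e::real. ennreal (exp e)) \<longlongrightarrow> ennreal (exp 0)) (at_right 0)"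
    by (intro tendsto_intros)
  then have "((\<lambda>e::real. ennreal (exp e) * I) \<longlongrightarrow> ennreal (exp 0) * I) (at_right 0)"
    by (rule tendsto_mult_ennreal[OF _ tendsto_const]) auto
  then show "((\<lambda>e::real. ennreal (exp e) * I) \<longlongrightarrow> I) (at_right 0)" by simp
  show "\<forall>\<^sub>F e::real in at_right 0. a \<le> ennreal (exp e) * I"
    using le unfolding eventually_at_right_field by (intro exI[of _ 1]) auto
qed simp

text \<open>The index type is countable, so the unordered sum is a limit of the partial sums along
  an enumeration.\<close>

lemma borel_measurable_infsum_dominated:
  fixes a :: "'i::countable \<Rightarrow> 'x \<Rightarrow> real"
  assumes a: "\<And>i. a i \<in> borel_measurable M"
    and sm: "\<And>x. x \<in> space M \<Longrightarrow> (\<lambda>i. a i x) summable_on UNIV"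
  shows "(\<lambda>x. \<Sum>\<^sub>\<infinity>i. a i x) \<in> borel_measurable M"
proof -
  define E where "E n = {i :: 'i. to_nat i < n}" for n
  have E: "finite (E n)" for n
    by (rule inj_on_finite[of to_nat _ "{..<n}"]) (auto simp: E_def)
  have lim: "filterlim E (finite_subsets_at_top UNIV) sequentially"
    unfolding filterlim_iff eventually_finite_subsets_at_top
  proof (intro allI impI)
    fix P :: "'i set \<Rightarrow> bool" assume "\<exists>Y. finite Y \<and> Y \<subseteq> UNIV \<and> (\<forall>Z. finite Z \<and> Y \<subseteq> Z \<and> Z \<subseteq> UNIV \<longrightarrow> P Z)"
    then obtain Y where Y: "finite Y" and PY: "\<forall>Z. finite Z \<and> Y \<subseteq> Z \<and> Z \<subseteq> UNIV \<longrightarrow> P Z"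
      by (elim exE conjE)
    obtain N where N: "\<And>y. y \<in> Y \<Longrightarrow> to_nat y < N"
      using finite_nat_set_iff_bounded[of "to_nat ` Y"] Y by auto
    have "P (E n)" if "N \<le> n" for n
    proof -
      have "Y \<subseteq> E n" using N that by (auto simp: E_def intro: less_le_trans)
      then show ?thesis using PY E by simp
    qed
    then show "\<forall>\<^sub>F n in sequentially. P (E n)" unfolding eventually_sequentially by blast
  qed
  show ?thesis
  proof (rule borel_measurable_LIMSEQ_real)
    show "(\<lambda>n. \<Sum>i\<in>E n. a i x) \<longlonglongrightarrow> (\<Sum>\<^sub>\<infinity>i. a i x)" if "x \<in> space M" for x
      by (rule filterlim_compose[OF infsum_tendsto[OF sm[OF that]] lim])
    show "(\<lambda>x. \<Sum>i\<in>E n. a i x) \<in> borel_measurable M" for n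
      by (intro borel_measurable_sum a)
  qed
qed

text \<open>On the set where the density exceeds f, the two integrals would differ strictly unless
  the set is null. The strict comparison needs the smaller integral to be finite, hence the
  assumption on f.\<close>

lemma RN_deriv_le:
  assumes "sigma_finite_measure M" and ac: "absolutely_continuous M N" and sets: "sets N = sets M"
    and f: "f \<in> borel_measurable M" and fin: "(\<integral>\<^sup>+x. f x \<partial>M) \<noteq> \<infinity>"
    and le: "\<And>A. A \<in> sets M \<Longrightarrow> emeasure N A \<le> (\<integral>\<^sup>+x. f x * indicator A x \<partial>M)"
  shows "AE x in M. RN_deriv M N x \<le> f x"
proof -
  interpret sigma_finite_measure M by fact
  let ?R = "RN_deriv M N"
  define A where "A = {x \<in> space M. f x < ?R x}"
  have A: "A \<in> sets M" unfolding A_def using f by measurable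
  have R: "emeasure N A = (\<integral>\<^sup>+x. ?R x * indicator A x \<partial>M)"
    using emeasure_density[of ?R M A] density_RN_deriv[OF ac sets] A by simp
  have "AE x in M. ?R x * indicator A x \<le> f x * indicator A x"
  proof (rule ccontr)
    assume n: "\<not> (AE x in M. ?R x * indicator A x \<le> f x * indicator A x)"
    have "(\<integral>\<^sup>+x. f x * indicator A x \<partial>M) < (\<integral>\<^sup>+x. ?R x * indicator A x \<partial>M)"
    proof (rule nn_integral_less[OF _ _ _ _ n])
      have "(\<integral>\<^sup>+x. f x * indicator A x \<partial>M) \<le> (\<integral>\<^sup>+x. f x \<partial>M)"
        by (intro nn_integral_mono) (simp add: indicator_def)
      then show "(\<integral>\<^sup>+x. f x * indicator A x \<partial>M) \<noteq> \<infinity>" using fin by (auto simp: top_unique)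
      show "AE x in M. f x * indicator A x \<le> ?R x * indicator A x"
        by (rule AE_I2) (auto simp: A_def indicator_def)
    qed (use f A in measurable)
    then show False using le[OF A] R by simp
  qed
  then show ?thesis
  proof (rule AE_mp[OF _ AE_I2], intro impI)
    fix x assume x: "x \<in> space M" "?R x * indicator A x \<le> f x * indicator A x"
    show "?R x \<le> f x"
    proof (rule ccontr)
      assume "\<not> ?R x \<le> f x"
      then have "x \<in> A" using x(1) by (simp add: A_def)
      then show False using x(2) \<open>\<not> ?R x \<le> f x\<close> by simp
    qed
  qed
qed

text \<open>For an involution images are preimages.\<close>

lemma image_measure_eq_distr:
  assumes f: "f \<in> measurable M M" and inv: "\<And>x. x \<in> space M \<Longrightarrow> f (f x) = x"
  shows "image_measure M f = distr M M f"
  unfolding image_measure_def distr_def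
proof (rule measure_of_eq)
  show "sets M \<subseteq> Pow (space M)" by (rule sets.space_closed)
  fix A assume "A \<in> sigma_sets (space M) (sets M)"
  then have "A \<subseteq> space M" using sets.sigma_sets_eq[of M] sets.sets_into_space by blast
  then have "f ` A = f -` A \<inter> space M"
    using inv measurable_space[OF f] by (auto simp: subset_iff image_iff) (metis+)
  then show "emeasure M (f ` A) = emeasure M (f -` A \<inter> space M)" by simp
qed

section \<open>The swap as an involution and the bound for its density\<close>

context swap_equilibrium
begin

lemma cylinder_v: "cylinder X F v = Xv" and cylinder_w: "cylinder X F w = Xw"
proof -
  have "restrict x F = t \<longleftrightarrow> (\<forall>f\<in>F. x f = t f)" if "t \<in> extensional F" for x t
    using that by (auto simp: fun_eq_iff restrict_def extensional_def)
  then show "cylinder X F v = Xv" "cylinder X F w = Xw"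
    using v w unfolding cylinder_def Xv_def Xw_def by blast+
qed

lemma vo_ov: "x \<in> Xv \<Longrightarrow> vo (ov x) = x" and ov_vo: "x \<in> Xw \<Longrightarrow> ov (vo x) = x"
  by (auto simp: override_on_def fun_eq_iff Xv_def Xw_def)

lemma ov_W: "x \<in> Xv \<Longrightarrow> ov x \<in> W"
  using Xv_ov vo_ov by (auto simp: W_def Xw_def Xv_def)

lemma vo_Xv: "x \<in> W \<Longrightarrow> vo x \<in> Xv"
  by (auto simp: W_def Xv_def)

lemma swap_Xv: "x \<in> Xv \<Longrightarrow> \<xi> x = ov x"
  using Xv_ov unfolding swap_map_def cylinder_v override_restrict by simp

text \<open>\<open>swap_map\<close> tests [v] first. A point of W that also lies in [v] forces v = w
  on F, and then both branches are the identity.\<close>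

lemma swap_W: "x \<in> W \<Longrightarrow> \<xi> x = vo x"
proof (cases "x \<in> Xv")
  case True
  assume "x \<in> W"
  then have "ov x = vo x" using True by (auto simp: W_def Xw_def Xv_def override_on_def fun_eq_iff)
  then show ?thesis using swap_Xv[OF True] by simp
next
  case False
  assume "x \<in> W"
  then show ?thesis
    using False unfolding swap_map_def cylinder_v cylinder_w override_restrict by (simp add: W_def)
qed

lemma swap_other: "x \<in> X \<Longrightarrow> x \<notin> Xv \<Longrightarrow> x \<notin> W \<Longrightarrow> \<xi> x = x"
  unfolding swap_map_def cylinder_v cylinder_w override_restrict by (auto simp: W_def)

lemma swap_in: "x \<in> X \<Longrightarrow> \<xi> x \<in> X"
proof -
  assume x: "x \<in> X"
  consider "x \<in> Xv" | "x \<in> W" | "x \<notin> Xv" "x \<notin> W" by blast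
  then show "\<xi> x \<in> X"
  proof cases
    case 1 then show ?thesis using swap_Xv[OF 1] Xv_ov[OF 1] by simp
  next
    case 2 then show ?thesis using swap_W[OF 2] by (simp add: W_def)
  next
    case 3 then show ?thesis using swap_other[OF x 3] x by simp
  qed
qed

lemma swap_swap: "x \<in> X \<Longrightarrow> \<xi> (\<xi> x) = x"
proof -
  assume x: "x \<in> X"
  consider "x \<in> Xv" | "x \<in> W" | "x \<notin> Xv" "x \<notin> W" by blast
  then show "\<xi> (\<xi> x) = x"
  proof cases
    case 1 then show ?thesis by (simp only: swap_Xv swap_W[OF ov_W] vo_ov)
  next
    case 2
    then have "x \<in> Xw" by (simp add: W_def)
    then show ?thesis using 2 by (simp only: swap_W swap_Xv[OF vo_Xv] ov_vo)
  next
    case 3 show ?thesis by (simp only: swap_other[OF x 3])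
  qed
qed

lemma swap_off: "x \<in> X \<Longrightarrow> k \<notin> F \<Longrightarrow> \<xi> x k = x k"
proof -
  assume x: "x \<in> X" and k: "k \<notin> F"
  consider "x \<in> Xv" | "x \<in> W" | "x \<notin> Xv" "x \<notin> W" by blast
  then show "\<xi> x k = x k"
  proof cases
    case 1 then show ?thesis using k by (simp add: swap_Xv)
  next
    case 2 then show ?thesis using k by (simp add: swap_W)
  next
    case 3 show ?thesis by (simp only: swap_other[OF x 3])
  qed
qed

lemma sets_Xv: "Xv \<in> sets \<mu>" and sets_Xw: "Xw \<in> sets \<mu>" and sets_W: "W \<in> sets \<mu>"
proof -
  show "Xv \<in> sets \<mu>" and Xw: "Xw \<in> sets \<mu>"
    unfolding Xv_def Xw_def by (rule sets_cylinder[OF F])+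
  have "W = Xw \<inter> (vo -` X \<inter> space \<mu>)" by (auto simp: W_def Xw_def space_eq)
  then show "W \<in> sets \<mu>" using Xw measurable_sets[OF override_measurable X_borel] by auto
qed

lemma swap_measurable: "\<xi> \<in> measurable \<mu> \<mu>"
proof (rule measurable_intoI)
  have "(\<lambda>x. if x \<in> Xv then ov x else if x \<in> W then vo x else x) \<in> borel_measurable \<mu>"
    by (intro measurable_If_set override_measurable id_measurable) (simp_all add: sets_Xv sets_W)
  moreover have "\<xi> x = (if x \<in> Xv then ov x else if x \<in> W then vo x else x)" if "x \<in> space \<mu>" for x
    using that swap_Xv swap_W swap_other by (simp add: space_eq)
  ultimately show "\<xi> \<in> borel_measurable \<mu>" by (simp cong: measurable_cong)
qed (simp add: space_eq swap_in)

definition \<Psi> :: "('g \<Rightarrow> 'a) \<Rightarrow> real" where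
  "\<Psi> x = (\<Sum>\<^sub>\<infinity>g. \<phi> (shift_map g (\<xi> x)) - \<phi> (shift_map g x))"

lemma Psi_W: "y \<in> W \<Longrightarrow> \<Psi> y = \<psi> (vo y)"
  unfolding \<Psi>_def \<psi>_def by (simp add: swap_W ov_vo W_def)

lemma Psi_fixed: "\<xi> y = y \<Longrightarrow> \<Psi> y = 0"
  by (simp add: \<Psi>_def)

lemma Psi_measurable: "\<Psi> \<in> borel_measurable \<mu>"
  and Psi_bounded: "\<exists>B. \<forall>x\<in>X. \<Psi> x \<le> B"
proof -
  obtain V :: "'g \<Rightarrow> real" where V: "\<And>h. 0 \<le> V h" "V summable_on UNIV"
    "\<And>x y g. x \<in> X \<Longrightarrow> y \<in> X \<Longrightarrow> (\<And>k. k \<notin> F \<Longrightarrow> x k = y k) \<Longrightarrow>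
      \<bar>\<phi> (shift_map g x) - \<phi> (shift_map g y)\<bar> \<le> V g"
    using oscillation by blast
  have bound: "\<bar>\<phi> (shift_map g (\<xi> x)) - \<phi> (shift_map g x)\<bar> \<le> V g" if "x \<in> X" for g x
    using that by (intro V(3) swap_in swap_off)
  show "\<Psi> \<in> borel_measurable \<mu>"
    unfolding \<Psi>_def
  proof (rule borel_measurable_infsum_dominated)
    show "(\<lambda>x. \<phi> (shift_map g (\<xi> x)) - \<phi> (shift_map g x)) \<in> borel_measurable \<mu>" for g
      by (intro borel_measurable_diff
        measurable_compose[OF measurable_compose[OF swap_measurable shift_map_measurable] phi_measurable]
        measurable_compose[OF shift_map_measurable phi_measurable])
    show "(\<lambda>g. \<phi> (shift_map g (\<xi> x)) - \<phi> (shift_map g x)) summable_on UNIV" if "x \<in> space \<mu>" for x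
      by (rule summable_on_dominated[OF V(2) bound]) (use that in \<open>simp add: space_eq\<close>)
  qed
  have "\<Psi> x \<le> infsum V UNIV" if x: "x \<in> X" for x
  proof -
    \<comment> \<open>With the empty set as truncation the whole sum is its own tail.\<close>
    have "\<bar>(\<Sum>g\<in>{}. \<phi> (shift_map g (\<xi> x)) - \<phi> (shift_map g x)) - \<Psi> x\<bar> \<le> infsum V UNIV"
      unfolding \<Psi>_def
      by (rule sum_le_infsum_tail[OF V(2) bound[OF x]]) (auto intro!: finite_sum_le_infsum V)
    then show ?thesis by simp
  qed
  then show "\<exists>B. \<forall>x\<in>X. \<Psi> x \<le> B" by blast
qed

text \<open>[v] is cut into finitely many pieces by its K-patterns, on each of which
  \<open>\<psi>\<close> varies by at most e / 2. Local domination with s =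
  \<open>\<psi> (r p) + e / 2\<close> at a representative, and \<open>\<Psi>\<close> at least
  \<open>\<psi> (r p) - e / 2\<close> on the image piece, lose a factor \<open>exp e\<close> in
  total, and e is arbitrary.\<close>

lemma domination_W:
  assumes A: "A \<in> sets \<mu>" "A \<subseteq> W"
  shows "emeasure \<mu> {x \<in> Xv. ov x \<in> A} \<le> (\<integral>\<^sup>+y. ennreal (exp (\<Psi> y)) * indicator A y \<partial>\<mu>)"
proof (rule ennreal_le_exp_epsilon)
  fix e :: real assume e: "0 < e"
  then have "0 < e / 2" by simp
  then obtain K where K: "finite K" "F \<subseteq> K"
    "\<And>x y. x \<in> Xv \<Longrightarrow> y \<in> Xv \<Longrightarrow> (\<forall>k\<in>K. x k = y k) \<Longrightarrow> \<bar>\<psi> x - \<psi> y\<bar> \<le> e / 2"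
    using psi_uniform by blast
  define P where "P = (\<lambda>x. restrict x K) ` Xv"
  have "P \<subseteq> (\<Pi>\<^sub>E k\<in>K. UNIV)" by (auto simp: P_def)
  then have finP: "finite P" by (rule finite_subset) (use K(1) in \<open>auto intro: finite_PiE\<close>)
  define r where "r p = (SOME x. x \<in> Xv \<and> restrict x K = p)" for p
  have r: "r p \<in> Xv" "restrict (r p) K = p" if "p \<in> P" for p
  proof -
    have "\<exists>x. x \<in> Xv \<and> restrict x K = p" using that by (auto simp: P_def)
    then have "r p \<in> Xv \<and> restrict (r p) K = p" unfolding r_def by (rule someI_ex)
    then show "r p \<in> Xv" "restrict (r p) K = p" by auto
  qed
  define U where "U p = {x \<in> X. (\<forall>k\<in>K. x k = r p k) \<and> ov x \<in> A}" for p
  define U' where "U' p = {y \<in> X. (\<forall>k\<in>K. y k = ov (r p) k) \<and> y \<in> A}" for p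
  let ?f = "\<lambda>y. ennreal (exp (\<Psi> y))"
  have fm: "?f \<in> borel_measurable \<mu>" using Psi_measurable by measurable
  have AX: "A \<subseteq> X" using A by (auto simp: W_def Xw_def)
  have Ab: "A \<in> sets borel" using A(1) in_sets_iff by blast
  note cyl = sets_cylinder[OF K(1)]
  have ovA: "ov -` A \<inter> space \<mu> \<in> sets \<mu>" by (rule measurable_sets[OF override_measurable Ab])
  have Us: "U p \<in> sets \<mu>" for p
  proof -
    have "U p = {x \<in> X. \<forall>k\<in>K. x k = r p k} \<inter> (ov -` A \<inter> space \<mu>)" by (auto simp: U_def space_eq)
    then show ?thesis using cyl ovA by simp
  qed
  have U's: "U' p \<in> sets \<mu>" for p
  proof -
    have "U' p = {x \<in> X. \<forall>k\<in>K. x k = ov (r p) k} \<inter> A" by (auto simp: U'_def)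
    then show ?thesis using cyl A(1) by simp
  qed
  have Psi_ge: "\<psi> (r p) - e / 2 \<le> \<Psi> y" if p: "p \<in> P" and y: "y \<in> U' p" for p y
  proof -
    have yW: "y \<in> W" using y A(2) by (auto simp: U'_def)
    have "\<forall>k\<in>K. vo y k = r p k"
      using y r(1)[OF p] by (auto simp: U'_def override_on_def Xv_def)
    then have "\<bar>\<psi> (vo y) - \<psi> (r p)\<bar> \<le> e / 2" by (rule K(3)[OF vo_Xv[OF yW] r(1)[OF p]])
    then show ?thesis unfolding Psi_W[OF yW] by linarith
  qed
  have local: "emeasure \<mu> (U p) \<le> ennreal (exp e) * (\<integral>\<^sup>+y. ?f y * indicator (U' p) y \<partial>\<mu>)" if p: "p \<in> P" for p
  proof -
    have "prob (U p) \<le> exp (\<psi> (r p) + e / 2) * prob (U' p)"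
      unfolding U_def U'_def
    proof (rule local_domination[OF r(1)[OF p] K(1,2) Ab])
      fix x assume x: "x \<in> Xv" "\<forall>k\<in>K. x k = r p k"
      then have "\<bar>\<psi> x - \<psi> (r p)\<bar> \<le> e / 2" by (intro K(3) r(1) p)
      then show "\<psi> x \<le> \<psi> (r p) + e / 2" by linarith
    qed
    then have "emeasure \<mu> (U p) \<le> ennreal (exp (\<psi> (r p) + e / 2) * prob (U' p))"
      unfolding emeasure_eq_measure by (rule ennreal_leI)
    also have "\<dots> = (\<integral>\<^sup>+y. ennreal (exp (\<psi> (r p) + e / 2)) * indicator (U' p) y \<partial>\<mu>)"
      using U's by (simp add: nn_integral_cmult_indicator emeasure_eq_measure ennreal_mult)
    also have "\<dots> \<le> (\<integral>\<^sup>+y. ennreal (exp e) * (?f y * indicator (U' p) y) \<partial>\<mu>)"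
    proof (rule nn_integral_mono)
      fix y
      show "ennreal (exp (\<psi> (r p) + e / 2)) * indicator (U' p) y \<le> ennreal (exp e) * (?f y * indicator (U' p) y)"
      proof (cases "y \<in> U' p")
        case True
        have "exp (\<psi> (r p) + e / 2) \<le> exp e * exp (\<Psi> y)"
          using Psi_ge[OF p True] by (simp add: exp_add[symmetric])
        then have "ennreal (exp (\<psi> (r p) + e / 2)) \<le> ennreal (exp e) * ?f y"
          by (simp add: ennreal_mult[symmetric])
        then show ?thesis using True by simp
      qed simp
    qed
    also have "\<dots> = ennreal (exp e) * (\<integral>\<^sup>+y. ?f y * indicator (U' p) y \<partial>\<mu>)"
      using fm U's by (intro nn_integral_cmult borel_measurable_times_ennreal borel_measurable_indicator)
    finally show ?thesis .
  qed
  have "{x \<in> Xv. ov x \<in> A} \<subseteq> (\<Union>p\<in>P. U p)"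
  proof
    fix x assume x: "x \<in> {x \<in> Xv. ov x \<in> A}"
    let ?p = "restrict x K"
    have p: "?p \<in> P" using x by (auto simp: P_def)
    have "\<forall>k\<in>K. x k = r ?p k" using r(2)[OF p] by (simp only: restrict_eq_iff) auto
    then have "x \<in> U ?p" using x by (auto simp: U_def Xv_def)
    then show "x \<in> (\<Union>p\<in>P. U p)" using p by blast
  qed
  then have "emeasure \<mu> {x \<in> Xv. ov x \<in> A} \<le> emeasure \<mu> (\<Union>p\<in>P. U p)"
    using Us finP by (intro emeasure_mono) auto
  also have "\<dots> \<le> (\<Sum>p\<in>P. emeasure \<mu> (U p))"
    using Us finP by (intro emeasure_subadditive_finite) auto
  also have "\<dots> \<le> (\<Sum>p\<in>P. ennreal (exp e) * (\<integral>\<^sup>+y. ?f y * indicator (U' p) y \<partial>\<mu>))"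
    by (intro sum_mono local)
  also have "\<dots> = ennreal (exp e) * (\<Sum>p\<in>P. \<integral>\<^sup>+y. ?f y * indicator (U' p) y \<partial>\<mu>)"
    by (rule sum_distrib_left[symmetric])
  also have "(\<Sum>p\<in>P. \<integral>\<^sup>+y. ?f y * indicator (U' p) y \<partial>\<mu>)
      = (\<integral>\<^sup>+y. (\<Sum>p\<in>P. ?f y * indicator (U' p) y) \<partial>\<mu>)"
    using fm U's by (intro nn_integral_sum[symmetric] borel_measurable_times_ennreal borel_measurable_indicator)
  also have "ennreal (exp e) * (\<integral>\<^sup>+y. (\<Sum>p\<in>P. ?f y * indicator (U' p) y) \<partial>\<mu>)
      \<le> ennreal (exp e) * (\<integral>\<^sup>+y. ?f y * indicator A y \<partial>\<mu>)"
  proof (intro mult_left_mono nn_integral_mono)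
    fix y
    \<comment> \<open>The pieces \<open>U' p\<close> are disjoint: off F the pattern can be read off
      from y, and on F all representatives carry v.\<close>
    have uniq: "p = p'" if "p \<in> P" "p' \<in> P" "y \<in> U' p" "y \<in> U' p'" for p p'
    proof -
      have "r p k = r p' k" if k: "k \<in> K" for k
      proof (cases "k \<in> F")
        case True
        then show ?thesis using r(1)[OF \<open>p \<in> P\<close>] r(1)[OF \<open>p' \<in> P\<close>] by (simp add: Xv_def)
      next
        case False
        have "y k = ov (r p) k" "y k = ov (r p') k"
          using \<open>y \<in> U' p\<close> \<open>y \<in> U' p'\<close> k unfolding U'_def by blast+
        then show ?thesis using False by simp
      qed
      then have "restrict (r p) K = restrict (r p') K" by (simp only: restrict_eq_iff) blast
      then show ?thesis using r(2) that by metis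
    qed
    show "(\<Sum>p\<in>P. ?f y * indicator (U' p) y) \<le> ?f y * indicator A y"
    proof (cases "\<exists>p\<in>P. y \<in> U' p")
      case True
      then obtain p where p: "p \<in> P" "y \<in> U' p" by blast
      have "(\<Sum>p'\<in>P. ?f y * indicator (U' p') y) = (\<Sum>p'\<in>P. if p' = p then ?f y else 0)"
        by (rule sum.cong[OF refl]) (use uniq p in \<open>auto simp: indicator_def\<close>)
      also have "\<dots> = ?f y" using p(1) finP by simp
      finally show ?thesis using p(2) by (simp add: U'_def)
    next
      case False
      then have "(\<Sum>p\<in>P. ?f y * indicator (U' p) y) = 0" by (intro sum.neutral) auto
      then show ?thesis by simp
    qed
  qed simp
  finally show "emeasure \<mu> {x \<in> Xv. ov x \<in> A} \<le> ennreal (exp e) * (\<integral>\<^sup>+y. ?f y * indicator A y \<partial>\<mu>)" .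
qed

text \<open>The preimage of A consists of points of [v] sent into W, which
  \<open>domination_W\<close> controls, and of fixed points in A - W. At the latter
  \<open>\<Psi>\<close> is 0 and the integrand is 1.\<close>

lemma domination:
  assumes A: "A \<in> sets \<mu>" "A \<subseteq> Xw"
  shows "emeasure \<mu> (\<xi> -` A \<inter> space \<mu>) \<le> (\<integral>\<^sup>+y. ennreal (exp (\<Psi> y)) * indicator A y \<partial>\<mu>)"
proof -
  let ?f = "\<lambda>y. ennreal (exp (\<Psi> y))"
  have fm: "?f \<in> borel_measurable \<mu>" using Psi_measurable by measurable
  have s: "A \<inter> W \<in> sets \<mu>" "A - W \<in> sets \<mu>" using A sets_W by auto
  have pre: "{x \<in> Xv. ov x \<in> A \<inter> W} \<in> sets \<mu>"
  proof -
    have "{x \<in> Xv. ov x \<in> A \<inter> W} = Xv \<inter> (ov -` (A \<inter> W) \<inter> space \<mu>)" by (auto simp: Xv_def space_eq)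
    moreover have "A \<inter> W \<in> sets borel" using s(1) in_sets_iff by blast
    ultimately show ?thesis using sets_Xv measurable_sets[OF override_measurable, of "A \<inter> W"] by auto
  qed
  have "\<xi> -` A \<inter> space \<mu> \<subseteq> {x \<in> Xv. ov x \<in> A \<inter> W} \<union> (A - W)"
  proof
    fix x assume "x \<in> \<xi> -` A \<inter> space \<mu>"
    then have x: "x \<in> X" "\<xi> x \<in> A" by (auto simp: space_eq)
    show "x \<in> {x \<in> Xv. ov x \<in> A \<inter> W} \<union> (A - W)"
    proof (cases "x \<in> Xv")
      case True
      then show ?thesis using x(2) swap_Xv[OF True] ov_W[OF True] by simp
    next
      case nv: False
      show ?thesis
      proof (cases "x \<in> W")
        case True
        then have "vo x \<in> Xw" using x(2) swap_W A(2) by auto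
        \<comment> \<open>A point of W whose image carries both v and w can exist only if the
          patterns coincide.\<close>
        then have "\<forall>f\<in>F. v f = w f" by (auto simp: Xw_def)
        then have "x \<in> Xv" using True by (auto simp: W_def Xw_def Xv_def)
        then show ?thesis using nv by simp
      next
        case False
        then show ?thesis using x swap_other[OF x(1) nv False] by simp
      qed
    qed
  qed
  then have "emeasure \<mu> (\<xi> -` A \<inter> space \<mu>) \<le> emeasure \<mu> ({x \<in> Xv. ov x \<in> A \<inter> W} \<union> (A - W))"
    using pre s by (intro emeasure_mono) auto
  also have "\<dots> \<le> emeasure \<mu> {x \<in> Xv. ov x \<in> A \<inter> W} + emeasure \<mu> (A - W)"
    using pre s by (intro emeasure_subadditive) auto
  also have "emeasure \<mu> {x \<in> Xv. ov x \<in> A \<inter> W} \<le> (\<integral>\<^sup>+y. ?f y * indicator (A \<inter> W) y \<partial>\<mu>)"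
    using s(1) by (rule domination_W) simp
  also have "emeasure \<mu> (A - W) = (\<integral>\<^sup>+y. indicator (A - W) y \<partial>\<mu>)" using s(2) by simp
  also have "\<dots> = (\<integral>\<^sup>+y. ?f y * indicator (A - W) y \<partial>\<mu>)"
  proof (rule nn_integral_cong)
    fix y
    show "indicator (A - W) y = ?f y * indicator (A - W) y"
    proof (cases "y \<in> A - W")
      case True
      then have y: "y \<in> Xw" "y \<notin> W" using A(2) by auto
      have "y \<notin> Xv"
      proof
        assume yv: "y \<in> Xv"
        then have "vo y = y" by (auto simp: Xv_def override_on_def fun_eq_iff)
        then show False using y by (auto simp: W_def Xw_def)
      qed
      then have "\<xi> y = y" using y by (intro swap_other) (auto simp: Xw_def)
      then show ?thesis by (simp add: Psi_fixed)
    qed simp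
  qed
  also have "(\<integral>\<^sup>+y. ?f y * indicator (A \<inter> W) y \<partial>\<mu>) + (\<integral>\<^sup>+y. ?f y * indicator (A - W) y \<partial>\<mu>)
      = (\<integral>\<^sup>+y. ?f y * indicator (A \<inter> W) y + ?f y * indicator (A - W) y \<partial>\<mu>)"
    using fm s by (intro nn_integral_add[symmetric] borel_measurable_times_ennreal borel_measurable_indicator) auto
  also have "\<dots> = (\<integral>\<^sup>+y. ?f y * indicator A y \<partial>\<mu>)"
    by (rule nn_integral_cong) (auto simp: indicator_def)
  finally show ?thesis by (simp add: add_mono)
qed

lemma swap_density_bound:
  defines "\<mu>w \<equiv> restrict_space \<mu> (cylinder X F w)"
    and "\<nu>w \<equiv> restrict_space (image_measure \<mu> \<xi>) (cylinder X F w)"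
  shows "absolutely_continuous \<mu>w \<nu>w"
    and "AE x in \<mu>. x \<in> cylinder X F w \<longrightarrow> RN_deriv \<mu>w \<nu>w x \<le> ennreal (exp (\<Psi> x))"
proof -
  let ?f = "\<lambda>y. ennreal (exp (\<Psi> y))"
  have im: "image_measure \<mu> \<xi> = distr \<mu> \<mu> \<xi>"
    by (rule image_measure_eq_distr[OF swap_measurable]) (simp add: space_eq swap_swap)
  have \<mu>w: "\<mu>w = restrict_space \<mu> Xw" and \<nu>w: "\<nu>w = restrict_space (distr \<mu> \<mu> \<xi>) Xw"
    by (simp_all add: \<mu>w_def \<nu>w_def im cylinder_w)
  have XwX: "Xw \<subseteq> X" by (auto simp: Xw_def)
  have Xws: "Xw \<inter> space \<mu> \<in> sets \<mu>" using sets_Xw by auto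
  have sets_w: "A \<in> sets \<mu>w \<longleftrightarrow> A \<subseteq> Xw \<and> A \<in> sets \<mu>" for A
    unfolding \<mu>w using sets_restrict_space_iff[OF Xws] .
  have sets: "sets \<nu>w = sets \<mu>w" unfolding \<mu>w \<nu>w by (rule sets_restrict_space_cong) simp
  have fm: "?f \<in> borel_measurable \<mu>" using Psi_measurable by measurable
  have fmw: "?f \<in> borel_measurable \<mu>w" unfolding \<mu>w by (rule measurable_restrict_space1[OF fm])
  have le: "emeasure \<nu>w A \<le> (\<integral>\<^sup>+x. ?f x * indicator A x \<partial>\<mu>w)" if "A \<in> sets \<mu>w" for A
  proof -
    have A: "A \<subseteq> Xw" "A \<in> sets \<mu>" using that sets_w by auto
    have "emeasure \<nu>w A = emeasure (distr \<mu> \<mu> \<xi>) A"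
      unfolding \<nu>w by (rule emeasure_restrict_space) (use Xws A in auto)
    also have "\<dots> = emeasure \<mu> (\<xi> -` A \<inter> space \<mu>)" by (rule emeasure_distr[OF swap_measurable A(2)])
    also have "\<dots> \<le> (\<integral>\<^sup>+y. ?f y * indicator A y \<partial>\<mu>)" by (rule domination[OF A(2,1)])
    also have "\<dots> = (\<integral>\<^sup>+y. (?f y * indicator A y) * indicator Xw y \<partial>\<mu>)"
      by (rule nn_integral_cong) (use A(1) in \<open>auto simp: indicator_def\<close>)
    also have "\<dots> = (\<integral>\<^sup>+y. ?f y * indicator A y \<partial>\<mu>w)"
      unfolding \<mu>w by (rule nn_integral_restrict_space[OF Xws, symmetric])
    finally show ?thesis .
  qed
  \<comment> \<open>The integral over a null set is 0, so absolute continuity follows from the same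
    inequality as the density bound.\<close>
  show ac: "absolutely_continuous \<mu>w \<nu>w"
    unfolding absolutely_continuous_def
  proof
    fix A assume A: "A \<in> null_sets \<mu>w"
    then have "(\<integral>\<^sup>+x. ?f x * indicator A x \<partial>\<mu>w) = 0"
      by (intro nn_integral_null_set)
    then have "emeasure \<nu>w A = 0" using le[of A] A by auto
    then show "A \<in> null_sets \<nu>w" using A sets by (auto simp: null_sets_def)
  qed
  \<comment> \<open>Boundedness of \<open>\<Psi>\<close> makes the proposed density integrable, as
    \<open>RN_deriv_le\<close> demands.\<close>
  obtain B where B: "\<And>x. x \<in> X \<Longrightarrow> \<Psi> x \<le> B" using Psi_bounded by blast
  have fin\<mu>w: "finite_measure \<mu>w" unfolding \<mu>w by (rule finite_measure_restrict_space[OF finite_measure_axioms sets_Xw])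
  interpret w: finite_measure \<mu>w by (rule fin\<mu>w)
  have "(\<integral>\<^sup>+x. ?f x \<partial>\<mu>w) \<le> (\<integral>\<^sup>+x. ennreal (exp B) \<partial>\<mu>w)"
    by (intro nn_integral_mono ennreal_leI) (use B XwX in \<open>auto simp: \<mu>w space_restrict_space\<close>)
  also have "\<dots> = ennreal (exp B) * emeasure \<mu>w (space \<mu>w)" by simp
  also have "\<dots> < \<infinity>" by (simp add: w.emeasure_eq_measure ennreal_mult_less_top)
  finally have fin: "(\<integral>\<^sup>+x. ?f x \<partial>\<mu>w) \<noteq> \<infinity>" by simp
  have "AE x in \<mu>w. RN_deriv \<mu>w \<nu>w x \<le> ?f x"
    by (rule RN_deriv_le[OF w.sigma_finite_measure_axioms ac sets fmw fin le])
  then show "AE x in \<mu>. x \<in> cylinder X F w \<longrightarrow> RN_deriv \<mu>w \<nu>w x \<le> ?f x"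
    unfolding cylinder_w unfolding \<mu>w by (simp add: AE_restrict_space_iff[OF Xws])
qed

end

theorem theorem3:
  fixes X :: "('g::{group_add, countable} \<Rightarrow> 'a::{finite, discrete_topology}) set"
    and F :: "'g set"
    and v w :: "'g \<Rightarrow> 'a"
    and \<phi> :: "('g \<Rightarrow> 'a) \<Rightarrow> real"
    and \<mu> :: "('g \<Rightarrow> 'a) measure"
  defines "\<xi> \<equiv> swap_map X F v w"
    and "\<mu>w \<equiv> restrict_space \<mu> (cylinder X F w)"
    and "\<nu>w \<equiv> restrict_space (image_measure \<mu> (swap_map X F v w)) (cylinder X F w)"
  assumes "amenable TYPE('g)"
    and "subshift X"
    and "finite F"
    and "v \<in> language X F"
    and "w \<in> language X F"
    and "summable_variation X \<phi>"
    and "equilibrium_state X \<phi> \<mu>"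
    and "extender_set X F v \<subseteq> extender_set X F w"
  shows "absolutely_continuous \<mu>w \<nu>w \<and>
    (AE x in \<mu>. x \<in> cylinder X F w \<longrightarrow>
       RN_deriv \<mu>w \<nu>w x
         \<le> ennreal (exp (\<Sum>\<^sub>\<infinity>g. (\<phi> (shift_map g (\<xi> x)) - \<phi> (shift_map g x)))))"
proof -
  interpret swap_equilibrium X F v w \<phi> \<mu>
  proof (rule swap_equilibrium.intro)
    show "v \<in> extensional F" "w \<in> extensional F"
      using assms(7,8) by (auto simp: language_def)
    \<comment> \<open>A point x showing v is v followed by its own restriction to the complement of
      F, so that restriction is an extender of v and hence of w.\<close>
    fix x assume x: "x \<in> X" "\<And>f. f \<in> F \<Longrightarrow> x f = v f"
    have "override_on x v F = x" using x(2) by (auto simp: override_on_def fun_eq_iff)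
    then have "restrict x (- F) \<in> extender_set X F v"
      using x(1) by (simp add: extender_set_def override_restrict)
    then have "restrict x (- F) \<in> extender_set X F w" using assms(11) by blast
    then show "override_on x w F \<in> X" by (simp add: extender_set_def override_restrict)
  qed (use assms in auto)
  show ?thesis
    using swap_density_bound unfolding \<Psi>_def \<xi>_def \<mu>w_def \<nu>w_def by blast
qed

end
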